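(* Let $f$ and $g$ be two elements of Thompson's group $F$ that are conjugate in $\mathrm{PL}^+(0,1)$. Then $f$ and $g$ are conjugate in $F$ if and only if $\Delta_f=\Delta_g$, where $\Delta$ is the quantity defined in the context.
   Context: **Groups.** For an open interval $(a,b)$, $\mathrm{PL}^+(a,b)$ is the group (under composition) of piecewise linear order-preserving homeomorphisms of $(a,b)$ with finitely many nodes, where a node of $f$ is a point at which $f$ is not locally affine. Thompson's group $F$ is the subgroup of $\mathrm{PL}^+(0,1)$ of those $f$ all of whose nodes lie in $\mathbb{Z}[\frac12]$ and for which $f'(x)$ is an integer power of $2$ whenever $x$ is not a node. Dyadic means lying in $\mathbb{Z}[\frac12]$. For a piecewise linear map $k$ from one interval $(a,b)$ to another, the initial slope of $k$ is its derivative at any point between $a$ and the first node, and the final slope is its derivative at any point between the last node and $b$. **Intervals.** For $f\in\mathrm{PL}^+(0,1)$ let $\epsilon_f(x)=1,0,-1$ according as $f(x)>x$, $f(x)=x$, $f(x)<x$, and let $\mathrm{fix}(f)$ be the set of fixed points of $f$ in $(0,1)$. Let $I_1,\dots,I_m$, with $I_j=(p_{j-1},p_j)$, $p_0=0$, $p_m=1$, be the connected components, from left to right, of $(0,1)$ minus the topological boundary of $\mathrm{fix}(f)$ in $(0,1)$; $\epsilon_f$ is constant on each $I_j$. $I_j$ is a bump domain of $f$ if $\epsilon_f\ne0$ on $I_j$. **Finite functions.** A finite function is a function $[0,1)\to\mathbb{R}^+$ equal to $1$ at all but finitely many points; $c_1,c_2$ are equivalent if $c_1=c_2\circ\rho$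 for some translation $\rho$ of $[0,1)$ modulo $1$. Let $I_j$ be a bump domain of $f$ and suppose first that $f(x)>x$ on $I_j$. For $x\in I_j$ put $f^*(x)=f'_+(x)/f'_-(x)$ (ratio of right to left derivative) and $\phi_{f,j}(x)=\prod_{n=-\infty}^{\infty}f^*(f^n(x))$ (only finitely many factors differ from $1$). Let $p$ be the smallest node of $f$ in $I_j$ and $p_*$ the smallest node of $f$ in $I_j$ with $\phi_{f,j}(p_* )\neq1$ (such a node exists). For $s\in[0,1)$ put $\psi_{f,j}(s)=\phi_{f,j}(\lambda^s(r-p_{j-1})+p_{j-1})$, where $\lambda$ is the initial slope of $f$ in $I_j$ and $r$ is any point of $(p_{j-1},p)$ of the form $r=f^n(p_* )$ with $n$ a negative integer. The finite-function class of $f$ on $I_j$ is $[\psi_{f,j}]$. If $f(x)<x$ on $I_j$, it is $[\psi_{f^{-1},j}]$ (with $\lambda$, $p$, $p_*$ taken for $f^{-1}$). **Minimum cornered function.** Let $D=(a,b)$ be a bump domain of $f$. A cornered function in $\mathrm{PL}^+(a,b)$ is an $l\in\mathrm{PL}^+(a,b)$ such that either $l(y)>y$ for all $y\in(a,b)$ and there is $x\in(a,b)$ with all nodes of $l$ in $(x,l(x))$, or $l(y)<y$ for all $y\in(a,b)$ and there is $x\in(a,b)$ with all nodes of $l$ in $(l(x),x)$. Such an $l$ corresponds to the finite function $c$ if $\psi_l=c$, where $\psi_l$ is defined as follows. If $l(y)>y$ on $(a,b)$, put $l^*(x)=l'_+(x)/l'_-(x)$ and $\phi_l(x)=\prod_{n=-\infty}^{\infty}l^*(l^n(x))$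 for $x\in(a,b)$, let $q$ be the smallest node of $l$ in $(a,b)$ and $q_*$ the smallest node of $l$ in $(a,b)$ with $\phi_l(q_* )\ne1$, and put $\psi_l(s)=\phi_l(\lambda^s(r-a)+a)$ for $s\in[0,1)$, where $\lambda$ is the initial slope of $l$ and $r$ is any point of $(a,q)$ of the form $r=l^n(q_* )$ with $n$ a negative integer. If $l(y)<y$ on $(a,b)$, put $\psi_l=\psi_{l^{-1}}$. For a given initial slope there is a unique cornered function in $\mathrm{PL}^+(a,b)$ corresponding to a given such $c$. Let $[c]$ be the finite-function class of $f$ on $D$ and let $C=\{c_1\in[c]: c_1(0)\ne1\}$. For distinct $c_1,c_2\in C$, let $x$ be the smallest value with $c_1(x)\ne c_2(x)$, and write $c_1<c_2$ if $c_1(x)<c_2(x)$. Let $c_m$ be the minimum of $C$. The minimum cornered function associated with $f$ over $D$ is the cornered function in $\mathrm{PL}^+(a,b)$ that corresponds to $c_m$ and whose initial slope is the initial slope of $f$ in $D$. **The quantity $\Delta_f$ (for $f\in F$).** A bump chain of $f$ is a run of consecutive intervals $I_t,I_{t+1},\dots,I_u$, all bump domains, such that of the points $p_{t-1},p_t,\dots,p_u$ exactly $p_{t-1}$ and $p_u$ are dyadic. Let $D_1,\dots,D_s$ be a bump chain, $D_j=(a_j,b_j)$, $w_j=b_j-a_j$, $f_j=f|_{D_j}$. It is known (Brin and Squier) that the centralizer of $f_j$ in $\mathrm{PL}^+(a_j,b_j)$ is infinite cyclic, generated by a root $\widehat{f_j}$ of $f_j$; let $\lambda_j$ and $\mu_j$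 be the initial and final slopes of $\widehat{f_j}$. Let $k_j\in\mathrm{PL}^+(a_j,b_j)$ be any element such that $k_jf_jk_j^{-1}$ is the minimum cornered function associated with $f$ over $D_j$, and let $\alpha_j$ and $\beta_j$ be the initial and final slopes of $k_j$. Define an equivalence relation on $\mathbb{R}^s$ by $(x_1,\dots,x_s)\sim(y_1,\dots,y_s)$ if and only if there are integers $m,n_1,\dots,n_s$ with $$2^mx_1=\lambda_1^{n_1}y_1,\qquad \mu_{i-1}^{n_{i-1}}x_i=\lambda_i^{n_i}y_i\quad(i=2,\dots,s).$$ Assign to the chain the equivalence class of $$\left(\frac{\alpha_1}{w_1},\ \frac{\alpha_2}{w_2}\frac{w_1}{\beta_1},\ \dots,\ \frac{\alpha_s}{w_s}\frac{w_{s-1}}{\beta_{s-1}}\right).$$ $\Delta_f$ is the ordered list (left to right) of these equivalence classes, one per bump chain of $f$. *)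

theory Defs
  imports "HOL-Analysis.Analysis" "HOL-Library.FuncSet" "HOL-Library.Groups_Big_Fun"
begin

section \<open>The groups\<close>

definition nodes :: "real \<Rightarrow> real \<Rightarrow> (real \<Rightarrow> real) \<Rightarrow> real set" where
  "nodes a b f = {x \<in> {a<..<b}. \<not> (\<exists>m c. \<forall>\<^sub>F y in nhds x. f y = m * y + c)}"

text \<open>
  A self-map of an open interval is encoded as a function on all reals that is the identity off
  that interval. The elements of the groups below are thus permutations of the reals: the group
  operation is composition, the unit is \<^const>\<open>id\<close>, inverses are given by \<open>inv\<close>, and equality
  in the group is equality of functions.
\<close>

definition PL_plus :: "real \<Rightarrow> real \<Rightarrow> (real \<Rightarrow> real) set" where
  "PL_plus a b = {f. (\<forall>x. x \<notin> {a<..<b} \<longrightarrow> f x = x)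
                   \<and> (\<exists>g. homeomorphism {a<..<b} {a<..<b} f g)
                   \<and> strict_mono_on {a<..<b} f
                   \<and> finite (nodes a b f)}"

definition dyadic :: "real \<Rightarrow> bool" where
  "dyadic x \<longleftrightarrow> (\<exists>(m::int) (n::nat). x = of_int m / 2 ^ n)"

definition thompson_F :: "(real \<Rightarrow> real) set" where
  "thompson_F = {f \<in> PL_plus 0 1. (\<forall>x \<in> nodes 0 1 f. dyadic x)
     \<and> (\<forall>x \<in> {0<..<1} - nodes 0 1 f. \<exists>k::int. (f has_real_derivative 2 powi k) (at x))}"

definition conjugate_in :: "(real \<Rightarrow> real) set \<Rightarrow> (real \<Rightarrow> real) \<Rightarrow> (real \<Rightarrow> real) \<Rightarrow> bool" where
  "conjugate_in G f g \<longleftrightarrow> (\<exists>h \<in> G. g = h \<circ> f \<circ> inv h)"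

definition int_iter :: "('a \<Rightarrow> 'a) \<Rightarrow> int \<Rightarrow> 'a \<Rightarrow> 'a" where
  "int_iter f n = (if n \<ge> 0 then f ^^ nat n else inv f ^^ nat (- n))"

text \<open>The choice of the point is immaterial, \<open>k\<close> being affine before its first and after its last
  node; a map without nodes is covered too.\<close>

definition initial_slope :: "real \<Rightarrow> real \<Rightarrow> (real \<Rightarrow> real) \<Rightarrow> real" where
  "initial_slope a b k = deriv k (SOME x. x \<in> {a<..<b} \<and> (\<forall>q \<in> nodes a b k. x < q))"

definition final_slope :: "real \<Rightarrow> real \<Rightarrow> (real \<Rightarrow> real) \<Rightarrow> real" where
  "final_slope a b k = deriv k (SOME x. x \<in> {a<..<b} \<and> (\<forall>q \<in> nodes a b k. q < x))"

section \<open>Bump domains\<close>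

definition fixset :: "(real \<Rightarrow> real) \<Rightarrow> real set" where
  "fixset f = {x \<in> {0<..<1}. f x = x}"

definition bump_domain :: "(real \<Rightarrow> real) \<Rightarrow> real \<Rightarrow> real \<Rightarrow> bool" where
  "bump_domain f a b \<longleftrightarrow>
     {a<..<b} \<in> components ({0<..<1} - top_of_set {0<..<1} frontier_of fixset f)
     \<and> (\<forall>x \<in> {a<..<b}. f x \<noteq> x)"

section \<open>Finite functions\<close>

definition finite_functions :: "(real \<Rightarrow> real) set" where
  "finite_functions = {c \<in> {0..<1} \<rightarrow>\<^sub>E {0<..}. finite {s \<in> {0..<1}. c s \<noteq> 1}}"

definition ff_class :: "(real \<Rightarrow> real) \<Rightarrow> (real \<Rightarrow> real) set" where
  "ff_class c = {c1 \<in> finite_functions. \<exists>t. \<forall>s \<in> {0..<1}. c1 s = c (frac (s + t))}"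

definition jump_ratio :: "(real \<Rightarrow> real) \<Rightarrow> real \<Rightarrow> real" where
  "jump_ratio f x = vector_derivative f (at_right x) / vector_derivative f (at_left x)"

definition phi :: "(real \<Rightarrow> real) \<Rightarrow> real \<Rightarrow> real" where
  "phi f x = Prod_any (\<lambda>n::int. jump_ratio f (int_iter f n x))"

definition psi_up :: "real \<Rightarrow> real \<Rightarrow> (real \<Rightarrow> real) \<Rightarrow> real \<Rightarrow> real" where
  "psi_up a b f =
     (let p = Min (nodes a b f);
          ps = Min {q \<in> nodes a b f. phi f q \<noteq> 1};
          r = (SOME r. r \<in> {a<..<p} \<and> (\<exists>n<0. r = int_iter f n ps));
          lam = initial_slope a b f
      in (\<lambda>s \<in> {0..<1}. phi f (lam powr s * (r - a) + a)))"

text \<open>Used both for an element of \<open>PL_plus 0 1\<close> on one of its bump domains \<open>(a, b)\<close> and for a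
  cornered function in \<open>PL_plus a b\<close>; in either case \<open>f x - x\<close> has constant nonzero sign
  on \<open>(a, b)\<close>.\<close>

definition psi :: "real \<Rightarrow> real \<Rightarrow> (real \<Rightarrow> real) \<Rightarrow> real \<Rightarrow> real" where
  "psi a b f = (if \<forall>x \<in> {a<..<b}. f x > x then psi_up a b f else psi_up a b (inv f))"

section \<open>The minimum cornered function\<close>

definition cornered :: "real \<Rightarrow> real \<Rightarrow> (real \<Rightarrow> real) set" where
  "cornered a b = {l \<in> PL_plus a b.
      (\<forall>y \<in> {a<..<b}. l y > y) \<and> (\<exists>x \<in> {a<..<b}. nodes a b l \<subseteq> {x<..<l x})
    \<or> (\<forall>y \<in> {a<..<b}. l y < y) \<and> (\<exists>x \<in> {a<..<b}. nodes a b l \<subseteq> {l x<..<x})}"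

definition ff_less :: "(real \<Rightarrow> real) \<Rightarrow> (real \<Rightarrow> real) \<Rightarrow> bool" where
  "ff_less c1 c2 \<longleftrightarrow> (\<exists>x \<in> {0..<1}. c1 x < c2 x \<and> (\<forall>y \<in> {0..<x}. c1 y = c2 y))"

definition min_ff :: "(real \<Rightarrow> real) \<Rightarrow> real \<Rightarrow> real \<Rightarrow> real \<Rightarrow> real" where
  "min_ff f a b =
     (let C = {c \<in> ff_class (psi a b f). c 0 \<noteq> 1}
      in THE c. c \<in> C \<and> (\<forall>c' \<in> C. c' \<noteq> c \<longrightarrow> ff_less c c'))"

definition min_cornered :: "(real \<Rightarrow> real) \<Rightarrow> real \<Rightarrow> real \<Rightarrow> real \<Rightarrow> real" where
  "min_cornered f a b = (THE l. l \<in> cornered a b \<and> psi a b l = min_ff f a b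
     \<and> initial_slope a b l = initial_slope a b f)"

section \<open>The invariant\<close>

definition restr :: "(real \<Rightarrow> real) \<Rightarrow> real \<Rightarrow> real \<Rightarrow> real \<Rightarrow> real" where
  "restr f a b x = (if x \<in> {a<..<b} then f x else x)"

definition centralizer :: "real \<Rightarrow> real \<Rightarrow> (real \<Rightarrow> real) \<Rightarrow> (real \<Rightarrow> real) set" where
  "centralizer a b f = {h \<in> PL_plus a b. h \<circ> f = f \<circ> h}"

definition root_gen :: "(real \<Rightarrow> real) \<Rightarrow> real \<Rightarrow> real \<Rightarrow> real \<Rightarrow> real" where
  "root_gen f a b = (SOME h. h \<in> PL_plus a b
     \<and> centralizer a b (restr f a b) = range (int_iter h)
     \<and> (\<exists>n::nat. n > 0 \<and> h ^^ n = restr f a b))"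

text \<open>Any conjugator may be taken: two of them differ by an element of the centralizer, which does
  not change the equivalence class below.\<close>

definition conj_to_min :: "(real \<Rightarrow> real) \<Rightarrow> real \<Rightarrow> real \<Rightarrow> real \<Rightarrow> real" where
  "conj_to_min f a b =
     (SOME k. k \<in> PL_plus a b \<and> k \<circ> restr f a b \<circ> inv k = min_cornered f a b)"

text \<open>A chain is the list of its bump domains, each given by its pair of end points; two of the
  intervals \<open>(p\<^sub>j\<^sub>-\<^sub>1, p\<^sub>j)\<close> are consecutive iff they share an end point.\<close>

definition bump_chain :: "(real \<Rightarrow> real) \<Rightarrow> (real \<times> real) list \<Rightarrow> bool" where
  "bump_chain f C \<longleftrightarrow> C \<noteq> []
     \<and> (\<forall>(a, b) \<in> set C. bump_domain f a b)
     \<and> (\<forall>i. Suc i < length C \<longrightarrow> snd (C ! i) = fst (C ! Suc i) \<and> \<not> dyadic (snd (C ! i)))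
     \<and> dyadic (fst (hd C)) \<and> dyadic (snd (last C))"

definition lam :: "(real \<Rightarrow> real) \<Rightarrow> real \<times> real \<Rightarrow> real" where
  "lam f = (\<lambda>(a, b). initial_slope a b (root_gen f a b))"

definition mu :: "(real \<Rightarrow> real) \<Rightarrow> real \<times> real \<Rightarrow> real" where
  "mu f = (\<lambda>(a, b). final_slope a b (root_gen f a b))"

definition alpha :: "(real \<Rightarrow> real) \<Rightarrow> real \<times> real \<Rightarrow> real" where
  "alpha f = (\<lambda>(a, b). initial_slope a b (conj_to_min f a b))"

definition beta :: "(real \<Rightarrow> real) \<Rightarrow> real \<times> real \<Rightarrow> real" where
  "beta f = (\<lambda>(a, b). final_slope a b (conj_to_min f a b))"

definition width :: "real \<times> real \<Rightarrow> real" where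
  "width = (\<lambda>(a, b). b - a)"

text \<open>Vectors in $\mathbb{R}^s$ are lists of length \<open>s\<close>, indexed from 0.\<close>

definition chain_rel :: "(real \<Rightarrow> real) \<Rightarrow> (real \<times> real) list \<Rightarrow> (real list \<times> real list) set" where
  "chain_rel f C = {(x, y). length x = length C \<and> length y = length C
     \<and> (\<exists>(m::int) (n::nat \<Rightarrow> int).
          2 powi m * x ! 0 = lam f (C ! 0) powi n 0 * y ! 0
        \<and> (\<forall>i. Suc i < length C \<longrightarrow>
             mu f (C ! i) powi n i * x ! Suc i = lam f (C ! Suc i) powi n (Suc i) * y ! Suc i))}"

definition chain_vec :: "(real \<Rightarrow> real) \<Rightarrow> (real \<times> real) list \<Rightarrow> real list" where
  "chain_vec f C = map (\<lambda>i. alpha f (C ! i) / width (C ! i)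
       * (if i = 0 then 1 else width (C ! (i - 1)) / beta f (C ! (i - 1)))) [0..<length C]"

text \<open>Distinct chains have distinct left end points, so sorting by left end point lists the chains
  from left to right.\<close>

definition Delta :: "(real \<Rightarrow> real) \<Rightarrow> real list set list" where
  "Delta f = map (\<lambda>C. chain_rel f C `` {chain_vec f C})
     (sorted_key_list_of_set (\<lambda>C. fst (hd C)) {C. bump_chain f C})"

end

theory Submission
  imports Defs
begin

text \<open>
  On a bump domain a map \<open>f\<close> with \<open>f x > x\<close> is linear near the left end point with slope \<open>\<lambda> > 1\<close>. A
  piecewise linear conjugator \<open>k\<close> from \<open>f\<close> to \<open>l\<close> is determined by its initial slope, and the chain rule
  along orbits gives \<open>phi l (k x) = phi f x\<close>. Hence the finite-function class is a conjugacy
  invariant, the initial slopes of the centralizer form a discrete group, and the minimum cornered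
  function exists and depends, up to rescaling, on the conjugacy class only. Consequently the pairs
  of end slopes of the conjugators between corresponding bumps of \<open>f\<close> and \<open>g\<close> are exactly
  \<open>(\<alpha>/w \<cdot> w'/\<alpha>' \<cdot> \<lambda>\<^sup>n, \<beta>/w \<cdot> w'/\<beta>' \<cdot> \<mu>\<^sup>n)\<close> with \<open>n\<close> an integer.

  A conjugator between elements of \<open>F\<close> whose germs are dyadic near the left end of a bump is
  dyadic on the whole bump, since the germs are carried along by \<open>f\<close> and \<open>g\<close>. So it lies in \<open>F\<close> as
  soon as it starts each chain with a power of 2 and has no node at the non-dyadic points inside a
  chain; these are the equations which define the equivalence relation. Between dyadic fixed points
  nothing has to be matched.
\<close>

section \<open>Piecewise linear homeomorphisms of the real line\<close>

text \<open>The conjugator \<open>h\<close> given in PL^+(0,1) need not respect dyadic points, so a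
  priori it matches only the bump domains of \<open>f\<close> and \<open>g\<close>, not their bump
  chains. Equality of the lists \<open>Delta f\<close> and \<open>Delta g\<close> supplies the rest:
  a class consists of vectors of one length, so it remembers how many bumps its chain has, and two
  lists of blocks with the same concatenation and the same block lengths agree. The quotient
  \<alpha>/w in the invariant has a simple origin. The minimum cornered functions of conjugate bumps
  are conjugate by the affine map between the two intervals, whose slope is w'/w, and every
  conjugator of the bumps is a power of the root, followed by k, this affine map and the inverse of
  k'. The analysis is carried out with homeomorphisms of the whole line: a bump is then a property
  of a map and two of its fixed points, maps between different intervals compose freely, and
  one-sided slopes exist at end points as well. Decreasing bumps are reduced to increasing ones by
  inversion.\<close>

definition pl_at :: "(real \<Rightarrow> real) \<Rightarrow> real \<Rightarrow> real \<Rightarrow> real \<Rightarrow> bool" where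
  "pl_at f x m n \<longleftrightarrow> (\<exists>e>0. \<forall>h. \<bar>h\<bar> < e \<longrightarrow> f (x + h) = f x + (if h < 0 then m else n) * h)"

definition left_slope :: "(real \<Rightarrow> real) \<Rightarrow> real \<Rightarrow> real" where
  "left_slope f x = vector_derivative f (at_left x)"

definition right_slope :: "(real \<Rightarrow> real) \<Rightarrow> real \<Rightarrow> real" where
  "right_slope f x = vector_derivative f (at_right x)"

text \<open>No bound on the number of nodes is imposed. The germ condition makes them locally
  finite, and compactness turns this into finiteness on bounded intervals, see
  \<open>finite_jumps\<close>; elements of \<open>PL_plus a b\<close> and affine maps thus live in
  one class closed under composition.\<close>

definition PL_real :: "(real \<Rightarrow> real) set" where
  "PL_real = {f. strict_mono f \<and> surj f \<and> (\<forall>x. \<exists>m n. pl_at f x m n)}"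

lemma jump_ratio_slopes: "jump_ratio f x = right_slope f x / left_slope f x"
  by (simp add: jump_ratio_def left_slope_def right_slope_def)

lemma left_slope_eqI:
  assumes "e > 0" and eq: "\<And>h. -e < h \<Longrightarrow> h \<le> 0 \<Longrightarrow> f (x + h) = f x + m * h"
  shows "left_slope f x = m"
proof -
  have "((\<lambda>y. f x + m * (y - x)) has_real_derivative m) (at x within {..<x})"
    by (auto intro!: derivative_eq_intros)
  then have d: "((\<lambda>y. f x + m * (y - x)) has_vector_derivative m) (at x within {..<x})"
    by (simp add: has_real_derivative_iff_has_vector_derivative)
  have "\<forall>\<^sub>F y in nhds x. dist y x < e"
    using eventually_nhds_metric[of "\<lambda>y. dist y x < e" x] \<open>e > 0\<close> by blast
  then have "\<forall>\<^sub>F y in nhds x. y \<in> {..<x} \<longrightarrow> f x + m * (y - x) = f y"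
  proof eventually_elim
    case (elim y)
    then show ?case using eq[of "y - x"] by (auto simp: dist_real_def)
  qed
  then have "(f has_vector_derivative m) (at x within {..<x})"
    using d by (subst (asm) has_vector_derivative_cong_ev[where g=f]) auto
  then show ?thesis unfolding left_slope_def
    by (intro vector_derivative_within) (simp_all add: trivial_limit_at_left_real)
qed

lemma right_slope_eqI:
  assumes "e > 0" and eq: "\<And>h. 0 \<le> h \<Longrightarrow> h < e \<Longrightarrow> f (x + h) = f x + n * h"
  shows "right_slope f x = n"
proof -
  have "((\<lambda>y. f x + n * (y - x)) has_real_derivative n) (at x within {x<..})"
    by (auto intro!: derivative_eq_intros)
  then have d: "((\<lambda>y. f x + n * (y - x)) has_vector_derivative n) (at x within {x<..})"
    by (simp add: has_real_derivative_iff_has_vector_derivative)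
  have "\<forall>\<^sub>F y in nhds x. dist y x < e"
    using eventually_nhds_metric[of "\<lambda>y. dist y x < e" x] \<open>e > 0\<close> by blast
  then have "\<forall>\<^sub>F y in nhds x. y \<in> {x<..} \<longrightarrow> f x + n * (y - x) = f y"
  proof eventually_elim
    case (elim y)
    then show ?case using eq[of "y - x"] by (auto simp: dist_real_def)
  qed
  then have "(f has_vector_derivative n) (at x within {x<..})"
    using d by (subst (asm) has_vector_derivative_cong_ev[where g=f]) auto
  then show ?thesis unfolding right_slope_def
    by (intro vector_derivative_within) (simp_all add: trivial_limit_at_right_real)
qed

lemma pl_at_slopes:
  assumes "pl_at f x m n" shows "left_slope f x = m" "right_slope f x = n"
proof -
  from assms obtain e where "e > 0"
    and e: "\<And>h. \<bar>h\<bar> < e \<Longrightarrow> f (x + h) = f x + (if h < 0 then m else n) * h"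
    unfolding pl_at_def by blast
  show "left_slope f x = m"
    by (rule left_slope_eqI[OF \<open>e > 0\<close>]) (auto simp: e)
  show "right_slope f x = n"
    by (rule right_slope_eqI[OF \<open>e > 0\<close>]) (auto simp: e)
qed

lemma PL_realD:
  assumes "f \<in> PL_real"
  shows "strict_mono f" "surj f" "bij f" "inj f" "pl_at f x (left_slope f x) (right_slope f x)"
    "f (inv f y) = y" "inv f (f x) = x" "f x < f y \<longleftrightarrow> x < y" "f x \<le> f y \<longleftrightarrow> x \<le> y"
    "f x = f y \<longleftrightarrow> x = y"
proof -
  show *: "strict_mono f" "surj f" using assms by (auto simp: PL_real_def)
  then show **: "inj f" by (simp add: strict_mono_imp_inj_on)
  with * show "bij f" by (simp add: bij_def)
  obtain m n where "pl_at f x m n" using assms unfolding PL_real_def by blast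
  with pl_at_slopes[OF this] show "pl_at f x (left_slope f x) (right_slope f x)" by simp
  show "f (inv f y) = y" "inv f (f x) = x" using * ** by (auto simp: surj_f_inv_f)
  show "f x < f y \<longleftrightarrow> x < y" "f x \<le> f y \<longleftrightarrow> x \<le> y" "f x = f y \<longleftrightarrow> x = y"
    using * by (auto simp: strict_mono_less strict_mono_less_eq strict_mono_eq)
qed

lemma PL_real_local:
  assumes "f \<in> PL_real"
  obtains e where "e > 0" "\<And>y. x - e < y \<Longrightarrow> y \<le> x \<Longrightarrow> f y = f x + left_slope f x * (y - x)"
    "\<And>y. x \<le> y \<Longrightarrow> y < x + e \<Longrightarrow> f y = f x + right_slope f x * (y - x)"
proof -
  from PL_realD(5)[OF assms, of x] obtain e where "e > 0"
    and e: "\<And>h. \<bar>h\<bar> < e \<Longrightarrow> f (x + h) = f x + (if h < 0 then left_slope f x else right_slope f x) * h"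
    unfolding pl_at_def by blast
  show ?thesis
  proof (rule that[OF \<open>e > 0\<close>])
    fix y assume "x - e < y" "y \<le> x"
    then show "f y = f x + left_slope f x * (y - x)" using e[of "y - x"] by auto
  next
    fix y assume "x \<le> y" "y < x + e"
    then show "f y = f x + right_slope f x * (y - x)" using e[of "y - x"] by auto
  qed
qed

lemma slopes_pos:
  assumes "f \<in> PL_real" shows "left_slope f x > 0" "right_slope f x > 0"
proof -
  obtain e where "e > 0" and e: "\<And>y. x - e < y \<Longrightarrow> y \<le> x \<Longrightarrow> f y = f x + left_slope f x * (y - x)"
    "\<And>y. x \<le> y \<Longrightarrow> y < x + e \<Longrightarrow> f y = f x + right_slope f x * (y - x)"
    using PL_real_local[OF assms] by blast
  have "f (x - e/2) < f x" "f x < f (x + e/2)" using PL_realD(8)[OF assms] \<open>e > 0\<close> by auto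
  with e(1)[of "x - e/2"] e(2)[of "x + e/2"] \<open>e > 0\<close>
  show "left_slope f x > 0" "right_slope f x > 0"
    by (auto simp: mult_less_0_iff zero_less_mult_iff)
qed

lemma slope_neq_0 [simp]:
  assumes "f \<in> PL_real" shows "left_slope f x \<noteq> 0" "right_slope f x \<noteq> 0"
  using slopes_pos[OF assms, of x] by auto

lemma jump_ratio_pos: "f \<in> PL_real \<Longrightarrow> jump_ratio f x > 0"
  by (simp add: jump_ratio_slopes slopes_pos)

lemma jump_ratio_eq_1: "f \<in> PL_real \<Longrightarrow> jump_ratio f x = 1 \<longleftrightarrow> left_slope f x = right_slope f x"
  by (auto simp: jump_ratio_slopes)

section \<open>Closure under composition and inversion\<close>

text \<open>Both slopes are positive, so a one-sided germ is carried to a germ on the same side and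
  left slopes meet only left slopes.\<close>

lemma pl_at_comp:
  assumes "pl_at f x m n" "m > 0" "n > 0" "pl_at g (f x) m' n'"
  shows "pl_at (g \<circ> f) x (m' * m) (n' * n)"
proof -
  from assms obtain e where "e > 0"
    and e: "\<And>h. \<bar>h\<bar> < e \<Longrightarrow> f (x + h) = f x + (if h < 0 then m else n) * h"
    unfolding pl_at_def by blast
  from assms obtain d where "d > 0"
    and d: "\<And>h. \<bar>h\<bar> < d \<Longrightarrow> g (f x + h) = g (f x) + (if h < 0 then m' else n') * h"
    unfolding pl_at_def by blast
  \<comment> \<open>The sum m + n bounds both slopes at once, so the displacement in the image stays
    below d on either side.\<close>
  define c where "c = min e (d / (m + n))"
  have "c > 0" using \<open>e > 0\<close> \<open>d > 0\<close> assms by (simp add: c_def)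
  have "(g \<circ> f) (x + h) = (g \<circ> f) x + (if h < 0 then m' * m else n' * n) * h" if h: "\<bar>h\<bar> < c" for h
  proof -
    let ?k = "(if h < 0 then m else n) * h"
    have "\<bar>h\<bar> < d / (m + n)" using h by (simp add: c_def)
    then have "(m + n) * \<bar>h\<bar> < d" using assms by (simp add: field_simps)
    moreover have "\<bar>?k\<bar> \<le> (m + n) * \<bar>h\<bar>" using assms by (auto simp: abs_mult intro!: mult_right_mono)
    ultimately have "g (f x + ?k) = g (f x) + (if ?k < 0 then m' else n') * ?k" by (intro d) linarith
    moreover have "f (x + h) = f x + ?k" using h by (intro e) (simp add: c_def)
    moreover have "?k < 0 \<longleftrightarrow> h < 0" using assms by (auto simp: mult_less_0_iff)
    ultimately show ?thesis by auto
  qed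
  with \<open>c > 0\<close> show ?thesis unfolding pl_at_def by blast
qed

lemma PL_real_comp:
  assumes "f \<in> PL_real" "g \<in> PL_real"
  shows "g \<circ> f \<in> PL_real" "left_slope (g \<circ> f) x = left_slope g (f x) * left_slope f x"
    "right_slope (g \<circ> f) x = right_slope g (f x) * right_slope f x"
proof -
  have *: "pl_at (g \<circ> f) x (left_slope g (f x) * left_slope f x) (right_slope g (f x) * right_slope f x)" for x
    using assms by (intro pl_at_comp PL_realD slopes_pos)
  show "left_slope (g \<circ> f) x = left_slope g (f x) * left_slope f x"
    "right_slope (g \<circ> f) x = right_slope g (f x) * right_slope f x"
    using pl_at_slopes[OF *[of x]] by auto
  have "strict_mono (g \<circ> f)"
    using assms by (auto simp: strict_mono_def PL_realD(8))
  moreover have "surj (g \<circ> f)" using PL_realD(2)[OF assms(1)] PL_realD(2)[OF assms(2)] by (rule comp_surj)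
  ultimately show "g \<circ> f \<in> PL_real" using * unfolding PL_real_def by blast
qed

lemma PL_real_affine:
  assumes "m > 0"
  shows "(\<lambda>y. m * y + c) \<in> PL_real" "left_slope (\<lambda>y. m * y + c) x = m"
    "right_slope (\<lambda>y. m * y + c) x = m"
proof -
  have *: "pl_at (\<lambda>y. m * y + c) x m m" for x
    unfolding pl_at_def by (intro exI[of _ 1]) (auto simp: algebra_simps)
  show "left_slope (\<lambda>y. m * y + c) x = m" "right_slope (\<lambda>y. m * y + c) x = m"
    using pl_at_slopes[OF *[of x]] by auto
  have "surj (\<lambda>y. m * y + c)"
    by (rule surjI[of _ "\<lambda>z. (z - c) / m"]) (use assms in auto)
  then show "(\<lambda>y. m * y + c) \<in> PL_real"
    using assms * unfolding PL_real_def strict_mono_def by (blast intro: add_strict_right_mono mult_strict_left_mono)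
qed

lemma PL_real_id: "id \<in> PL_real" "left_slope id x = 1" "right_slope id x = 1"
  using PL_real_affine[of 1 0] by (auto simp: id_def)

lemma pl_at_inv:
  assumes "f \<in> PL_real"
  shows "pl_at (inv f) (f x) (1 / left_slope f x) (1 / right_slope f x)"
proof -
  let ?m = "left_slope f x" and ?n = "right_slope f x"
  obtain e where "e > 0"
    and e: "\<And>h. \<bar>h\<bar> < e \<Longrightarrow> f (x + h) = f x + (if h < 0 then ?m else ?n) * h"
    using PL_realD(5)[OF assms, of x] unfolding pl_at_def by blast
  note pos = slopes_pos[OF assms, of x]
  define c where "c = e * min ?m ?n"
  have "c > 0" using \<open>e > 0\<close> pos by (simp add: c_def)
  have "inv f (f x + h) = inv f (f x) + (if h < 0 then 1 / ?m else 1 / ?n) * h" if h: "\<bar>h\<bar> < c" for h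
  proof -
    let ?k = "(if h < 0 then 1 / ?m else 1 / ?n) * h"
    have "c \<le> e * ?m" "c \<le> e * ?n" using \<open>e > 0\<close> by (auto simp: c_def)
    then have "\<bar>?k\<bar> < e" using h pos by (auto simp: abs_mult field_simps)
    then have "f (x + ?k) = f x + (if ?k < 0 then ?m else ?n) * ?k" by (rule e)
    also have "\<dots> = f x + h" using pos by (auto simp: divide_less_0_iff)
    finally have "inv f (f x + h) = x + ?k" using PL_realD(7)[OF assms, of "x + ?k"] by simp
    then show ?thesis using PL_realD(7)[OF assms] by simp
  qed
  with \<open>c > 0\<close> show ?thesis unfolding pl_at_def by blast
qed

lemma PL_real_inv:
  assumes "f \<in> PL_real"
  shows "inv f \<in> PL_real" "left_slope (inv f) (f x) = 1 / left_slope f x"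
    "right_slope (inv f) (f x) = 1 / right_slope f x"
proof -
  show "left_slope (inv f) (f x) = 1 / left_slope f x"
    "right_slope (inv f) (f x) = 1 / right_slope f x"
    using pl_at_slopes[OF pl_at_inv[OF assms, of x]] by auto
  have "inv f y < inv f z" if "y < z" for y z
    using that PL_realD(8)[OF assms, of "inv f y" "inv f z"] by (simp add: PL_realD(6)[OF assms])
  moreover have "surj (inv f)" using PL_realD(3)[OF assms] by (simp add: bij_imp_bij_inv bij_is_surj)
  moreover have "\<exists>m n. pl_at (inv f) y m n" for y
    using pl_at_inv[OF assms, of "inv f y"] by (auto simp: PL_realD(6)[OF assms])
  ultimately show "inv f \<in> PL_real" by (auto simp: PL_real_def strict_mono_def)
qed

lemma PL_real_inv_less:
  assumes "f \<in> PL_real"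
  shows "inv f y < x \<longleftrightarrow> y < f x" "x < inv f y \<longleftrightarrow> f x < y" "inv f y \<le> x \<longleftrightarrow> y \<le> f x"
    "x \<le> inv f y \<longleftrightarrow> f x \<le> y" "inv f y = x \<longleftrightarrow> y = f x"
  using PL_realD(8)[OF assms, of "inv f y" x] PL_realD(8)[OF assms, of x "inv f y"]
    PL_realD(9)[OF assms, of "inv f y" x] PL_realD(9)[OF assms, of x "inv f y"]
    PL_realD(10)[OF assms, of "inv f y" x]
  by (auto simp: PL_realD(6)[OF assms])

lemma PL_real_funpow: "f \<in> PL_real \<Longrightarrow> f ^^ n \<in> PL_real"
  by (induction n) (auto simp: PL_real_id PL_real_comp)

lemma PL_real_int_iter: "f \<in> PL_real \<Longrightarrow> int_iter f n \<in> PL_real"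
  by (simp add: int_iter_def PL_real_funpow PL_real_inv)

section \<open>Local comparison and gluing\<close>

lemma left_slope_cong:
  assumes "u < x" "\<And>y. u < y \<Longrightarrow> y \<le> x \<Longrightarrow> f y = g y" "g \<in> PL_real"
  shows "left_slope f x = left_slope g x"
proof -
  obtain e where "e > 0" and e: "\<And>y. x - e < y \<Longrightarrow> y \<le> x \<Longrightarrow> g y = g x + left_slope g x * (y - x)"
    using PL_real_local[OF assms(3)] by metis
  show ?thesis
  proof (rule left_slope_eqI)
    show "min e (x - u) > 0" using \<open>e > 0\<close> assms by simp
    fix h assume "- min e (x - u) < h" "h \<le> 0"
    then show "f (x + h) = f x + left_slope g x * h" using e[of "x + h"] assms by auto
  qed
qed

lemma right_slope_cong:
  assumes "x < v" "\<And>y. x \<le> y \<Longrightarrow> y < v \<Longrightarrow> f y = g y" "g \<in> PL_real"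
  shows "right_slope f x = right_slope g x"
proof -
  obtain e where "e > 0" and e: "\<And>y. x \<le> y \<Longrightarrow> y < x + e \<Longrightarrow> g y = g x + right_slope g x * (y - x)"
    using PL_real_local[OF assms(3)] by metis
  show ?thesis
  proof (rule right_slope_eqI)
    show "min e (v - x) > 0" using \<open>e > 0\<close> assms by simp
    fix h assume "0 \<le> h" "h < min e (v - x)"
    then show "f (x + h) = f x + right_slope g x * h" using e[of "x + h"] assms by auto
  qed
qed

lemma strict_mono_surj_continuous:
  fixes f :: "real \<Rightarrow> real"
  assumes "strict_mono f" "surj f" shows "continuous_on S f"
proof -
  have "continuous_on UNIV f"
    using assms by (intro continuous_onI_mono) (auto simp: strict_mono_less_eq)
  then show ?thesis using continuous_on_subset by blast
qed

lemma PL_real_continuous: "f \<in> PL_real \<Longrightarrow> continuous_on S f"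
  by (simp add: PL_realD strict_mono_surj_continuous)

text \<open>Each side may be compared with a different known map. Both comparisons include the point
  x itself, so the two germs share the value at x and no separate continuity argument is
  needed.\<close>

lemma PL_realI:
  assumes "strict_mono f" "surj f"
    and l: "\<And>x. \<exists>g\<in>PL_real. \<exists>u<x. \<forall>y. u < y \<and> y \<le> x \<longrightarrow> f y = g y"
    and r: "\<And>x. \<exists>g\<in>PL_real. \<exists>v>x. \<forall>y. x \<le> y \<and> y < v \<longrightarrow> f y = g y"
  shows "f \<in> PL_real"
proof -
  have "\<exists>m n. pl_at f x m n" for x
  proof -
    obtain g u where g: "g \<in> PL_real" "u < x" "\<And>y. u < y \<Longrightarrow> y \<le> x \<Longrightarrow> f y = g y" using l by metis
    obtain k v where k: "k \<in> PL_real" "x < v" "\<And>y. x \<le> y \<Longrightarrow> y < v \<Longrightarrow> f y = k y" using r by metis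
    obtain d where d: "d > 0" "\<And>y. x - d < y \<Longrightarrow> y \<le> x \<Longrightarrow> g y = g x + left_slope g x * (y - x)"
      using PL_real_local[OF g(1)] by metis
    obtain e where e: "e > 0" "\<And>y. x \<le> y \<Longrightarrow> y < x + e \<Longrightarrow> k y = k x + right_slope k x * (y - x)"
      using PL_real_local[OF k(1)] by metis
    define c where "c = Min {d, e, x - u, v - x}"
    have c: "c > 0" "c \<le> d" "c \<le> e" "c \<le> x - u" "c \<le> v - x"
      using g k d(1) e(1) by (auto simp: c_def)
    have fx: "f x = g x" "f x = k x" using g(2) g(3)[of x] k(2) k(3)[of x] by simp_all
    have "f (x + h) = f x + (if h < 0 then left_slope g x else right_slope k x) * h" if h: "\<bar>h\<bar> < c" for h
    proof (cases "h < 0")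
      case True
      then have "f (x + h) = g (x + h)" "g (x + h) = g x + left_slope g x * h"
        using h c g(3)[of "x + h"] d(2)[of "x + h"] by auto
      with fx(1) True show ?thesis by simp
    next
      case False
      then have "f (x + h) = k (x + h)" "k (x + h) = k x + right_slope k x * h"
        using h c k(3)[of "x + h"] e(2)[of "x + h"] by auto
      with fx(2) False show ?thesis by simp
    qed
    with c(1) show ?thesis unfolding pl_at_def by blast
  qed
  with assms(1,2) show ?thesis unfolding PL_real_def by blast
qed

lemma PL_real_glue:
  assumes "f \<in> PL_real" "g \<in> PL_real" "f z = g z"
  shows "(\<lambda>y. if y \<le> z then f y else g y) \<in> PL_real" (is "?h \<in> _")
proof (rule PL_realI)
  have "?h x < ?h y" if "x < y" for x y
  proof -
    consider "y \<le> z" | "x \<le> z" "z < y" | "z < x" using that by linarith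
    then show ?thesis
    proof cases
      case 2
      then have "f x \<le> f z" "g z < g y" using PL_realD(9)[OF assms(1), of x z] PL_realD(8)[OF assms(2), of z y] by auto
      with 2 assms(3) show ?thesis by simp
    qed (use that PL_realD(8) assms in auto)
  qed
  then show "strict_mono ?h" by (simp add: strict_mono_def)
  have "\<exists>x. y = ?h x" for y
  proof (cases "y \<le> f z")
    case True
    then have "inv f y \<le> z" "f (inv f y) = y" using PL_realD(6) PL_real_inv_less assms(1) by auto
    then show ?thesis by (intro exI[of _ "inv f y"]) simp
  next
    case False
    then have "\<not> inv g y \<le> z" "g (inv g y) = y" using PL_realD(6) PL_real_inv_less assms by auto
    then show ?thesis by (intro exI[of _ "inv g y"]) simp
  qed
  then show "surj ?h" unfolding surj_def by blast
  show "\<exists>k\<in>PL_real. \<exists>u<x. \<forall>y. u < y \<and> y \<le> x \<longrightarrow> ?h y = k y" for x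
  proof (cases "x \<le> z")
    case True
    then show ?thesis using assms by (intro bexI[of _ f] exI[of _ "x - 1"]) auto
  next
    case False
    then show ?thesis using assms by (intro bexI[of _ g] exI[of _ z]) auto
  qed
  show "\<exists>k\<in>PL_real. \<exists>v>x. \<forall>y. x \<le> y \<and> y < v \<longrightarrow> ?h y = k y" for x
  proof (cases "x < z")
    case True
    then show ?thesis using assms by (intro bexI[of _ f] exI[of _ z]) auto
  next
    case False
    then have "?h y = g y" if "x \<le> y" for y using that assms(3) by (cases "y = z") auto
    then show ?thesis using assms by (intro bexI[of _ g] exI[of _ "x + 1"]) auto
  qed
qed

lemma PL_real_restr:
  assumes "f \<in> PL_real" "a < b" "f a = a" "f b = b"
  shows "restr f a b \<in> PL_real"
proof -
  let ?g = "\<lambda>y. if y \<le> b then f y else id y"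
  have "?g \<in> PL_real" by (rule PL_real_glue[OF assms(1) PL_real_id(1)]) (use assms in simp)
  then have "(\<lambda>y. if y \<le> a then id y else ?g y) \<in> PL_real"
    by (rule PL_real_glue[OF PL_real_id(1)]) (use assms in simp)
  also have "(\<lambda>y. if y \<le> a then id y else ?g y) = restr f a b"
    using assms by (auto simp: restr_def fun_eq_iff)
  finally show ?thesis .
qed

section \<open>Jumps and nodes\<close>

text \<open>Read backwards, this gives the one-sided slopes at an exceptional point from those at
  ordinary points nearby, which is how slopes at nodes and end points are later seen to be powers of
  2.\<close>

lemma slopes_near:
  assumes "f \<in> PL_real"
  obtains e where "e > 0"
    "\<And>y. x - e < y \<Longrightarrow> y < x \<Longrightarrow> left_slope f y = left_slope f x \<and> right_slope f y = left_slope f x"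
    "\<And>y. x < y \<Longrightarrow> y < x + e \<Longrightarrow> left_slope f y = right_slope f x \<and> right_slope f y = right_slope f x"
proof -
  obtain e where "e > 0" and l: "\<And>y. x - e < y \<Longrightarrow> y \<le> x \<Longrightarrow> f y = f x + left_slope f x * (y - x)"
    and r: "\<And>y. x \<le> y \<Longrightarrow> y < x + e \<Longrightarrow> f y = f x + right_slope f x * (y - x)"
    using PL_real_local[OF assms] by blast
  show ?thesis
  proof (rule that[OF \<open>e > 0\<close>])
    fix y assume y: "x - e < y" "y < x"
    have *: "f (y + h) = f y + left_slope f x * h" if "x - e < y + h" "y + h \<le> x" for h
      using y l[of y] l[of "y + h"] that by (simp add: algebra_simps)
    have "left_slope f y = left_slope f x"
      by (rule left_slope_eqI[of "y - x + e"]) (use y in \<open>auto intro!: *\<close>)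
    moreover have "right_slope f y = left_slope f x"
      by (rule right_slope_eqI[of "x - y"]) (use y in \<open>auto intro!: *\<close>)
    ultimately show "left_slope f y = left_slope f x \<and> right_slope f y = left_slope f x" ..
  next
    fix y assume y: "x < y" "y < x + e"
    have *: "f (y + h) = f y + right_slope f x * h" if "x \<le> y + h" "y + h < x + e" for h
      using y r[of y] r[of "y + h"] that by (simp add: algebra_simps)
    have "left_slope f y = right_slope f x"
      by (rule left_slope_eqI[of "y - x"]) (use y in \<open>auto intro!: *\<close>)
    moreover have "right_slope f y = right_slope f x"
      by (rule right_slope_eqI[of "x + e - y"]) (use y in \<open>auto intro!: *\<close>)
    ultimately show "left_slope f y = right_slope f x \<and> right_slope f y = right_slope f x" ..
  qed
qed

lemma no_jumps_near:
  assumes "f \<in> PL_real"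
  obtains e where "e > 0" "\<And>y. y \<noteq> x \<Longrightarrow> \<bar>y - x\<bar> < e \<Longrightarrow> jump_ratio f y = 1"
proof -
  obtain e where "e > 0"
    "\<And>y. x - e < y \<Longrightarrow> y < x \<Longrightarrow> left_slope f y = left_slope f x \<and> right_slope f y = left_slope f x"
    "\<And>y. x < y \<Longrightarrow> y < x + e \<Longrightarrow> left_slope f y = right_slope f x \<and> right_slope f y = right_slope f x"
    using slopes_near[OF assms] by blast
  then show ?thesis using assms
    by (intro that[of e]) (auto simp: jump_ratio_eq_1 abs_if neq_iff split: if_splits)
qed

lemma finite_jumps:
  assumes "f \<in> PL_real" shows "finite {x \<in> {a..b}. jump_ratio f x \<noteq> 1}"
proof (rule ccontr)
  let ?S = "{x \<in> {a..b}. jump_ratio f x \<noteq> 1}"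
  assume "infinite ?S"
  moreover have "?S \<subseteq> {a..b}" by auto
  ultimately obtain x where "x islimpt ?S"
    using compact_eq_Bolzano_Weierstrass[of "{a..b}"] by auto
  obtain e where "e > 0" and e: "\<And>y. y \<noteq> x \<Longrightarrow> \<bar>y - x\<bar> < e \<Longrightarrow> jump_ratio f y = 1"
    using no_jumps_near[OF assms] by blast
  from \<open>x islimpt ?S\<close> \<open>e > 0\<close> obtain y where "y \<in> ?S" "y \<noteq> x" "dist y x < e"
    unfolding islimpt_approachable by blast
  with e[of y] show False by (auto simp: dist_real_def)
qed

text \<open>An affine germ determines its two coefficients, so the points with a given germ form an
  open and closed subset of the open interval; connectedness makes the germ constant, and continuity
  extends the formula to the end points.\<close>

lemma locally_affine_imp_affine:
  fixes f :: "real \<Rightarrow> real"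
  assumes "u < v" "continuous_on {u..v} f"
    and loc: "\<And>y. u < y \<Longrightarrow> y < v \<Longrightarrow> \<exists>m c. \<forall>\<^sub>F z in nhds y. f z = m * z + c"
  obtains m c where "\<And>y. u \<le> y \<Longrightarrow> y \<le> v \<Longrightarrow> f y = m * y + c"
proof -
  have germ: "m = m' \<and> c = c'"
    if "\<forall>\<^sub>F z in nhds y. f z = m * z + c" "\<forall>\<^sub>F z in nhds y. f z = m' * z + c'" for m m' c c' y
  proof -
    have "\<forall>\<^sub>F z in nhds y. m * z + c = m' * z + c'" using that by eventually_elim auto
    then obtain d where "d > 0" and d: "\<And>z. dist z y < d \<Longrightarrow> m * z + c = m' * z + c'"
      unfolding eventually_nhds_metric by blast
    define h where "h = d / 2"
    have "m * y + c = m' * y + c'" "m * (y + h) + c = m' * (y + h) + c'"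
      using \<open>d > 0\<close> by (auto intro!: d simp: dist_real_def h_def)
    moreover from this have "(m - m') * h = 0" by algebra
    ultimately show ?thesis using \<open>d > 0\<close> by (simp add: h_def)
  qed
  define y0 where "y0 = (u + v) / 2"
  have y0: "u < y0" "y0 < v" using assms(1) by (auto simp: y0_def)
  obtain m c where mc: "\<forall>\<^sub>F z in nhds y0. f z = m * z + c" using loc[OF y0] by blast
  have *: "\<forall>\<^sub>F z in nhds y. f z = m * z + c" if y: "u < y" "y < v" for y
  proof (rule connected_induction_simple[of "{u<..<v}" y0 y "\<lambda>y. \<forall>\<^sub>F z in nhds y. f z = m * z + c"])
    fix a assume a: "a \<in> {u<..<v}"
    then obtain m1 c1 where 1: "\<forall>\<^sub>F z in nhds a. f z = m1 * z + c1" using loc by force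
    then have "\<forall>\<^sub>F w in nhds a. \<forall>\<^sub>F z in nhds w. f z = m1 * z + c1" by (simp add: eventually_eventually)
    then obtain S where S: "open S" "a \<in> S" "\<And>w. w \<in> S \<Longrightarrow> \<forall>\<^sub>F z in nhds w. f z = m1 * z + c1"
      unfolding eventually_nhds[of _ a] by blast
    have "\<forall>x\<in>{u<..<v} \<inter> S. \<forall>y\<in>{u<..<v} \<inter> S. (\<forall>\<^sub>F z in nhds x. f z = m * z + c) \<longrightarrow>
       (\<forall>\<^sub>F z in nhds y. f z = m * z + c)"
      using S(3) germ by blast
    then show "\<exists>T. openin (top_of_set {u<..<v}) T \<and> a \<in> T \<and>
       (\<forall>x\<in>T. \<forall>y\<in>T. (\<forall>\<^sub>F z in nhds x. f z = m * z + c) \<longrightarrow> (\<forall>\<^sub>F z in nhds y. f z = m * z + c))"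
      using S a by (intro exI[of _ "{u<..<v} \<inter> S"]) (auto simp: openin_open)
  qed (use y0 y mc in auto)
  have cl: "closure {u<..<v} = {u..v}" using assms(1) by simp
  have "f y - m * y - c = 0" if "y \<in> {u..v}" for y
  proof (rule continuous_constant_on_closure[of "{u<..<v}" "\<lambda>y. f y - m * y - c" 0])
    show "continuous_on (closure {u<..<v}) (\<lambda>y. f y - m * y - c)"
      unfolding cl by (intro continuous_intros assms)
    fix x assume "x \<in> {u<..<v}"
    then have "\<forall>\<^sub>F z in nhds x. f z = m * z + c" by (intro *) auto
    then show "f x - m * x - c = 0" using eventually_nhds_x_imp_x by fastforce
  qed (use that cl in auto)
  then show ?thesis by (intro that[of m c]) fastforce
qed

text \<open>Turns the nodes of the definition into points with a nontrivial
  \<open>jump_ratio\<close>, a multiplicative quantity that obeys the chain rule.\<close>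

lemma locally_affine_iff:
  assumes "f \<in> PL_real"
  shows "(\<exists>m c. \<forall>\<^sub>F y in nhds x. f y = m * y + c) \<longleftrightarrow> jump_ratio f x = 1"
proof
  assume "\<exists>m c. \<forall>\<^sub>F y in nhds x. f y = m * y + c"
  then obtain m c d where "d > 0" and d: "\<And>z. dist z x < d \<Longrightarrow> f z = m * z + c"
    unfolding eventually_nhds_metric by blast
  have "left_slope f x = m" "right_slope f x = m"
    using d[of x] \<open>d > 0\<close>
    by (auto intro!: left_slope_eqI[of d] right_slope_eqI[of d] simp: d dist_real_def algebra_simps)
  then show "jump_ratio f x = 1" using jump_ratio_eq_1[OF assms] by simp
next
  assume "jump_ratio f x = 1"
  then have eq: "left_slope f x = right_slope f x" using jump_ratio_eq_1[OF assms] by simp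
  obtain e where "e > 0" and e: "\<And>y. x - e < y \<Longrightarrow> y \<le> x \<Longrightarrow> f y = f x + left_slope f x * (y - x)"
    "\<And>y. x \<le> y \<Longrightarrow> y < x + e \<Longrightarrow> f y = f x + right_slope f x * (y - x)"
    using PL_real_local[OF assms] by blast
  have "f y = right_slope f x * y + (f x - right_slope f x * x)" if "dist y x < e" for y
    using that e(1)[of y] e(2)[of y] eq by (cases "y \<le> x") (auto simp: dist_real_def algebra_simps)
  then show "\<exists>m c. \<forall>\<^sub>F y in nhds x. f y = m * y + c"
    using \<open>e > 0\<close> unfolding eventually_nhds_metric by blast
qed

lemma nodes_PL_real: "f \<in> PL_real \<Longrightarrow> nodes a b f = {x \<in> {a<..<b}. jump_ratio f x \<noteq> 1}"
  by (simp add: nodes_def locally_affine_iff)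

lemma finite_nodes: "f \<in> PL_real \<Longrightarrow> finite (nodes a b f)"
  by (rule finite_subset[OF _ finite_jumps[of f a b]]) (auto simp: nodes_PL_real)

lemma no_jump_affine:
  assumes "f \<in> PL_real" "u < v" "\<And>x. u < x \<Longrightarrow> x < v \<Longrightarrow> jump_ratio f x = 1"
  shows "u \<le> y \<Longrightarrow> y \<le> v \<Longrightarrow> f y = f u + right_slope f u * (y - u)"
    "u \<le> y \<Longrightarrow> y < v \<Longrightarrow> right_slope f y = right_slope f u"
    "u < y \<Longrightarrow> y \<le> v \<Longrightarrow> left_slope f y = right_slope f u"
proof -
  obtain m c where mc: "\<And>y. u \<le> y \<Longrightarrow> y \<le> v \<Longrightarrow> f y = m * y + c"
  proof (rule locally_affine_imp_affine[of u v f])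
    show "continuous_on {u..v} f" by (simp add: PL_real_continuous assms)
  qed (use assms locally_affine_iff in auto)
  have r: "right_slope f y = m" if "u \<le> y" "y < v" for y
    using that by (intro right_slope_eqI[of "v - y"]) (auto simp: mc algebra_simps)
  have l: "left_slope f y = m" if "u < y" "y \<le> v" for y
    using that by (intro left_slope_eqI[of "y - u"]) (auto simp: mc algebra_simps)
  have "right_slope f u = m" using r[of u] assms(2) by auto
  with mc r l assms(2) show "u \<le> y \<Longrightarrow> y \<le> v \<Longrightarrow> f y = f u + right_slope f u * (y - u)"
    "u \<le> y \<Longrightarrow> y < v \<Longrightarrow> right_slope f y = right_slope f u"
    "u < y \<Longrightarrow> y \<le> v \<Longrightarrow> left_slope f y = right_slope f u"
    by (auto simp: algebra_simps)
qed

section \<open>The groups PL^+(a,b) as sets of maps of the line\<close>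

text \<open>Finiteness of the nodes is recovered from compactness in one direction. In the other it
  provides, on each side of a point, a last or next node up to which the map is affine; off the
  interval the comparison map is \<open>id\<close>.\<close>

lemma PL_plus_iff:
  assumes "a < b"
  shows "f \<in> PL_plus a b \<longleftrightarrow> f \<in> PL_real \<and> (\<forall>x. x \<notin> {a<..<b} \<longrightarrow> f x = x)"
proof
  assume f: "f \<in> PL_real \<and> (\<forall>x. x \<notin> {a<..<b} \<longrightarrow> f x = x)"
  then have fP: "f \<in> PL_real" and id: "\<And>x. x \<notin> {a<..<b} \<Longrightarrow> f x = x" by auto
  have mem: "f x \<in> {a<..<b} \<longleftrightarrow> x \<in> {a<..<b}" for x
    using PL_realD(8)[OF fP, of a x] PL_realD(8)[OF fP, of x b] id[of a] id[of b] by auto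
  have "homeomorphism {a<..<b} {a<..<b} f (inv f)"
  proof (rule homeomorphismI)
    show "f ` {a<..<b} \<subseteq> {a<..<b}" using mem by blast
    show "inv f ` {a<..<b} \<subseteq> {a<..<b}" using mem PL_realD(6)[OF fP] by (metis image_subsetI)
  qed (use fP in \<open>auto simp: PL_real_continuous PL_real_inv PL_realD\<close>)
  then show "f \<in> PL_plus a b"
    using id finite_nodes[OF fP] PL_realD(8)[OF fP]
    unfolding PL_plus_def by (blast intro: strict_mono_onI)
next
  assume "f \<in> PL_plus a b"
  then obtain g where id: "\<And>x. x \<notin> {a<..<b} \<Longrightarrow> f x = x" and hom: "homeomorphism {a<..<b} {a<..<b} f g"
    and mono: "strict_mono_on {a<..<b} f" and fin: "finite (nodes a b f)"
    unfolding PL_plus_def by blast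
  have img: "f ` {a<..<b} = {a<..<b}" using hom by (simp add: homeomorphism_def)
  have "f x < f y" if "x < y" for x y
  proof (cases "x \<in> {a<..<b}"; cases "y \<in> {a<..<b}")
    assume "x \<in> {a<..<b}" "y \<in> {a<..<b}"
    then show ?thesis using mono that by (simp add: strict_mono_on_def)
  next
    assume "x \<in> {a<..<b}" "y \<notin> {a<..<b}"
    moreover then have "f x \<in> {a<..<b}" using img by blast
    ultimately show ?thesis using that id[of y] by auto
  next
    assume "x \<notin> {a<..<b}" "y \<in> {a<..<b}"
    moreover then have "f y \<in> {a<..<b}" using img by blast
    ultimately show ?thesis using that id[of x] by auto
  qed (use that id in auto)
  then have sm: "strict_mono f" by (simp add: strict_mono_def)
  have "\<exists>x. y = f x" for y
  proof (cases "y \<in> {a<..<b}")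
    case True
    then have "y \<in> f ` {a<..<b}" using img by simp
    then show ?thesis by blast
  next
    case False
    then show ?thesis using id[of y] by metis
  qed
  then have su: "surj f" unfolding surj_def by blast
  have cont: "continuous_on S f" for S by (rule strict_mono_surj_continuous[OF sm su])
  have loc: "\<exists>m c. m > 0 \<and> (\<forall>y. u \<le> y \<and> y \<le> v \<longrightarrow> f y = m * y + c)"
    if uv: "u < v" "{u<..<v} \<inter> nodes a b f = {}" "{u<..<v} \<subseteq> {a<..<b}" for u v
  proof -
    obtain m c where mc: "\<And>y. u \<le> y \<Longrightarrow> y \<le> v \<Longrightarrow> f y = m * y + c"
    proof (rule locally_affine_imp_affine[of u v f])
      fix y assume "u < y" "y < v"
      then have "y \<in> {u<..<v}" by simp
      then show "\<exists>m c. \<forall>\<^sub>F z in nhds y. f z = m * z + c"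
        using uv unfolding nodes_def by blast
    qed (use uv cont in auto)
    moreover have "m > 0"
    proof -
      have "f u < f v" using sm uv by (simp add: strict_mono_def)
      then have "0 < m * (v - u)" using mc[of u] mc[of v] uv by (auto simp: algebra_simps)
      then show ?thesis using uv by (simp add: zero_less_mult_iff)
    qed
    ultimately show ?thesis by blast
  qed
  have "f \<in> PL_real"
  proof (rule PL_realI[OF sm su])
    fix x
    show "\<exists>g\<in>PL_real. \<exists>u<x. \<forall>y. u < y \<and> y \<le> x \<longrightarrow> f y = g y"
    proof (cases "a < x \<and> x \<le> b")
      case True
      \<comment> \<open>The end point a serves as a sentinel when x has no node to its left.\<close>
      define u where "u = Max ((nodes a b f \<union> {a}) \<inter> {..<x})"
      have ne: "finite ((nodes a b f \<union> {a}) \<inter> {..<x})" "(nodes a b f \<union> {a}) \<inter> {..<x} \<noteq> {}"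
        using fin True by auto
      have "u \<in> (nodes a b f \<union> {a}) \<inter> {..<x}" unfolding u_def by (rule Max_in[OF ne])
      moreover have "a \<le> u" unfolding u_def by (rule Max_ge[OF ne(1)]) (use True in auto)
      moreover have "y \<le> u" if "y \<in> nodes a b f" "y < x" for y
        unfolding u_def by (rule Max_ge[OF ne(1)]) (use that in auto)
      ultimately have "u < x" "{u<..<x} \<inter> nodes a b f = {}" "{u<..<x} \<subseteq> {a<..<b}"
        using True by force+
      from loc[OF this] obtain m c where "m > 0" "\<And>y. u \<le> y \<Longrightarrow> y \<le> x \<Longrightarrow> f y = m * y + c" by blast
      then show ?thesis using \<open>u < x\<close> PL_real_affine(1)
        by (intro bexI[of _ "\<lambda>y. m * y + c"] exI[of _ u]) auto
    next
      case False
      then consider "x \<le> a" | "b < x" by linarith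
      then show ?thesis
      proof cases
        case 1
        then show ?thesis using id PL_real_id(1) by (intro bexI[of _ id] exI[of _ "x - 1"]) auto
      next
        case 2
        then show ?thesis using id PL_real_id(1) by (intro bexI[of _ id] exI[of _ b]) auto
      qed
    qed
    show "\<exists>g\<in>PL_real. \<exists>v>x. \<forall>y. x \<le> y \<and> y < v \<longrightarrow> f y = g y"
    proof (cases "a \<le> x \<and> x < b")
      case True
      define v where "v = Min ((nodes a b f \<union> {b}) \<inter> {x<..})"
      have ne: "finite ((nodes a b f \<union> {b}) \<inter> {x<..})" "(nodes a b f \<union> {b}) \<inter> {x<..} \<noteq> {}"
        using fin True by auto
      have "v \<in> (nodes a b f \<union> {b}) \<inter> {x<..}" unfolding v_def by (rule Min_in[OF ne])
      moreover have "v \<le> b" unfolding v_def by (rule Min_le[OF ne(1)]) (use True in auto)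
      moreover have "v \<le> y" if "y \<in> nodes a b f" "x < y" for y
        unfolding v_def by (rule Min_le[OF ne(1)]) (use that in auto)
      ultimately have "x < v" "{x<..<v} \<inter> nodes a b f = {}" "{x<..<v} \<subseteq> {a<..<b}"
        using True by force+
      from loc[OF this] obtain m c where "m > 0" "\<And>y. x \<le> y \<Longrightarrow> y \<le> v \<Longrightarrow> f y = m * y + c" by blast
      then show ?thesis using \<open>x < v\<close> PL_real_affine(1)
        by (intro bexI[of _ "\<lambda>y. m * y + c"] exI[of _ v]) auto
    next
      case False
      then consider "x < a" | "b \<le> x" by linarith
      then show ?thesis
      proof cases
        case 1
        then show ?thesis using id PL_real_id(1) by (intro bexI[of _ id] exI[of _ a]) auto
      next
        case 2
        then show ?thesis using id PL_real_id(1) by (intro bexI[of _ id] exI[of _ "x + 1"]) auto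
      qed
    qed
  qed
  with id show "f \<in> PL_real \<and> (\<forall>x. x \<notin> {a<..<b} \<longrightarrow> f x = x)" by blast
qed

lemma deriv_PL_real:
  assumes "f \<in> PL_real" "jump_ratio f x = 1"
  shows "(f has_real_derivative right_slope f x) (at x)"
proof -
  have eq: "left_slope f x = right_slope f x" using assms jump_ratio_eq_1 by blast
  obtain e where "e > 0" and e: "\<And>y. x - e < y \<Longrightarrow> y \<le> x \<Longrightarrow> f y = f x + left_slope f x * (y - x)"
    "\<And>y. x \<le> y \<Longrightarrow> y < x + e \<Longrightarrow> f y = f x + right_slope f x * (y - x)"
    using PL_real_local[OF assms(1)] by blast
  have d: "((\<lambda>y. f x + right_slope f x * (y - x)) has_real_derivative right_slope f x) (at x)"
    by (auto intro!: derivative_eq_intros)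
  have *: "f x + right_slope f x * (y - x) = f y" if "y \<in> {x - e<..<x + e}" for y
  proof (cases "y \<le> x")
    case True
    then show ?thesis using that e(1)[of y] unfolding eq by simp
  next
    case False
    then show ?thesis using that e(2)[of y] by simp
  qed
  show ?thesis
    by (rule has_field_derivative_transform_within_open[OF d, of "{x - e<..<x + e}"])
      (use \<open>e > 0\<close> * in auto)
qed

text \<open>Between a and the first node the map is affine, so every point that may be chosen has
  the slope of the right germ at a. A map of the whole line has this germ although a lies outside
  the interval.\<close>

lemma initial_slope_PL_real:
  assumes "f \<in> PL_real" "a < b" shows "initial_slope a b f = right_slope f a"
proof -
  let ?P = "\<lambda>x. x \<in> {a<..<b} \<and> (\<forall>q\<in>nodes a b f. x < q)"
  define x where "x = (SOME x. ?P x)"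
  obtain e where "e > 0" and e: "\<And>y. y \<noteq> a \<Longrightarrow> \<bar>y - a\<bar> < e \<Longrightarrow> jump_ratio f y = 1"
    using no_jumps_near[OF assms(1)] by blast
  obtain h where h: "0 < h" "h < e" "h < b - a"
    using field_lbound_gt_zero[of e "b - a"] \<open>e > 0\<close> assms(2) by auto
  have "a + h < q" if "q \<in> nodes a b f" for q
    using that e[of q] h by (force simp: nodes_PL_real[OF assms(1)])
  then have "?P (a + h)" using h by auto
  then have x: "?P x" unfolding x_def by (rule someI)
  have nj: "jump_ratio f y = 1" if "a < y" "y \<le> x" for y
    using x that by (force simp: nodes_PL_real[OF assms(1)])
  have "right_slope f x = right_slope f a"
    using no_jump_affine(3)[OF assms(1), of a x x] nj[of x] nj x assms jump_ratio_eq_1 by auto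
  then have "deriv f x = right_slope f a"
    using deriv_PL_real[OF assms(1) nj[of x]] x by (auto intro: DERIV_imp_deriv)
  then show ?thesis by (simp add: initial_slope_def x_def)
qed

lemma final_slope_PL_real:
  assumes "f \<in> PL_real" "a < b" shows "final_slope a b f = left_slope f b"
proof -
  let ?P = "\<lambda>x. x \<in> {a<..<b} \<and> (\<forall>q\<in>nodes a b f. q < x)"
  define x where "x = (SOME x. ?P x)"
  obtain e where "e > 0" and e: "\<And>y. y \<noteq> b \<Longrightarrow> \<bar>y - b\<bar> < e \<Longrightarrow> jump_ratio f y = 1"
    using no_jumps_near[OF assms(1)] by blast
  obtain h where h: "0 < h" "h < e" "h < b - a"
    using field_lbound_gt_zero[of e "b - a"] \<open>e > 0\<close> assms(2) by auto
  have "q < b - h" if "q \<in> nodes a b f" for q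
    using that e[of q] h by (force simp: nodes_PL_real[OF assms(1)])
  then have "?P (b - h)" using h by auto
  then have x: "?P x" unfolding x_def by (rule someI)
  have nj: "jump_ratio f y = 1" if "y < b" "x \<le> y" for y
  proof -
    have "a < y" "\<not> y < x" using x that by auto
    moreover from this x have "y \<notin> nodes a b f" by blast
    ultimately show ?thesis using that by (simp add: nodes_PL_real[OF assms(1)])
  qed
  have "left_slope f b = right_slope f x"
    using no_jump_affine(3)[OF assms(1), of x b b] nj x assms by auto
  then have "deriv f x = left_slope f b"
    using deriv_PL_real[OF assms(1) nj[of x]] x by (auto intro: DERIV_imp_deriv)
  then show ?thesis by (simp add: final_slope_def x_def)
qed

section \<open>Bumps and their orbit products\<close>

lemma int_iter_simps [simp]:
  "int_iter f 0 = id" "int_iter f 1 = f" "int_iter f (int n) = f ^^ n" "int_iter f (- int n) = inv f ^^ n"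
  "int_iter f (-1) = inv f"
  by (auto simp: int_iter_def)

lemma int_iter_Suc:
  assumes "bij f" shows "int_iter f (n + 1) x = f (int_iter f n x)"
proof (cases "n \<ge> 0")
  case True
  then have "nat (n + 1) = Suc (nat n)" by simp
  with True show ?thesis by (simp add: int_iter_def)
next
  case False
  then have "nat (- n) = Suc (nat (- n - 1))" by simp
  then have "int_iter f n x = inv f (int_iter f (n + 1) x)"
    using False by (cases "n = -1") (auto simp: int_iter_def)
  then show ?thesis using assms by (simp add: bij_is_surj surj_f_inv_f)
qed

lemma int_iter_add:
  assumes "bij f" shows "int_iter f (m + n) x = int_iter f m (int_iter f n x)"
proof (induction m rule: int_induct[of _ 0])
  case (step1 i)
  then show ?case using int_iter_Suc[OF assms, of "i + n"] int_iter_Suc[OF assms, of i]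
    by (simp add: add.commute add.left_commute)
next
  case (step2 i)
  have "f (int_iter f (i - 1 + n) x) = f (int_iter f (i - 1) (int_iter f n x))"
    using step2 int_iter_Suc[OF assms, of "i - 1 + n" x] int_iter_Suc[OF assms, of "i - 1" "int_iter f n x"]
    by simp
  then show ?case using assms by (metis bij_pointE)
qed simp

lemma int_iter_fix: "bij f \<Longrightarrow> f a = a \<Longrightarrow> int_iter f n a = a"
proof (induction n rule: int_induct[of _ 0])
  case (step1 i) then show ?case by (simp add: int_iter_Suc)
next
  case (step2 i)
  then show ?case using int_iter_Suc[of f "i - 1" a] by (metis bij_pointE diff_add_cancel)
qed simp

lemma int_iter_minus: "bij f \<Longrightarrow> int_iter (inv f) n = int_iter f (- n)"
  by (auto simp: int_iter_def inv_inv_eq)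

text \<open>The relation between k, f and l is only available on a bump, so the whole orbit has to
  stay in the set S where it holds.\<close>

lemma int_iter_commute:
  assumes "bij f" "bij l" "\<And>y. y \<in> S \<Longrightarrow> k (f y) = l (k y)" "\<And>n. int_iter f n y \<in> S"
  shows "int_iter l n (k y) = k (int_iter f n y)"
proof (induction n rule: int_induct[of _ 0])
  case (step1 i)
  then show ?case using assms by (simp add: int_iter_Suc)
next
  case (step2 i)
  have "l (int_iter l (i - 1) (k y)) = l (k (int_iter f (i - 1) y))"
    using step2 int_iter_Suc[OF assms(1), of "i - 1" y] int_iter_Suc[OF assms(2), of "i - 1" "k y"]
      assms(3)[OF assms(4)[of "i - 1"]] by simp
  then show ?case using assms(2) by (metis bij_pointE)
qed simp

section \<open>Increasing bumps\<close>

text \<open>Outside [a, b] only membership in \<open>PL_real\<close> is asked, so an element of F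
  can be studied on one of its bump domains without being cut off there.\<close>

definition up_bump :: "(real \<Rightarrow> real) \<Rightarrow> real \<Rightarrow> real \<Rightarrow> bool" where
  "up_bump f a b \<longleftrightarrow> f \<in> PL_real \<and> a < b \<and> f a = a \<and> f b = b \<and> (\<forall>y. a < y \<and> y < b \<longrightarrow> y < f y)"

lemma up_bumpD:
  assumes "up_bump f a b"
  shows "f \<in> PL_real" "a < b" "f a = a" "f b = b" "a < y \<Longrightarrow> y < b \<Longrightarrow> y < f y" "bij f"
    "a < y \<Longrightarrow> y < b \<Longrightarrow> inv f y < y"
  using assms PL_realD(3)[of f] PL_real_inv_less(1)[of f] by (auto simp: up_bump_def)

lemma iter_mem:
  assumes "f \<in> PL_real" "f a = a" "f b = b"
  shows "int_iter f n y < b \<longleftrightarrow> y < b" "a < int_iter f n y \<longleftrightarrow> a < y"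
    "int_iter f n y \<le> b \<longleftrightarrow> y \<le> b" "a \<le> int_iter f n y \<longleftrightarrow> a \<le> y"
  using PL_realD(8,9)[OF PL_real_int_iter[OF assms(1), of n]]
    int_iter_fix[OF PL_realD(3)[OF assms(1)] assms(2), of n]
    int_iter_fix[OF PL_realD(3)[OF assms(1)] assms(3), of n] by metis+

lemma up_iter_mem:
  assumes "up_bump f a b" 
  shows "int_iter f n y < b \<longleftrightarrow> y < b" "a < int_iter f n y \<longleftrightarrow> a < y"
    "int_iter f n y \<le> b \<longleftrightarrow> y \<le> b" "a \<le> int_iter f n y \<longleftrightarrow> a \<le> y"
  using iter_mem[of f a b n y] up_bumpD[OF assms] by blast+

lemma up_iter_less:
  assumes "up_bump f a b" "a < y" "y < b" "m < n"
  shows "int_iter f m y < int_iter f n y"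
  using \<open>m < n\<close>
proof (induction n rule: int_gr_induct)
  case base
  then show ?case using int_iter_Suc[OF up_bumpD(6)[OF assms(1)]] up_bumpD(5)[OF assms(1)]
      up_iter_mem[OF assms(1)] assms by simp
next
  case (step i)
  have "int_iter f i y < int_iter f (i + 1) y"
    using int_iter_Suc[OF up_bumpD(6)[OF assms(1)]] up_bumpD(5)[OF assms(1)]
      up_iter_mem[OF assms(1)] assms by simp
  with step show ?case by simp
qed

lemma up_iter_le:
  assumes "up_bump f a b" "a < y" "y < b" "m \<le> n"
  shows "int_iter f m y \<le> int_iter f n y"
  using up_iter_less[OF assms(1-3), of m n] assms(4) by (cases "m = n") auto

text \<open>A bounded orbit would have a supremum s inside the bump. Since f moves s to the right,
  some iterate lies beyond \<open>inv f s\<close>, and the next one exceeds s.\<close>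

lemma up_tends_b:
  assumes "up_bump f a b" "a < y" "y < b" "z < b"
  obtains N where "\<And>n. n \<ge> N \<Longrightarrow> z < int_iter f n y"
proof -
  have "\<exists>n. z < int_iter f n y"
  proof (rule ccontr)
    assume "\<nexists>n. z < int_iter f n y"
    then have le: "int_iter f n y \<le> z" for n by (auto simp: not_less)
    let ?X = "range (\<lambda>n. int_iter f n y)"
    define s where "s = Sup ?X"
    have bdd: "bdd_above ?X" using le by (auto simp: bdd_above_def)
    have ub: "int_iter f n y \<le> s" for n unfolding s_def by (rule cSup_upper[OF _ bdd]) simp
    have "s \<le> z" unfolding s_def by (rule cSup_least) (use le in auto)
    have "a < s" using ub[of 0] assms by simp
    then have "s < f s" using up_bumpD(5)[OF assms(1)] \<open>s \<le> z\<close> assms by auto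
    then have "inv f s < s" using PL_real_inv_less up_bumpD[OF assms(1)] by auto
    then obtain n where "inv f s < int_iter f n y"
      using less_cSup_iff[OF _ bdd, of "inv f s"] unfolding s_def by auto
    then have "s < int_iter f (n + 1) y"
      using PL_real_inv_less up_bumpD[OF assms(1)] int_iter_Suc[of f] by auto
    with ub[of "n + 1"] show False by simp
  qed
  then obtain N where "z < int_iter f N y" by blast
  then show ?thesis using up_iter_le[OF assms(1-3)] by (intro that[of N]) (meson less_le_trans)
qed

lemma up_tends_a:
  assumes "up_bump f a b" "a < y" "y < b" "a < z"
  obtains N where "\<And>n. n \<le> N \<Longrightarrow> int_iter f n y < z"
proof -
  have "\<exists>n. int_iter f n y < z"
  proof (rule ccontr)
    assume "\<nexists>n. int_iter f n y < z"
    then have le: "z \<le> int_iter f n y" for n by (auto simp: not_less)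
    let ?X = "range (\<lambda>n. int_iter f n y)"
    define s where "s = Inf ?X"
    have bdd: "bdd_below ?X" using le by (auto simp: bdd_below_def)
    have lb: "s \<le> int_iter f n y" for n unfolding s_def by (rule cInf_lower[OF _ bdd]) simp
    have "z \<le> s" unfolding s_def by (rule cInf_greatest) (use le in auto)
    have "s < b" using lb[of 0] assms by simp
    then have "s < f s" using up_bumpD(5)[OF assms(1)] \<open>z \<le> s\<close> assms by auto
    then obtain n where "int_iter f n y < f s"
      using cInf_less_iff[OF _ bdd, of "f s"] unfolding s_def by auto
    then have "f (int_iter f (n - 1) y) < f s"
      using int_iter_Suc[OF up_bumpD(6)[OF assms(1)], of "n - 1"] by simp
    then show False using lb[of "n - 1"] PL_realD(8)[OF up_bumpD(1)[OF assms(1)]] by (simp add: not_less)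
  qed
  then obtain N where "int_iter f N y < z" by blast
  then show ?thesis using up_iter_le[OF assms(1-3)] by (intro that[of N]) (meson le_less_trans)
qed

lemma up_slopes:
  assumes "up_bump f a b" shows "right_slope f a > 1" "left_slope f b < 1"
proof -
  note u = up_bumpD[OF assms]
  obtain e where e: "e > 0" "\<And>y. a \<le> y \<Longrightarrow> y < a + e \<Longrightarrow> f y = f a + right_slope f a * (y - a)"
    using PL_real_local[OF u(1)] by metis
  define h where "h = min e (b - a) / 2"
  have h: "h > 0" "h < e" "h < b - a" using e u(2) by (auto simp: h_def min_def field_simps)
  have "a + h < a + right_slope f a * h" using e(2)[of "a + h"] u(5)[of "a + h"] h u(3) by auto
  then show "right_slope f a > 1" using h by simp
  obtain e where e: "e > 0" "\<And>y. b - e < y \<Longrightarrow> y \<le> b \<Longrightarrow> f y = f b + left_slope f b * (y - b)"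
    using PL_real_local[OF u(1)] by metis
  define h where "h = min e (b - a) / 2"
  have h: "h > 0" "h < e" "h < b - a" using e u(2) by (auto simp: h_def min_def field_simps)
  have "b - h < b - left_slope f b * h" using e(2)[of "b - h"] u(5)[of "b - h"] h u(4) by auto
  then show "left_slope f b < 1" using h by simp
qed

lemma no_jumps_ends:
  assumes "f \<in> PL_real" "a < b"
  obtains x1 x2 where "a < x1" "x1 < b" "a < x2" "x2 < b"
    "\<And>y. a < y \<Longrightarrow> y \<le> x1 \<Longrightarrow> jump_ratio f y = 1"
    "\<And>y. x2 \<le> y \<Longrightarrow> y < b \<Longrightarrow> jump_ratio f y = 1"
proof -
  obtain d where d: "d > 0" "\<And>y. y \<noteq> a \<Longrightarrow> \<bar>y - a\<bar> < d \<Longrightarrow> jump_ratio f y = 1"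
    using no_jumps_near[OF assms(1), of a] by blast
  obtain e where e: "e > 0" "\<And>y. y \<noteq> b \<Longrightarrow> \<bar>y - b\<bar> < e \<Longrightarrow> jump_ratio f y = 1"
    using no_jumps_near[OF assms(1), of b] by blast
  define h where "h = min (min d e) (b - a) / 2"
  have "h > 0" "h < d" "h < e" "h < b - a" using d(1) e(1) assms by (auto simp: h_def min_def field_simps)
  then show ?thesis using d(2) e(2) by (intro that[of "a + h" "b - h"]) auto
qed

section \<open>The chain rule and orbit products\<close>

lemma jump_ratio_comp:
  assumes "f \<in> PL_real" "g \<in> PL_real"
  shows "jump_ratio (g \<circ> f) x = jump_ratio g (f x) * jump_ratio f x"
  using assms by (simp add: jump_ratio_slopes PL_real_comp)

lemma jump_ratio_inv:
  assumes "f \<in> PL_real" shows "jump_ratio (inv f) (f x) = 1 / jump_ratio f x"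
  using assms by (simp add: jump_ratio_slopes PL_real_inv)

lemma jump_ratio_funpow:
  assumes "f \<in> PL_real" shows "jump_ratio (f ^^ N) x = (\<Prod>i<N. jump_ratio f ((f ^^ i) x))"
proof (induction N)
  case 0
  show ?case unfolding funpow.simps jump_ratio_slopes PL_real_id by simp
next
  case (Suc N)
  have "f ^^ Suc N = f \<circ> f ^^ N" by simp
  then have "jump_ratio (f ^^ Suc N) x = jump_ratio f ((f ^^ N) x) * jump_ratio (f ^^ N) x"
    using jump_ratio_comp[OF PL_real_funpow[OF assms] assms] by metis
  with Suc show ?case by (simp only: prod.lessThan_Suc mult.commute)
qed

lemma phi_shift: 
  assumes "bij f" shows "phi f (int_iter f n x) = phi f x"
  unfolding phi_def
proof (rule Prod_any.reindex_cong[symmetric])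
  show "bij (\<lambda>m::int. m + n)" by (rule bijI') (auto intro: exI[of _ "_ - n"])
  show "(\<lambda>m. jump_ratio f (int_iter f m x)) \<circ> (\<lambda>m. m + n) = (\<lambda>m. jump_ratio f (int_iter f m (int_iter f n x)))"
    by (auto simp: int_iter_add[OF assms])
qed

lemma phi_step: "bij f \<Longrightarrow> phi f (f x) = phi f x"
  using phi_shift[of f 1 x] by simp

text \<open>Pushing a point from before the first node to beyond the last one turns the bi-infinite
  product into a single jump ratio, so that the chain rule applies to it.\<close>

lemma phi_eq_jump:
  assumes u: "up_bump f a b" "a < y" "y < b"
    and l: "\<And>z. a < z \<Longrightarrow> z < y \<Longrightarrow> jump_ratio f z = 1"
    and r: "\<And>z. (f ^^ N) y \<le> z \<Longrightarrow> z < b \<Longrightarrow> jump_ratio f z = 1"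
  shows "phi f y = jump_ratio (f ^^ N) y"
proof -
  have "{n. jump_ratio f (int_iter f n y) \<noteq> 1} \<subseteq> int ` {..<N}"
  proof (rule subsetI, rule ccontr)
    fix n assume n: "n \<in> {n. jump_ratio f (int_iter f n y) \<noteq> 1}" "n \<notin> int ` {..<N}"
    then have "n < 0 \<or> int N \<le> n" by (metis imageI int_nat_eq lessThan_iff linorder_not_less nat_less_iff)
    then have "jump_ratio f (int_iter f n y) = 1"
    proof
      assume "n < 0"
      then show ?thesis using up_iter_less[OF u, of n 0] up_iter_mem[OF u(1)] u by (intro l) auto
    next
      assume "int N \<le> n"
      then show ?thesis using up_iter_le[OF u, of "int N" n] up_iter_mem[OF u(1)] u by (intro r) auto
    qed
    with n show False by simp
  qed
  then have "phi f y = (\<Prod>n\<in>int ` {..<N}. jump_ratio f (int_iter f n y))"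
    unfolding phi_def by (intro Prod_any.expand_superset) auto
  also have "\<dots> = (\<Prod>i<N. jump_ratio f ((f ^^ i) y))"
    by (subst prod.reindex) (auto simp: inj_on_def)
  also have "\<dots> = jump_ratio (f ^^ N) y" using up_bumpD(1)[OF u(1)] by (simp add: jump_ratio_funpow)
  finally show ?thesis .
qed

lemma up_reach:
  assumes "up_bump f a b" "a < y" "y < b" "z < b"
  obtains N where "\<And>n. n \<ge> N \<Longrightarrow> z < (f ^^ n) y"
proof -
  obtain M where M: "\<And>n. n \<ge> M \<Longrightarrow> z < int_iter f n y" using up_tends_b[OF assms] by blast
  show ?thesis
  proof (rule that[of "nat M"])
    fix n assume "nat M \<le> n"
    then show "z < (f ^^ n) y" using M[of "int n"] by simp
  qed
qed

text \<open>One power works for the whole range from y0 to x1, since the images of larger points are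
  beyond those of y0. Up to the first node the points with nontrivial \<open>phi\<close> are
  therefore jumps of a single piecewise linear map, hence finite in number on compact
  ranges.\<close>

lemma phi_as_jump:
  assumes "up_bump f a b" "a < x1" "x1 < b"
    and "\<And>z. a < z \<Longrightarrow> z < x1 \<Longrightarrow> jump_ratio f z = 1"
    and "a < y0" "y0 < b"
  obtains N where "\<And>n y. n \<ge> N \<Longrightarrow> y0 \<le> y \<Longrightarrow> y \<le> x1 \<Longrightarrow> phi f y = jump_ratio (f ^^ n) y"
proof -
  obtain x2 where x2: "x2 < b" "\<And>y. x2 \<le> y \<Longrightarrow> y < b \<Longrightarrow> jump_ratio f y = 1"
    using no_jumps_ends[OF up_bumpD(1,2)[OF assms(1)]] by metis
  obtain N where N: "\<And>n. n \<ge> N \<Longrightarrow> x2 < (f ^^ n) y0"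
    using up_reach[OF assms(1,5,6) x2(1)] by blast
  show ?thesis
  proof (rule that[of N])
    fix n y assume *: "N \<le> n" "y0 \<le> y" "y \<le> x1"
    then have "(f ^^ n) y0 \<le> (f ^^ n) y"
      using PL_realD(9)[OF PL_real_funpow[OF up_bumpD(1)[OF assms(1)]]] by simp
    with N[OF *(1)] have "x2 < (f ^^ n) y" by simp
    with * assms x2 show "phi f y = jump_ratio (f ^^ n) y"
      by (intro phi_eq_jump[OF assms(1)]) auto
  qed
qed

text \<open>\<open>phi\<close> is constant on orbits, and at a point of the orbit before all nodes
  it is the jump ratio of a power of f.\<close>

lemma phi_pos:
  assumes "up_bump f a b" "a < y" "y < b" shows "phi f y > 0"
proof -
  obtain x1 where x1: "a < x1" "x1 < b" "\<And>y. a < y \<Longrightarrow> y \<le> x1 \<Longrightarrow> jump_ratio f y = 1"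
    using no_jumps_ends[OF up_bumpD(1,2)[OF assms(1)]] by metis
  obtain M where M: "\<And>n. n \<le> M \<Longrightarrow> int_iter f n y < x1"
    using up_tends_a[OF assms x1(1)] by blast
  let ?y = "int_iter f M y"
  have y: "a < ?y" "?y < b" using up_iter_mem[OF assms(1)] assms by auto
  obtain N where "phi f ?y = jump_ratio (f ^^ N) ?y"
    using phi_as_jump[OF assms(1) x1(1,2) _ y] x1(3) M[of M] by (metis less_imp_le order_refl)
  then have "phi f ?y > 0" using jump_ratio_pos[OF PL_real_funpow[OF up_bumpD(1)[OF assms(1)]]] by simp
  then show ?thesis using phi_shift[OF up_bumpD(6)[OF assms(1)]] by metis
qed

text \<open>Without a jump of \<open>phi\<close> a high power of \<open>f\<close> would be affine on two successive fundamental
  domains near \<open>a\<close>; as it commutes with \<open>f\<close>, the slopes of \<open>f\<close> at both ends would agree.\<close>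

lemma phi_nontrivial:
  assumes "up_bump f a b"
  obtains y where "a < y" "y < b" "phi f y \<noteq> 1"
proof (rule ccontr)
  assume "\<not> thesis"
  with that have triv: "phi f y = 1" if "a < y" "y < b" for y using \<open>a < y\<close> \<open>y < b\<close> by blast
  note u = up_bumpD[OF assms]
  obtain x1 x2 where x: "a < x1" "x1 < b" "a < x2" "x2 < b"
    "\<And>y. a < y \<Longrightarrow> y \<le> x1 \<Longrightarrow> jump_ratio f y = 1" "\<And>y. x2 \<le> y \<Longrightarrow> y < b \<Longrightarrow> jump_ratio f y = 1"
    using no_jumps_ends[OF u(1,2)] by metis
  \<comment> \<open>Two steps back from x1, so that two successive fundamental domains lie in the
    range without jumps at the left end.\<close>
  define y0 where "y0 = inv f (inv f x1)"
  have y0: "a < y0" "y0 < f y0" "f y0 < x1" "f (f y0) = x1"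
    using x PL_real_inv_less[OF u(1)] u PL_realD(6)[OF u(1)] by (auto simp: y0_def)
  obtain N1 where N1: "\<And>n y. n \<ge> N1 \<Longrightarrow> y0 \<le> y \<Longrightarrow> y \<le> x1 \<Longrightarrow> phi f y = jump_ratio (f ^^ n) y"
    using phi_as_jump[OF assms x(1,2) _ y0(1)] x y0 by auto
  obtain N2 where N2: "\<And>n. n \<ge> N2 \<Longrightarrow> x2 < (f ^^ n) y0" using up_reach[OF assms y0(1) _ x(4)] y0 x by auto
  let ?n = "max N1 N2" and ?g = "f ^^ (max N1 N2)"
  have g: "?g \<in> PL_real" by (rule PL_real_funpow[OF u(1)])
  have nj: "jump_ratio ?g y = 1" if "y0 \<le> y" "y \<le> x1" for y
    using N1[of ?n y] that triv[of y] y0 x by auto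
  define z where "z = inv f x1"
  have z: "z = f y0" using y0 PL_real_inv_less[OF u(1)] by (auto simp: z_def)
  have "right_slope ?g z = right_slope ?g y0"
    by (rule no_jump_affine(2)[OF g, of y0 x1]) (use nj y0 z in auto)
  moreover have "right_slope f y0 = right_slope f a"
    by (rule no_jump_affine(2)[OF u(1), of a x1]) (use x y0 in auto)
  moreover have "(?g \<circ> f) = (f \<circ> ?g)" by (simp add: funpow_swap1 fun_eq_iff)
  then have "right_slope ?g z * right_slope f y0 = right_slope f (?g y0) * right_slope ?g y0"
    using PL_real_comp(3)[OF u(1) g, of y0] PL_real_comp(3)[OF g u(1), of y0] z by simp
  moreover have gy: "x2 < ?g y0" "?g y0 < b"
    using N2[of ?n] up_iter_mem(1)[OF assms, of "int ?n" y0] y0 x by auto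
  moreover have "right_slope f (?g y0) = left_slope f b"
    using no_jump_affine(2)[OF u(1), of x2 b "?g y0"] no_jump_affine(3)[OF u(1), of x2 b b] x gy by simp
  \<comment> \<open>In the chain rule for g f = f g at y0 the two equal slopes of g cancel; what
    remains are the slopes of f near a and near b.\<close>
  ultimately have "right_slope f a = left_slope f b" using g by simp
  then show False using up_slopes[OF assms] by simp
qed

section \<open>Conjugation between bumps\<close>

text \<open>The two intervals may differ and the relation is only asked on [a, b]. Such maps compose
  and invert like arrows between bumps, which lets the bumps of f and of g be compared
  directly.\<close>

definition conj_between where
  "conj_between k f a b l c d \<longleftrightarrow> k \<in> PL_real \<and> k a = c \<and> k b = d \<and> (\<forall>y. a \<le> y \<and> y \<le> b \<longrightarrow> k (f y) = l (k y))"

lemma conj_betweenD: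
  assumes "conj_between k f a b l c d"
  shows "k \<in> PL_real" "k a = c" "k b = d" "a \<le> y \<Longrightarrow> y \<le> b \<Longrightarrow> k (f y) = l (k y)"
  "c < k y \<longleftrightarrow> a < y" "c \<le> k y \<longleftrightarrow> a \<le> y" "k y < d \<longleftrightarrow> y < b" "k y \<le> d \<longleftrightarrow> y \<le> b"
  using assms PL_realD(8,9)[of k] by (auto simp: conj_between_def)

lemma conj_between_comp:
  assumes "conj_between k f a b l c d" "conj_between k' l c d m p q"
  shows "conj_between (k' \<circ> k) f a b m p q"
  using conj_betweenD[OF assms(1)] conj_betweenD[OF assms(2)]
  by (auto simp: conj_between_def PL_real_comp)

lemma conj_between_inv:
  assumes "conj_between k f a b l c d"
  shows "conj_between (inv k) l c d f a b"
  unfolding conj_between_def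
proof (intro conjI allI impI)
  note k = conj_betweenD[OF assms]
  show "inv k \<in> PL_real" "inv k c = a" "inv k d = b"
    using k PL_real_inv PL_real_inv_less(5) by auto
  fix y assume "c \<le> y \<and> y \<le> d"
  then have "a \<le> inv k y" "inv k y \<le> b" using PL_real_inv_less[OF k(1)] k by auto
  then have "k (f (inv k y)) = l y" using k PL_realD(6)[OF k(1)] by simp
  then show "inv k (l y) = f (inv k y)" using PL_real_inv_less(5)[OF k(1)] by simp
qed

lemma conj_between_inverses:
  assumes "conj_between k f a b l c d" "f \<in> PL_real" "l \<in> PL_real" "f a = a" "f b = b"
  shows "conj_between k (inv f) a b (inv l) c d"
  unfolding conj_between_def
proof (intro conjI allI impI)
  note k = conj_betweenD[OF assms(1)]
  show "k \<in> PL_real" "k a = c" "k b = d" using k by auto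
  fix y assume "a \<le> y \<and> y \<le> b"
  then have "a \<le> inv f y" "inv f y \<le> b" using PL_real_inv_less[OF assms(2)] assms by auto
  then have "k y = l (k (inv f y))" using k(4) PL_realD(6)[OF assms(2)] by metis
  then show "k (inv f y) = inv l (k y)" using PL_realD(7)[OF assms(3)] by simp
qed

lemma conj_up_bump:
  assumes "up_bump f a b" "conj_between k f a b l c d" "l \<in> PL_real"
  shows "up_bump l c d"
  unfolding up_bump_def
proof (intro conjI allI impI)
  note u = up_bumpD[OF assms(1)] and k = conj_betweenD[OF assms(2)]
  show "l \<in> PL_real" by fact
  show "c < d" using k u(2) by metis
  show "l c = c" "l d = d" using k(4)[of a] k(4)[of b] k u by auto
  fix y assume "c < y \<and> y < d"
  moreover obtain x where x: "y = k x" using PL_realD(6)[OF k(1)] by metis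
  ultimately have "a < x" "x < b" using k by auto
  then have *: "k (f x) = l (k x)" "x < f x" using k(4)[of x] u(5)[of x] by simp_all
  have "k x < k (f x)" using *(2) PL_realD(8)[OF k(1)] by simp
  then show "y < l y" unfolding x *(1) .
qed

text \<open>In the chain rule at an end point the slope of k occurs on both sides and
  cancels.\<close>

lemma conj_slopes:
  assumes "conj_between k f a b l c d" "f \<in> PL_real" "l \<in> PL_real" "f a = a" "f b = b" "a < b"
  shows "right_slope l c = right_slope f a" "left_slope l d = left_slope f b"
proof -
  note k = conj_betweenD[OF assms(1)]
  have l: "l c = c" "l d = d" using k(4)[of a] k(4)[of b] k assms by auto
  have "right_slope (k \<circ> f) a = right_slope (l \<circ> k) a"
    by (rule right_slope_cong[OF assms(6)]) (use k assms PL_real_comp in auto)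
  then show "right_slope l c = right_slope f a"
    using PL_real_comp(3)[OF assms(2) k(1), of a] PL_real_comp(3)[OF k(1) assms(3), of a] assms k by simp
  have "left_slope (k \<circ> f) b = left_slope (l \<circ> k) b"
    by (rule left_slope_cong[OF assms(6)]) (use k assms PL_real_comp in auto)
  then show "left_slope l d = left_slope f b"
    using PL_real_comp(2)[OF assms(2) k(1), of b] PL_real_comp(2)[OF k(1) assms(3), of b] assms k by simp
qed

lemma jump_ratio_cong:
  assumes "u < x" "x < v" "\<And>y. u < y \<Longrightarrow> y < v \<Longrightarrow> f y = g y" "g \<in> PL_real"
  shows "jump_ratio f x = jump_ratio g x"
  using left_slope_cong[of u x f g] right_slope_cong[of x v f g] assms by (simp add: jump_ratio_slopes)

text \<open>Replace y by a point w of its orbit such that w lies to the left of all jumps of f and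
  k, and k w to the left of all jumps of l; take N so large that \<open>f ^^ N\<close> brings w
  beyond all of them. Both orbit products become jump ratios of N-th powers, and in k f^N = l^N k
  the two factors that come from k are 1.\<close>

lemma phi_conj:
  assumes "up_bump f a b" "conj_between k f a b l c d" "l \<in> PL_real" "a < y" "y < b"
  shows "phi l (k y) = phi f y"
proof -
  note u = up_bumpD[OF assms(1)] and k = conj_betweenD[OF assms(2)]
  have ul: "up_bump l c d" by (rule conj_up_bump[OF assms(1-3)])
  note ul' = up_bumpD[OF ul]
  obtain x1 x2 where x: "a < x1" "x1 < b" "a < x2" "x2 < b"
    "\<And>y. a < y \<Longrightarrow> y \<le> x1 \<Longrightarrow> jump_ratio f y = 1" "\<And>y. x2 \<le> y \<Longrightarrow> y < b \<Longrightarrow> jump_ratio f y = 1"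
    using no_jumps_ends[OF u(1,2)] by metis
  obtain y1 y2 where y12: "c < y1" "y1 < d" "c < y2" "y2 < d"
    "\<And>y. c < y \<Longrightarrow> y \<le> y1 \<Longrightarrow> jump_ratio l y = 1" "\<And>y. y2 \<le> y \<Longrightarrow> y < d \<Longrightarrow> jump_ratio l y = 1"
    using no_jumps_ends[OF ul'(1,2)] by metis
  obtain z1 z2 where z: "a < z1" "z1 < b" "a < z2" "z2 < b"
    "\<And>y. a < y \<Longrightarrow> y \<le> z1 \<Longrightarrow> jump_ratio k y = 1" "\<And>y. z2 \<le> y \<Longrightarrow> y < b \<Longrightarrow> jump_ratio k y = 1"
    using no_jumps_ends[OF k(1) u(2)] by metis
  obtain M where M: "int_iter f M y < Min {x1, z1, inv k y1}"
  proof -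
    have "a < Min {x1, z1, inv k y1}" using x z y12 PL_real_inv_less[OF k(1)] k by auto
    then show ?thesis using up_tends_a[OF assms(1,4,5)] that by (metis order_refl)
  qed
  define w where "w = int_iter f M y"
  have w: "a < w" "w < b" "w < x1" "w < z1" "k w < y1"
    using M up_iter_mem[OF assms(1)] assms PL_real_inv_less[OF k(1)] by (auto simp: w_def)
  obtain N where N: "Max {x2, z2, inv k y2} < (f ^^ N) w"
  proof -
    have "Max {x2, z2, inv k y2} < b" using x z y12 PL_real_inv_less[OF k(1)] k by auto
    then show ?thesis using up_reach[OF assms(1) w(1,2)] that by (metis order_refl)
  qed
  have fN: "x2 < (f ^^ N) w" "z2 < (f ^^ N) w" "y2 < k ((f ^^ N) w)" "(f ^^ N) w < b"
    using N PL_real_inv_less[OF k(1)] up_iter_mem(1)[OF assms(1), of "int N" w] w by auto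
  have comm: "(l ^^ n) (k v) = k ((f ^^ n) v)" if "a < v" "v < b" for n v
    using int_iter_commute[of f l "{a<..<b}" k v "int n"] up_iter_mem[OF assms(1)] u ul' k that by auto
  have "phi f w = jump_ratio (f ^^ N) w"
    by (rule phi_eq_jump[OF assms(1) w(1,2)]) (use x w fN in auto)
  moreover have "phi l (k w) = jump_ratio (l ^^ N) (k w)"
    by (rule phi_eq_jump[OF ul]) (use k w y12 fN comm[of w] in auto)
  moreover have "jump_ratio (k \<circ> (f ^^ N)) w = jump_ratio ((l ^^ N) \<circ> k) w"
    by (rule jump_ratio_cong[of a _ b]) (use w comm PL_real_comp PL_real_funpow k ul' in auto)
  then have "jump_ratio k ((f ^^ N) w) * jump_ratio (f ^^ N) w = jump_ratio (l ^^ N) (k w) * jump_ratio k w"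
    using jump_ratio_comp[OF PL_real_funpow[OF u(1)] k(1), of N w]
      jump_ratio_comp[OF k(1) PL_real_funpow[OF ul'(1)], of N w] by simp
  moreover have "jump_ratio k ((f ^^ N) w) = 1" "jump_ratio k w = 1" using z w fN by auto
  ultimately have "phi l (k w) = phi f w" by simp
  moreover have "k w = int_iter l M (k y)"
    using int_iter_commute[of f l "{a<..<b}" k y M] up_iter_mem[OF assms(1)] u ul' k assms by (auto simp: w_def)
  ultimately show ?thesis using phi_shift u ul' by (metis w_def)
qed

section \<open>Finite functions\<close>

text \<open>If a is fixed and L is the slope there, f moves the point a + \<rho> L^u of such a
  segment to a + \<rho> L^(u + 1). All computations with finite functions take place in this
  logarithmic coordinate u.\<close>

definition affine_start :: "(real \<Rightarrow> real) \<Rightarrow> real \<Rightarrow> real \<Rightarrow> bool" where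
  "affine_start f a e \<longleftrightarrow> f \<in> PL_real \<and> 0 < e \<and> (\<forall>y. a < y \<and> y < a + e \<longrightarrow> jump_ratio f y = 1)"

lemma affine_startD:
  assumes "affine_start f a e" "0 \<le> t" "t \<le> e"
  shows "f (a + t) = f a + right_slope f a * t"
  using no_jump_affine(1)[of f a "a + e" "a + t"] assms by (auto simp: affine_start_def)

lemma affine_start_exists:
  assumes "f \<in> PL_real" "a < b"
  obtains e where "affine_start f a e" "a + e < b"
proof -
  obtain x1 where "a < x1" "x1 < b" "\<And>y. a < y \<Longrightarrow> y \<le> x1 \<Longrightarrow> jump_ratio f y = 1"
    using no_jumps_ends[OF assms] by metis
  then show ?thesis using assms by (intro that[of "x1 - a"]) (auto simp: affine_start_def)
qed

text \<open>In the coordinate u the map f is translation by 1 and \<open>phi\<close> is constant on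
  orbits, so \<open>phi\<close> has period 1. The step from u - 1 to u requires only the first of
  the two points to lie in the affine segment, which allows every u below 1.\<close>

lemma phi_frac:
  assumes "up_bump f a b" "affine_start f a e" "0 < \<rho>" "\<rho> \<le> e" "u < 1"
  shows "phi f (a + \<rho> * right_slope f a powr u) = phi f (a + \<rho> * right_slope f a powr frac u)"
proof -
  let ?L = "right_slope f a"
  have L: "?L > 1" by (rule up_slopes[OF assms(1)])
  have step: "phi f (a + \<rho> * ?L powr (v - 1)) = phi f (a + \<rho> * ?L powr v)" if "v \<le> 1" for v
  proof -
    have "?L powr (v - 1) \<le> ?L powr 0" using L that by (intro powr_mono) auto
    then have "\<rho> * ?L powr (v - 1) \<le> e" using assms(3,4) L
      by (metis less_imp_le mult.right_neutral mult_left_mono not_one_less_zero order_trans powr_zero_eq_one)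
    then have "f (a + \<rho> * ?L powr (v - 1)) = a + ?L * (\<rho> * ?L powr (v - 1))"
      using affine_startD[OF assms(2)] assms(3) up_bumpD(3)[OF assms(1)] by simp
    also have "\<dots> = a + \<rho> * ?L powr v" using L by (simp add: powr_diff)
    finally show ?thesis using phi_step[OF up_bumpD(6)[OF assms(1)]] by metis
  qed
  have "phi f (a + \<rho> * ?L powr (v - real n)) = phi f (a + \<rho> * ?L powr v)" if "v \<le> 1" for v n
  proof (induction n)
    case (Suc n)
    have eq: "v - real (Suc n) = (v - real n) - 1" by simp
    show ?case unfolding eq using Suc step[of "v - real n"] that by simp
  qed simp
  \<comment> \<open>As u < 1, its integer part is at most 0, so u is \<open>frac u\<close> minus a
    natural number.\<close>
  from this[of "frac u" "nat (- \<lfloor>u\<rfloor>)"] show ?thesis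
    using assms(5) frac_lt_1[of u] by (simp add: frac_def less_imp_le)
qed

lemma finite_phi_near:
  assumes "up_bump f a b" "affine_start f a e" "a + e < b" "a < y0"
  shows "finite {y \<in> {y0..a + e}. phi f y \<noteq> 1}"
proof (cases "y0 \<le> a + e")
  case True
  have "\<exists>N. \<forall>n y. n \<ge> N \<longrightarrow> y0 \<le> y \<longrightarrow> y \<le> a + e \<longrightarrow> phi f y = jump_ratio (f ^^ n) y"
    using phi_as_jump[OF assms(1), of "a + e" y0] assms True unfolding affine_start_def
    by (smt (verit))
  then obtain N where N: "\<And>y. y0 \<le> y \<Longrightarrow> y \<le> a + e \<Longrightarrow> phi f y = jump_ratio (f ^^ N) y" by blast
  show ?thesis
    by (rule finite_subset[OF _ finite_jumps[OF PL_real_funpow[OF up_bumpD(1)[OF assms(1)]], of y0 "a + e" N]])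
      (auto simp: N)
qed simp

text \<open>The exponents are moved from [0, 1) to [-1, 0), where the points lie in the affine
  segment and \<open>finite_phi_near\<close> applies.\<close>

lemma finite_phi_powr:
  assumes "up_bump f a b" "affine_start f a e" "a + e < b" "0 < \<rho>" "\<rho> \<le> e"
  shows "finite {s \<in> {0..<1}. phi f (a + \<rho> * right_slope f a powr s) \<noteq> 1}"
proof -
  let ?L = "right_slope f a" and ?g = "\<lambda>s. a + \<rho> * right_slope f a powr (s - 1)"
  have L: "?L > 1" by (rule up_slopes[OF assms(1)])
  let ?F = "{y \<in> {a + \<rho> * ?L powr (- 1)..a + e}. phi f y \<noteq> 1}"
  have "?g ` {s \<in> {0..<1}. phi f (a + \<rho> * ?L powr s) \<noteq> 1} \<subseteq> ?F"
  proof (rule image_subsetI)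
    fix s assume "s \<in> {s \<in> {0..<1}. phi f (a + \<rho> * ?L powr s) \<noteq> 1}"
    then have s: "s \<in> {0..<1::real}" "phi f (a + \<rho> * ?L powr s) \<noteq> 1" by auto
    have "frac (s - 1) = s" using s by (simp add: frac_def) linarith
    then have "phi f (?g s) \<noteq> 1" using s phi_frac[OF assms(1,2,4,5), of "s - 1"] by simp
    moreover have "\<rho> * ?L powr (- 1) \<le> \<rho> * ?L powr (s - 1)"
      using L s assms by (intro mult_left_mono powr_mono) auto
    moreover have "?L powr (s - 1) \<le> ?L powr 0" using L s by (intro powr_mono) auto
    then have "\<rho> * ?L powr (s - 1) \<le> \<rho> * 1" using L assms by (intro mult_left_mono) auto
    then have "\<rho> * ?L powr (s - 1) \<le> e" using assms(5) by linarith
    ultimately show "?g s \<in> ?F" using assms by auto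
  qed
  moreover have "finite ?F" using assms L by (intro finite_phi_near) auto
  ultimately have "finite (?g ` {s \<in> {0..<1}. phi f (a + \<rho> * ?L powr s) \<noteq> 1})" by (rule finite_subset)
  moreover have "inj_on ?g A" for A
    using L assms by (auto simp: inj_on_def powr_inj)
  ultimately show ?thesis by (rule finite_imageD)
qed

text \<open>The exponent 1 gives the point f (a + \<rho>), which is still below b.\<close>

lemma powr_region:
  assumes "up_bump f a b" "affine_start f a e" "a + e < b" "0 < \<rho>" "\<rho> \<le> e" "s < 1"
  shows "a < a + \<rho> * right_slope f a powr s" "a + \<rho> * right_slope f a powr s < b"
proof -
  let ?L = "right_slope f a"
  have L: "?L > 1" by (rule up_slopes[OF assms(1)])
  show "a < a + \<rho> * ?L powr s" using assms L by simp
  have "\<rho> * ?L powr s < \<rho> * ?L powr 1" using assms L by (intro mult_strict_left_mono powr_less_mono) auto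
  also have "a + \<rho> * ?L powr 1 = f (a + \<rho>)"
    using affine_startD[OF assms(2), of \<rho>] assms L up_bumpD[OF assms(1)] by simp
  then have "a + \<rho> * ?L powr 1 < b"
    using up_iter_mem(1)[OF assms(1), of 1 "a + \<rho>"] assms by simp
  ultimately show "a + \<rho> * ?L powr s < b" by linarith
qed

text \<open>A point with nontrivial \<open>phi\<close> has a node on its orbit, and
  \<open>phi\<close> takes the same value there; hence the minima in \<open>psi_up\<close> are taken
  over nonempty sets.\<close>

lemma psi_up_nodes:
  assumes "up_bump f a b"
  shows "finite (nodes a b f)" "{q \<in> nodes a b f. phi f q \<noteq> 1} \<noteq> {}"
proof -
  note u = up_bumpD[OF assms]
  show "finite (nodes a b f)" by (rule finite_nodes[OF u(1)])
  obtain y where y: "a < y" "y < b" "phi f y \<noteq> 1" using phi_nontrivial[OF assms] .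
  then obtain n where "jump_ratio f (int_iter f n y) \<noteq> 1"
    unfolding phi_def by (metis Prod_any.not_neutral_obtains_not_neutral)
  then have "int_iter f n y \<in> {q \<in> nodes a b f. phi f q \<noteq> 1}"
    using y up_iter_mem[OF assms] phi_shift[OF u(6)] by (auto simp: nodes_PL_real[OF u(1)])
  then show "{q \<in> nodes a b f. phi f q \<noteq> 1} \<noteq> {}" by blast
qed

lemma affine_start_Min:
  assumes "up_bump f a b"
  shows "a < Min (nodes a b f)" "Min (nodes a b f) < b" "affine_start f a (Min (nodes a b f) - a)"
proof -
  note u = up_bumpD[OF assms]
  have "nodes a b f \<noteq> {}" using psi_up_nodes(2)[OF assms] by auto
  then have "Min (nodes a b f) \<in> nodes a b f" using psi_up_nodes(1)[OF assms] by (rule Min_in[rotated])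
  then show *: "a < Min (nodes a b f)" "Min (nodes a b f) < b" by (auto simp: nodes_PL_real[OF u(1)])
  have "jump_ratio f y = 1" if "a < y" "y < Min (nodes a b f)" for y
  proof (rule ccontr)
    assume "jump_ratio f y \<noteq> 1"
    then have "y \<in> nodes a b f" using that * by (auto simp: nodes_PL_real[OF u(1)])
    then have "Min (nodes a b f) \<le> y" using psi_up_nodes(1)[OF assms] by simp
    with that show False by simp
  qed
  then show "affine_start f a (Min (nodes a b f) - a)"
    using * u by (auto simp: affine_start_def)
qed

lemma psi_up_rep:
  assumes "up_bump f a b"
  obtains r n where "a < r" "r < Min (nodes a b f)" "n < 0"
    "r = int_iter f n (Min {q \<in> nodes a b f. phi f q \<noteq> 1})"
    "psi_up a b f = (\<lambda>s\<in>{0..<1}. phi f (a + (r - a) * right_slope f a powr s))"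
    "phi f r \<noteq> 1"
proof -
  note u = up_bumpD[OF assms]
  let ?p = "Min (nodes a b f)" and ?ps = "Min {q \<in> nodes a b f. phi f q \<noteq> 1}"
  let ?P = "\<lambda>r. r \<in> {a<..<?p} \<and> (\<exists>n<0. r = int_iter f n ?ps)"
  have "?ps \<in> {q \<in> nodes a b f. phi f q \<noteq> 1}"
    by (rule Min_in) (use psi_up_nodes[OF assms] in auto)
  then have ps: "a < ?ps" "?ps < b" "phi f ?ps \<noteq> 1" by (auto simp: nodes_PL_real[OF u(1)])
  obtain N where N: "\<And>n. n \<le> N \<Longrightarrow> int_iter f n ?ps < ?p"
    using up_tends_a[OF assms ps(1,2) affine_start_Min(1)[OF assms]] by blast
  define r where "r = (SOME r. ?P r)"
  have "int_iter f (min N (-1)) ?ps \<in> {a<..<?p}"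
    using N[of "min N (-1)"] up_iter_mem(2)[OF assms] ps(1) by simp
  moreover have "min N (-1) < 0" by simp
  ultimately have "?P (int_iter f (min N (-1)) ?ps)" by blast
  then have "?P r" unfolding r_def by (rule someI[of ?P])
  then obtain n where r: "a < r" "r < ?p" "n < 0" "r = int_iter f n ?ps" by auto
  show ?thesis
  proof (rule that[of r n])
    show "psi_up a b f = (\<lambda>s\<in>{0..<1}. phi f (a + (r - a) * right_slope f a powr s))"
      unfolding psi_up_def Let_def r_def[symmetric] initial_slope_PL_real[OF u(1,2)]
      by (simp add: mult.commute add.commute)
    show "phi f r \<noteq> 1" using ps(3) unfolding r(4) phi_shift[OF u(6)] .
  qed (fact r)+
qed

text \<open>Removes the choice of r: up to the scale \<rho>, the finite function is
  \<open>phi\<close> in the logarithmic coordinate over one period, normalised by a nontrivial value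
  at 0.\<close>

lemma psi_up_char:
  assumes "up_bump f a b"
  obtains e \<rho> where "affine_start f a e" "a + e < b" "0 < \<rho>" "\<rho> \<le> e" "phi f (a + \<rho>) \<noteq> 1"
    "psi_up a b f = (\<lambda>s\<in>{0..<1}. phi f (a + \<rho> * right_slope f a powr s))"
proof -
  obtain r n where r: "a < r" "r < Min (nodes a b f)" "phi f r \<noteq> 1"
    "psi_up a b f = (\<lambda>s\<in>{0..<1}. phi f (a + (r - a) * right_slope f a powr s))"
    using psi_up_rep[OF assms] by metis
  show ?thesis
    by (rule that[of "Min (nodes a b f) - a" "r - a"]) (use r affine_start_Min[OF assms] in auto)
qed

lemma psi_up_finite_function:
  assumes "up_bump f a b"
  shows "psi_up a b f \<in> finite_functions" "psi_up a b f 0 \<noteq> 1"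
proof -
  obtain e \<rho> where *: "affine_start f a e" "a + e < b" "0 < \<rho>" "\<rho> \<le> e" "phi f (a + \<rho>) \<noteq> 1"
    "psi_up a b f = (\<lambda>s\<in>{0..<1}. phi f (a + \<rho> * right_slope f a powr s))"
    using psi_up_char[OF assms] by blast
  show "psi_up a b f 0 \<noteq> 1" using * up_bumpD[OF assms] by simp
  have "{s \<in> {0..<1}. psi_up a b f s \<noteq> 1} = {s \<in> {0..<1}. phi f (a + \<rho> * right_slope f a powr s) \<noteq> 1}"
    unfolding * by auto
  then have "finite {s \<in> {0..<1}. psi_up a b f s \<noteq> 1}"
    using finite_phi_powr[OF assms *(1-4)] by simp
  moreover have "psi_up a b f \<in> {0..<1} \<rightarrow>\<^sub>E {0<..}"
    unfolding *(6) using phi_pos[OF assms] powr_region[OF assms *(1-4)] by auto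
  ultimately show "psi_up a b f \<in> finite_functions" by (simp add: finite_functions_def)
qed

section \<open>Shift classes under conjugation\<close>

lemma frac_frac_add: "frac (frac x + y) = frac (x + y)" for x y :: real
proof -
  have "frac (x + y - of_int n) = frac (x + y)" for n
    unfolding frac_def floor_diff_of_int by simp
  moreover have eq: "frac x + y = x + y - of_int \<lfloor>x\<rfloor>" by (simp add: frac_def)
  ultimately show ?thesis unfolding eq by blast
qed

lemma ff_class_shift:
  assumes "\<And>s. s \<in> {0..<1} \<Longrightarrow> c s = c' (frac (s + \<tau>))"
  shows "ff_class c = ff_class c'"
proof -
  have sub: "ff_class c \<subseteq> ff_class c'" if "\<And>s. s \<in> {0..<1} \<Longrightarrow> c s = c' (frac (s + \<tau>))" for c c' :: "real \<Rightarrow> real" and \<tau>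
  proof
    fix c1 assume "c1 \<in> ff_class c"
    then obtain t where c1: "c1 \<in> finite_functions" "\<And>s. s \<in> {0..<1} \<Longrightarrow> c1 s = c (frac (s + t))"
      by (auto simp: ff_class_def)
    have "c1 s = c' (frac (s + (t + \<tau>)))" if "s \<in> {0..<1}" for s
      using c1(2)[OF that] \<open>\<And>s. s \<in> {0..<1} \<Longrightarrow> c s = c' (frac (s + \<tau>))\<close>[of "frac (s + t)"]
      by (simp add: frac_frac_add frac_lt_1 add.assoc)
    with c1(1) show "c1 \<in> ff_class c'" by (auto simp: ff_class_def)
  qed
  have "c' s = c (frac (s + (- \<tau>)))" if "s \<in> {0..<1}" for s
    using assms[of "frac (s + (- \<tau>))"] that by (simp add: frac_frac_add frac_lt_1 frac_eq)
  then show ?thesis using sub assms by (metis subset_antisym)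
qed

text \<open>Close to a the conjugator k is affine, hence a translation in logarithmic coordinates;
  \<open>phi_conj\<close> carries the values across, so the two finite functions differ by a
  shift.\<close>

lemma ff_class_conj:
  assumes "up_bump f a b" "conj_between k f a b l c d" "l \<in> PL_real"
  shows "ff_class (psi_up c d l) = ff_class (psi_up a b f)"
proof -
  note k = conj_betweenD[OF assms(2)] and u = up_bumpD[OF assms(1)]
  have ul: "up_bump l c d" by (rule conj_up_bump[OF assms])
  obtain e \<rho> where f: "affine_start f a e" "a + e < b" "0 < \<rho>" "\<rho> \<le> e"
    "psi_up a b f = (\<lambda>s\<in>{0..<1}. phi f (a + \<rho> * right_slope f a powr s))"
    using psi_up_char[OF assms(1)] by metis
  obtain e' \<rho>' where l: "affine_start l c e'" "c + e' < d" "0 < \<rho>'" "\<rho>' \<le> e'"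
    "psi_up c d l = (\<lambda>s\<in>{0..<1}. phi l (c + \<rho>' * right_slope l c powr s))"
    using psi_up_char[OF ul] by metis
  obtain e'' where k': "affine_start k a e''" "a + e'' < b"
    using affine_start_exists[OF k(1) u(2)] by metis
  have e'': "e'' > 0" using k'(1) by (simp add: affine_start_def)
  let ?L = "right_slope f a" and ?A = "right_slope k a"
  have L: "?L > 1" "right_slope l c = ?L"
    using up_slopes[OF assms(1)] conj_slopes[OF assms(2)] u assms by auto
  have A: "?A > 0" using slopes_pos k by blast
  \<comment> \<open>The slope \<open>?A\<close> of k turns the scale \<rho> into
    \<open>?A * \<rho>\<close>, which is \<rho>' times the power \<tau> of
    \<open>?L\<close>.\<close>
  define \<tau> where "\<tau> = log ?L (?A * \<rho> / \<rho>')"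
  have \<tau>: "?A * \<rho> = \<rho>' * ?L powr \<tau>" using L A f l by (simp add: \<tau>_def)
  have "psi_up a b f s = psi_up c d l (frac (s + \<tau>))" if s: "s \<in> {0..<1}" for s
  proof -
    \<comment> \<open>So many periods back, the point lies where k is affine, and the exponents
      before and after the shift by \<tau> are both below 1.\<close>
    define j where "j = nat \<lceil>2 + \<bar>\<tau>\<bar> + \<bar>log ?L (e'' / \<rho>)\<bar>\<rceil>"
    have j: "real j \<ge> 2 + \<bar>\<tau>\<bar> + \<bar>log ?L (e'' / \<rho>)\<bar>" unfolding j_def by linarith
    let ?v = "s - real j"
    have v: "?v < 1" "?v + \<tau> < 1" "?v < log ?L (e'' / \<rho>)" using j s by auto
    have fr: "frac ?v = s" using s by (simp add: frac_unique_iff)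
    have fr': "frac (?v + \<tau>) = frac (s + \<tau>)"
    proof -
      have "?v + \<tau> = s + \<tau> - of_int (int j)" by simp
      then show ?thesis unfolding frac_def by (simp only: floor_diff_of_int of_int_diff)
    qed
    have "?L powr ?v < e'' / \<rho>" using v(3) L e'' f by (simp add: less_log_iff)
    then have small: "\<rho> * ?L powr ?v \<le> e''" using f by (simp add: field_simps)
    have "psi_up a b f s = phi f (a + \<rho> * ?L powr s)" using s f by simp
    also have "\<dots> = phi f (a + \<rho> * ?L powr ?v)" using phi_frac[OF assms(1) f(1,3,4) v(1)] fr by simp
    also have "\<dots> = phi l (k (a + \<rho> * ?L powr ?v))"
      using powr_region[OF assms(1) f(1-4) v(1)] by (intro phi_conj[symmetric, OF assms]) auto
    also have "k (a + \<rho> * ?L powr ?v) = c + ?A * (\<rho> * ?L powr ?v)"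
      using affine_startD[OF k'(1) _ small] f k by simp
    also have "?A * (\<rho> * ?L powr ?v) = \<rho>' * ?L powr (?v + \<tau>)" using \<tau> by (simp add: powr_add)
    also have "phi l (c + \<rho>' * ?L powr (?v + \<tau>)) = phi l (c + \<rho>' * ?L powr frac (s + \<tau>))"
      using phi_frac[OF ul l(1,3,4) v(2)] L fr' by simp
    also have "\<dots> = psi_up c d l (frac (s + \<tau>))" using l L by (simp add: frac_lt_1)
    finally show ?thesis .
  qed
  then show ?thesis using ff_class_shift by metis
qed

section \<open>The order on finite functions\<close>

text \<open>Two finite functions differ at finitely many arguments only, so there is a first one,
  and it decides.\<close>

lemma ff_less_linear:
  assumes "c1 \<in> finite_functions" "c2 \<in> finite_functions" "c1 \<noteq> c2"
  shows "ff_less c1 c2 \<or> ff_less c2 c1"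
proof -
  let ?D = "{s \<in> {0..<1}. c1 s \<noteq> c2 s}"
  have "?D \<subseteq> {s \<in> {0..<1}. c1 s \<noteq> 1} \<union> {s \<in> {0..<1}. c2 s \<noteq> 1}" by auto
  then have fin: "finite ?D" using assms unfolding finite_functions_def
    by (metis (no_types, lifting) finite_UnI finite_subset mem_Collect_eq)
  have "?D \<noteq> {}"
    using assms extensionalityI[of c1 "{0..<1}" c2] by (auto simp: finite_functions_def PiE_def)
  then have M: "Min ?D \<in> ?D" using fin by (rule Min_in[rotated])
  have eq: "c1 y = c2 y" if "y \<in> {0..<Min ?D}" for y
  proof (rule ccontr)
    assume "c1 y \<noteq> c2 y"
    then have "y \<in> ?D" using that M by auto
    then have "Min ?D \<le> y" using fin by simp
    with that show False by simp
  qed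
  from M have "c1 (Min ?D) < c2 (Min ?D) \<or> c2 (Min ?D) < c1 (Min ?D)" by auto
  then show ?thesis
  proof
    assume "c1 (Min ?D) < c2 (Min ?D)"
    then have "ff_less c1 c2" unfolding ff_less_def using M eq by blast
    then show ?thesis ..
  next
    assume "c2 (Min ?D) < c1 (Min ?D)"
    then have "ff_less c2 c1" unfolding ff_less_def using M eq by (metis (no_types, lifting) mem_Collect_eq)
    then show ?thesis ..
  qed
qed

lemma ff_less_trans:
  assumes "ff_less c1 c2" "ff_less c2 c3" shows "ff_less c1 c3"
proof -
  obtain x y where x: "x \<in> {0..<1}" "c1 x < c2 x" "\<forall>z\<in>{0..<x}. c1 z = c2 z"
    and y: "y \<in> {0..<1}" "c2 y < c3 y" "\<forall>z\<in>{0..<y}. c2 z = c3 z"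
    using assms by (auto simp: ff_less_def)
  have "c1 (min x y) < c3 (min x y)"
    using x y by (cases x y rule: linorder_cases) (auto simp: min_def)
  then show ?thesis using x y unfolding ff_less_def by (intro bexI[of _ "min x y"]) auto
qed

lemma ff_less_irrefl: "\<not> ff_less c c"
  by (auto simp: ff_less_def)

lemma ff_minimum:
  assumes "finite S" "S \<noteq> {}" "S \<subseteq> finite_functions"
  shows "\<exists>!m. m \<in> S \<and> (\<forall>c\<in>S. c \<noteq> m \<longrightarrow> ff_less m c)"
proof -
  have "\<exists>m. m \<in> S \<and> (\<forall>c\<in>S. c \<noteq> m \<longrightarrow> ff_less m c)"
    using assms
  proof (induction S rule: finite_ne_induct)
    case (insert x F)
    then obtain m where m: "m \<in> F" "\<forall>c\<in>F. c \<noteq> m \<longrightarrow> ff_less m c" by auto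
    have "x \<noteq> m" using insert m by auto
    then have "ff_less x m \<or> ff_less m x" using insert m by (intro ff_less_linear) auto
    then show ?case
    proof
      assume "ff_less x m"
      then have "ff_less x c" if "c \<in> insert x F" "c \<noteq> x" for c
        using that m ff_less_trans[of x m c] by (cases "c = m") auto
      then show ?thesis by blast
    next
      assume "ff_less m x"
      then have "\<forall>c\<in>insert x F. c \<noteq> m \<longrightarrow> ff_less m c" using m by blast
      then show ?thesis using m by blast
    qed
  qed simp
  then obtain m where m: "m \<in> S \<and> (\<forall>c\<in>S. c \<noteq> m \<longrightarrow> ff_less m c)" ..
  show ?thesis
  proof (rule ex1I[of _ m])
    show "m \<in> S \<and> (\<forall>c\<in>S. c \<noteq> m \<longrightarrow> ff_less m c)" by (rule m)
  next
    fix m' assume m': "m' \<in> S \<and> (\<forall>c\<in>S. c \<noteq> m' \<longrightarrow> ff_less m' c)"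
    show "m' = m"
    proof (rule ccontr)
      assume "m' \<noteq> m"
      then have "ff_less m m'" "ff_less m' m" using m m' by metis+
      then show False using ff_less_trans ff_less_irrefl by metis
    qed
  qed
qed

section \<open>Bumps of either direction\<close>

definition bump :: "(real \<Rightarrow> real) \<Rightarrow> real \<Rightarrow> real \<Rightarrow> bool" where
  "bump f a b \<longleftrightarrow> f \<in> PL_real \<and> a < b \<and> f a = a \<and> f b = b \<and> (\<forall>y. a < y \<and> y < b \<longrightarrow> f y \<noteq> y)"

lemma bumpD:
  assumes "bump f a b"
  shows "f \<in> PL_real" "a < b" "f a = a" "f b = b" "a < y \<Longrightarrow> y < b \<Longrightarrow> f y \<noteq> y" "bij f"
  using assms PL_realD(3) by (auto simp: bump_def)

lemma up_bump_imp_bump: "up_bump f a b \<Longrightarrow> bump f a b"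
  unfolding up_bump_def bump_def by force

lemma inv_inv_PL_real: "f \<in> PL_real \<Longrightarrow> inv (inv f) = f"
  by (simp add: PL_realD(3) inv_inv_eq)

text \<open>By the intermediate value theorem f x - x has one sign on the bump, and inversion turns
  a decreasing bump into an increasing one. Statements about bumps are reduced to
  \<open>up_bump\<close> in this way.\<close>

lemma bump_cases:
  assumes "bump f a b" shows "up_bump f a b \<or> up_bump (inv f) a b"
proof (rule ccontr)
  note u = bumpD[OF assms]
  assume "\<not> ?thesis"
  then obtain y z where y: "a < y" "y < b" "f y \<le> y" and z: "a < z" "z < b" "inv f z \<le> z"
    using u PL_real_inv(1)[OF u(1)] PL_real_inv_less(5)[OF u(1)] unfolding up_bump_def
    by (metis not_less)
  then have "f y - y \<le> 0" "f z - z \<ge> 0" using PL_real_inv_less[OF u(1)] by auto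
  have cont: "continuous_on S (\<lambda>x. f x - x)" for S
    by (intro continuous_intros PL_real_continuous u)
  have "\<exists>x. min y z \<le> x \<and> x \<le> max y z \<and> f x - x = 0"
    using IVT'[of "\<lambda>x. f x - x" y 0 z] IVT2'[of "\<lambda>x. f x - x" y 0 z] cont
      \<open>f y - y \<le> 0\<close> \<open>f z - z \<ge> 0\<close> by (cases "y \<le> z") (auto simp: min_def max_def)
  then obtain x where "min y z \<le> x" "x \<le> max y z" "f x = x" by auto
  then show False using u(5)[of x] y z by auto
qed

lemma psi_up_bump: "up_bump f a b \<Longrightarrow> psi a b f = psi_up a b f"
  by (auto simp: psi_def up_bump_def)

lemma psi_down_bump:
  assumes "up_bump (inv f) a b" "f \<in> PL_real" shows "psi a b f = psi_up a b (inv f)"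
proof -
  let ?y = "(a + b) / 2"
  note u = up_bumpD[OF assms(1)]
  have y: "a < ?y" "?y < b" using u(2) by auto
  then have "f ?y < ?y" using u(5)[OF y] PL_real_inv_less[OF assms(2)] by simp
  then have "\<not> (\<forall>x\<in>{a<..<b}. x < f x)" using y by (metis greaterThanLessThan_iff less_asym)
  then show ?thesis unfolding psi_def by (rule if_not_P)
qed

lemma psi_finite_function:
  assumes "bump f a b" shows "psi a b f \<in> finite_functions" "psi a b f 0 \<noteq> 1"
  using bump_cases[OF assms] psi_up_bump[of f a b] psi_down_bump[of f a b] bumpD(1)[OF assms]
    psi_up_finite_function by metis+

text \<open>The set of candidates is finite: a shift by t has a nontrivial value at 0 only if the
  function is nontrivial at t, which leaves finitely many t in [0, 1). A finite set of finite
  functions has a minimum for \<open>ff_less\<close>.\<close>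

lemma min_ff_in_class:
  assumes "bump f a b"
  shows "min_ff f a b \<in> ff_class (psi a b f)" "min_ff f a b 0 \<noteq> 1"
proof -
  let ?c = "psi a b f"
  let ?C = "{c \<in> ff_class ?c. c 0 \<noteq> 1}"
  have "?C \<subseteq> (\<lambda>t. \<lambda>s\<in>{0..<1}. ?c (frac (s + t))) ` {t \<in> {0..<1}. ?c t \<noteq> 1}"
  proof
    fix c1 assume "c1 \<in> ?C"
    then obtain t where t: "c1 \<in> finite_functions" "\<And>s. s \<in> {0..<1} \<Longrightarrow> c1 s = ?c (frac (s + t))" "c1 0 \<noteq> 1"
      by (auto simp: ff_class_def)
    have "?c (frac t) \<noteq> 1" using t(2)[of 0] t(3) by simp
    moreover have "c1 = (\<lambda>s\<in>{0..<1}. ?c (frac (s + frac t)))"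
    proof (rule extensionalityI[of _ "{0..<1}"])
      show "c1 \<in> extensional {0..<1}" using t(1) by (auto simp: finite_functions_def PiE_def)
      fix s :: real assume "s \<in> {0..<1}"
      then show "c1 s = (\<lambda>s\<in>{0..<1}. ?c (frac (s + frac t))) s"
        using t(2) frac_frac_add[of t s] by (simp add: add.commute)
    qed simp
    ultimately show "c1 \<in> (\<lambda>t. \<lambda>s\<in>{0..<1}. ?c (frac (s + t))) ` {t \<in> {0..<1}. ?c t \<noteq> 1}"
      by (intro image_eqI[of _ _ "frac t"]) (auto simp: frac_lt_1)
  qed
  moreover have "finite {t \<in> {0..<1}. ?c t \<noteq> 1}"
    using psi_finite_function[OF assms] by (simp add: finite_functions_def)
  ultimately have "finite ?C" by (meson finite_imageI finite_subset)
  moreover have "?c \<in> ?C"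
    using psi_finite_function[OF assms] by (auto simp: ff_class_def frac_eq intro!: exI[of _ 0])
  then have "?C \<noteq> {}" by blast
  moreover have "?C \<subseteq> finite_functions" by (auto simp: ff_class_def)
  ultimately have "\<exists>!m. m \<in> ?C \<and> (\<forall>c\<in>?C. c \<noteq> m \<longrightarrow> ff_less m c)" by (rule ff_minimum)
  from theI'[OF this] have "min_ff f a b \<in> ?C" unfolding min_ff_def Let_def by (rule conjunct1)
  then show "min_ff f a b \<in> ff_class ?c" "min_ff f a b 0 \<noteq> 1" by auto
qed

lemma psi_class_conj:
  assumes "bump f a b" "conj_between k f a b l c d" "l \<in> PL_real"
  shows "ff_class (psi c d l) = ff_class (psi a b f)"
  using bump_cases[OF assms(1)]
proof
  assume u: "up_bump f a b"
  show ?thesis using ff_class_conj[OF u assms(2,3)] psi_up_bump[OF u]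
      psi_up_bump[OF conj_up_bump[OF u assms(2,3)]] by simp
next
  assume u: "up_bump (inv f) a b"
  note b = bumpD[OF assms(1)]
  have k: "conj_between k (inv f) a b (inv l) c d"
    using assms b by (intro conj_between_inverses)
  have il: "inv l \<in> PL_real" using assms PL_real_inv by blast
  show ?thesis using ff_class_conj[OF u k il] psi_down_bump[OF u b(1)]
      psi_down_bump[OF conj_up_bump[OF u k il] assms(3)] by simp
qed

lemma min_ff_conj:
  assumes "bump f a b" "conj_between k f a b l c d" "l \<in> PL_real"
  shows "min_ff l c d = min_ff f a b"
  unfolding min_ff_def psi_class_conj[OF assms] ..

section \<open>Cornered functions\<close>

definition up_cornered :: "(real \<Rightarrow> real) \<Rightarrow> real \<Rightarrow> real \<Rightarrow> bool" where
  "up_cornered l a b \<longleftrightarrow> up_bump l a b \<and> (\<exists>x\<in>{a<..<b}. nodes a b l \<subseteq> {x<..<l x})"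

lemma nodes_inv:
  assumes "f \<in> PL_real" "f a = a" "f b = b"
  shows "f y \<in> nodes a b (inv f) \<longleftrightarrow> y \<in> nodes a b f"
proof -
  have "jump_ratio f y = 1 \<longleftrightarrow> jump_ratio (inv f) (f y) = 1"
    using jump_ratio_inv[OF assms(1), of y] jump_ratio_pos[OF assms(1), of y] by auto
  moreover have "f y \<in> {a<..<b} \<longleftrightarrow> y \<in> {a<..<b}"
    using PL_realD(8)[OF assms(1), of a y] PL_realD(8)[OF assms(1), of y b] assms by auto
  ultimately show ?thesis
    using nodes_PL_real[OF assms(1)] nodes_PL_real[OF PL_real_inv(1)[OF assms(1)]] by auto
qed

lemma up_bump_iff:
  "up_bump f a b \<longleftrightarrow> f \<in> PL_real \<and> a < b \<and> f a = a \<and> f b = b \<and> (\<forall>y\<in>{a<..<b}. y < f y)"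
  by (auto simp: up_bump_def)

text \<open>A corner of a decreasing map is a corner of its inverse, because the nodes of the
  inverse are the images of the nodes.\<close>

lemma cornered_iff:
  assumes "a < b"
  shows "l \<in> cornered a b \<longleftrightarrow> l \<in> PL_plus a b \<and> (up_cornered l a b \<or> up_cornered (inv l) a b)"
proof (cases "l \<in> PL_plus a b")
  case True
  then have l: "l \<in> PL_real" "l a = a" "l b = b" using PL_plus_iff[OF assms] by auto
  have il: "inv l \<in> PL_real" "inv l a = a" "inv l b = b"
    using l PL_real_inv PL_real_inv_less(5)[OF l(1)] by auto
  have mem: "l y \<in> {a<..<b} \<longleftrightarrow> y \<in> {a<..<b}" "inv l y \<in> {a<..<b} \<longleftrightarrow> y \<in> {a<..<b}" for y
    using PL_realD(8)[OF l(1), of a y] PL_realD(8)[OF l(1), of y b] PL_real_inv_less[OF l(1)] l by auto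
  have ll: "l (inv l y) = y" "inv l (l y) = y" "inv l y < inv l z \<longleftrightarrow> y < z" "l y < l z \<longleftrightarrow> y < z" for y z
    using PL_realD[OF l(1)] PL_realD(8)[OF il(1)] by auto
  have nd: "y \<in> nodes a b (inv l) \<longleftrightarrow> inv l y \<in> nodes a b l" for y
    using nodes_inv[OF l, of "inv l y"] ll by simp
  have 1: "(\<forall>y\<in>{a<..<b}. l y > y) \<and> (\<exists>x\<in>{a<..<b}. nodes a b l \<subseteq> {x<..<l x}) \<longleftrightarrow> up_cornered l a b"
    using l assms by (auto simp: up_cornered_def up_bump_iff)
  have "(\<forall>y\<in>{a<..<b}. l y < y) \<longleftrightarrow> up_bump (inv l) a b"
    using il assms PL_real_inv_less[OF l(1)] by (auto simp: up_bump_iff)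
  moreover have "(\<exists>x\<in>{a<..<b}. nodes a b l \<subseteq> {l x<..<x}) \<longleftrightarrow> (\<exists>x\<in>{a<..<b}. nodes a b (inv l) \<subseteq> {x<..<inv l x})"
  proof
    assume "\<exists>x\<in>{a<..<b}. nodes a b l \<subseteq> {l x<..<x}"
    then obtain x where x: "x \<in> {a<..<b}" "nodes a b l \<subseteq> {l x<..<x}" by blast
    \<comment> \<open>The nodes of the inverse lie between l (l x) and l x, the images of the bounds
      l x and x; so l (l x) is the corner of the inverse.\<close>
    have "y \<in> {l (l x)<..<inv l (l (l x))}" if "y \<in> nodes a b (inv l)" for y
    proof -
      have "inv l y \<in> {l x<..<x}" using that x nd by auto
      then show ?thesis using ll(4)[of "l x" "inv l y"] ll(4)[of "inv l y" x] ll(1,2) by simp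
    qed
    then show "\<exists>x\<in>{a<..<b}. nodes a b (inv l) \<subseteq> {x<..<inv l x}"
      using x(1) mem by (intro bexI[of _ "l (l x)"]) auto
  next
    assume "\<exists>x\<in>{a<..<b}. nodes a b (inv l) \<subseteq> {x<..<inv l x}"
    then obtain x where x: "x \<in> {a<..<b}" "nodes a b (inv l) \<subseteq> {x<..<inv l x}" by blast
    have "y \<in> {l (inv l (inv l x))<..<inv l (inv l x)}" if "y \<in> nodes a b l" for y
    proof -
      have "l y \<in> {x<..<inv l x}" using that x nd[of "l y"] ll by auto
      then show ?thesis using ll(3)[of x "l y"] ll(3)[of "l y" "inv l x"] ll(1,2) by simp
    qed
    then show "\<exists>x\<in>{a<..<b}. nodes a b l \<subseteq> {l x<..<x}"
      using x(1) mem by (intro bexI[of _ "inv l (inv l x)"]) auto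
  qed
  ultimately have 2: "(\<forall>y\<in>{a<..<b}. l y < y) \<and> (\<exists>x\<in>{a<..<b}. nodes a b l \<subseteq> {l x<..<x}) \<longleftrightarrow> up_cornered (inv l) a b"
    unfolding up_cornered_def by blast
  from True show ?thesis unfolding cornered_def mem_Collect_eq 1 2 by blast
qed (simp add: cornered_def)

text \<open>The orbit of y meets the half-open fundamental domain from x to l x once, so only one
  factor of the product can be nontrivial.\<close>

lemma phi_cornered:
  assumes "up_bump l a b" "nodes a b l \<subseteq> {x<..<l x}" "a < x" "x \<le> y" "y < l x" "x < b"
  shows "phi l y = jump_ratio l y"
proof -
  note u = up_bumpD[OF assms(1)]
  have y: "a < y" "y < b" using assms up_iter_mem(1)[OF assms(1), of 1 x] by auto
  have "jump_ratio l (int_iter l n y) = 1" if "n \<noteq> 0" for n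
  proof -
    have mem: "int_iter l n y \<in> {a<..<b}" using up_iter_mem[OF assms(1)] y by auto
    have "int_iter l n y \<notin> {x<..<l x}"
    proof (cases "n > 0")
      case True
      then have "int_iter l 1 y \<le> int_iter l n y" by (intro up_iter_le[OF assms(1) y]) auto
      moreover have "l x \<le> l y" using PL_realD(9)[OF u(1)] assms by simp
      ultimately show ?thesis by simp
    next
      case False
      then have "int_iter l n y \<le> int_iter l (-1) y" using that by (intro up_iter_le[OF assms(1) y]) auto
      moreover have "inv l y < x" using PL_real_inv_less[OF u(1)] assms by simp
      ultimately show ?thesis by simp
    qed
    with mem assms(2) show ?thesis by (auto simp: nodes_PL_real[OF u(1)])
  qed
  then have "phi l y = (\<Prod>n\<in>{0}. jump_ratio l (int_iter l n y))"
    unfolding phi_def by (intro Prod_any.expand_superset) auto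
  then show ?thesis by simp
qed

lemma back_iter:
  assumes "up_bump f a b" "affine_start f a e" "0 \<le> t" "t \<le> e"
  shows "int_iter f (- int m) (a + t) = a + t * right_slope f a powr (- real m)"
proof (induction m)
  case 0
  then show ?case using up_slopes(1)[OF assms(1)] by simp
next
  case (Suc m)
  let ?L = "right_slope f a"
  note u = up_bumpD[OF assms(1)]
  have L: "?L > 1" using up_slopes[OF assms(1)] by simp
  let ?t = "t * ?L powr (- real (Suc m))"
  have "?L powr (- real (Suc m)) \<le> ?L powr 0" using L by (intro powr_mono) auto
  then have "?t \<le> t * 1" using L assms by (intro mult_left_mono) auto
  then have t: "0 \<le> ?t" "?t \<le> e" using assms by auto
  have "?L * ?L powr (- real (Suc m)) = ?L powr 1 * ?L powr (- real (Suc m))" using L by simp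
  also have "\<dots> = ?L powr (- real m)" by (simp only: powr_add[symmetric]) simp
  finally have "f (a + ?t) = a + t * ?L powr (- real m)"
    using affine_startD[OF assms(2) t] u by (simp add: mult.left_commute)
  then have "f (a + ?t) = f (int_iter f (- int (Suc m)) (a + t))"
    using Suc int_iter_Suc[OF u(6), of "- int (Suc m)" "a + t"] by simp
  then show ?case using PL_realD(10)[OF u(1)] by simp
qed

text \<open>The corner x of the definition is replaced by the first node q: all nodes lie in the
  fundamental domain from q to l q, where \<open>phi\<close> is just the jump ratio. Hence
  \<open>phi l q\<close> is not 1, the two minima in \<open>psi_up\<close> coincide, and by
  periodicity q itself can serve as the reference point, although r has to lie before the first
  node.\<close>

lemma up_corneredD:
  assumes "up_cornered l a b" and q: "q = Min (nodes a b l)"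
  shows "up_bump l a b" "a < q" "q < b" "affine_start l a (q - a)" "l q = a + right_slope l a * (q - a)"
    "\<And>y. a < y \<Longrightarrow> y < q \<Longrightarrow> jump_ratio l y = 1"
    "\<And>y. l q \<le> y \<Longrightarrow> y < b \<Longrightarrow> jump_ratio l y = 1"
    "\<And>y. q \<le> y \<Longrightarrow> y < l q \<Longrightarrow> phi l y = jump_ratio l y"
    "psi_up a b l = (\<lambda>s\<in>{0..<1}. phi l (a + (q - a) * right_slope l a powr s))"
proof -
  show ul: "up_bump l a b" using assms by (simp add: up_cornered_def)
  note u = up_bumpD[OF ul]
  show q': "a < q" "q < b" "affine_start l a (q - a)" using affine_start_Min[OF ul] q by auto
  show "l q = a + right_slope l a * (q - a)"
    using affine_startD[OF q'(3), of "q - a"] q' u by simp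
  show "\<And>y. a < y \<Longrightarrow> y < q \<Longrightarrow> jump_ratio l y = 1"
    using q'(3) by (simp add: affine_start_def)
  obtain x where x: "a < x" "x < b" "nodes a b l \<subseteq> {x<..<l x}" using assms by (auto simp: up_cornered_def)
  have ne: "nodes a b l \<noteq> {}" using psi_up_nodes(2)[OF ul] by auto
  have qn: "q \<in> nodes a b l" unfolding q by (rule Min_in[OF psi_up_nodes(1)[OF ul] ne])
  then have xq: "x < q" "q < l x" using x by auto
  then have lq: "l x < l q" using PL_realD(8)[OF u(1)] by simp
  have lqb: "l q < b" using up_iter_mem(1)[OF ul, of 1 q] q' by simp
  show 7: "jump_ratio l y = 1" if "l q \<le> y" "y < b" for y
  proof (rule ccontr)
    assume "jump_ratio l y \<noteq> 1"
    then have "y \<in> nodes a b l" using that lq xq x u(5)[of x] by (auto simp: nodes_PL_real[OF u(1)])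
    then show False using x that lq by auto
  qed
  show 8: "phi l y = jump_ratio l y" if y: "q \<le> y" "y < l q" for y
  proof -
    have *: "jump_ratio l (int_iter l n y) = 1" if "n \<noteq> 0" for n
    proof (cases "n > 0")
      case True
      then have "int_iter l 1 y \<le> int_iter l n y" using y q' lqb by (intro up_iter_le[OF ul]) auto
      moreover have "l q \<le> l y" using PL_realD(9)[OF u(1)] y by simp
      ultimately show ?thesis using up_iter_mem[OF ul] y lqb by (intro 7) auto
    next
      case False
      then have "int_iter l n y \<le> int_iter l (-1) y" using that y q' lqb by (intro up_iter_le[OF ul]) auto
      moreover have "inv l y < q" using PL_real_inv_less[OF u(1)] y by simp
      ultimately have "int_iter l n y < q" by simp
      moreover have "a < int_iter l n y" using up_iter_mem[OF ul] y q' by auto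
      ultimately show ?thesis using q'(3) by (auto simp: affine_start_def)
    qed
    then have "phi l y = (\<Prod>n\<in>{0}. jump_ratio l (int_iter l n y))"
      unfolding phi_def by (intro Prod_any.expand_superset) auto
    then show ?thesis by simp
  qed
  have "phi l q \<noteq> 1" using 8[of q] qn u q' by (auto simp: nodes_PL_real[OF u(1)])
  then have "Min {z \<in> nodes a b l. phi l z \<noteq> 1} = q"
    using qn psi_up_nodes(1)[OF ul] q by (intro Min_eqI) auto
  then obtain r n where r: "n < 0" "r = int_iter l n q"
    "psi_up a b l = (\<lambda>s\<in>{0..<1}. phi l (a + (r - a) * right_slope l a powr s))"
    using psi_up_rep[OF ul] by metis
  define m where "m = nat (- n)"
  have "r = int_iter l (- int m) (a + (q - a))" using r by (simp add: m_def)
  also have "\<dots> = a + (q - a) * right_slope l a powr (- real m)"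
    using q' by (intro back_iter[OF ul]) auto
  finally have r_eq: "r - a = (q - a) * right_slope l a powr (- real m)" by simp
  have "phi l (a + (r - a) * right_slope l a powr s) = phi l (a + (q - a) * right_slope l a powr s)"
    if s: "s \<in> {0..<1}" for s
  proof -
    have m: "m > 0" using r by (simp add: m_def)
    have "frac (- real m + s) = s" using s by (simp add: frac_unique_iff)
    then show ?thesis
      using phi_frac[OF ul q'(3), of "q - a" "- real m + s"] q' s m unfolding r_eq
      by (simp add: powr_add[symmetric] mult.assoc)
  qed
  then show "psi_up a b l = (\<lambda>s\<in>{0..<1}. phi l (a + (q - a) * right_slope l a powr s))"
    unfolding r(3) by (intro restrict_ext) auto
qed

section \<open>Rigidity of cornered functions\<close>

text \<open>The composite of v with the inverse of u has no jumps on the image of the interval and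
  slope 1 at its left end, so it is a translation there; since u a = v a, it is the
  identity.\<close>

lemma eq_of_jumps:
  assumes "u \<in> PL_real" "v \<in> PL_real" "u a = v a" "right_slope u a = right_slope v a" "a < m"
    and "\<And>y. a < y \<Longrightarrow> y < m \<Longrightarrow> jump_ratio u y = jump_ratio v y"
    and y: "a \<le> y" "y \<le> m"
  shows "u y = v y"
proof -
  let ?w = "v \<circ> inv u"
  have w: "?w \<in> PL_real" by (intro PL_real_comp(1) PL_real_inv(1) assms)
  have iu: "inv u (v a) = a" using PL_realD(7)[OF assms(1), of a] assms(3) by simp
  have um: "u a < u m" using PL_realD(8)[OF assms(1), of a m] assms(5) by simp
  have "jump_ratio ?w z = 1" if z: "u a < z" "z < u m" for z
  proof -
    have x: "a < inv u z" "inv u z < m" "z = u (inv u z)"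
      using z PL_real_inv_less[OF assms(1)] PL_realD(6)[OF assms(1)] by auto
    have "jump_ratio (inv u) z = 1 / jump_ratio u (inv u z)"
      using jump_ratio_inv[OF assms(1), of "inv u z"] x(3) by simp
    then show ?thesis
      using jump_ratio_comp[OF PL_real_inv(1)[OF assms(1)] assms(2), of z] assms(6)[OF x(1,2)]
        jump_ratio_pos[OF assms(2), of "inv u z"] by simp
  qed
  moreover have "right_slope ?w (u a) = 1"
    using PL_real_comp(3)[OF PL_real_inv(1)[OF assms(1)] assms(2), of "u a"] PL_real_inv(3)[OF assms(1), of a]
      iu assms by simp
  moreover have "u a \<le> u y" "u y \<le> u m" using PL_realD(9)[OF assms(1)] y by auto
  ultimately have "?w (u y) = ?w (u a) + 1 * (u y - u a)"
    using no_jump_affine(1)[OF w um, of "u y"] by auto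
  then show ?thesis using PL_realD(7)[OF assms(1)] iu assms(3) by simp
qed

text \<open>The increasing affine bijection of (a, b) onto (c, d), in the normal form of
  \<open>PL_real_affine\<close>.\<close>

definition rescale :: "real \<Rightarrow> real \<Rightarrow> real \<Rightarrow> real \<Rightarrow> real \<Rightarrow> real" where
  "rescale a b c d y = (d - c) / (b - a) * y + (c - (d - c) / (b - a) * a)"

lemma rescale_PL_real:
  assumes "a < b" "c < d"
  shows "rescale a b c d \<in> PL_real" "left_slope (rescale a b c d) x = (d - c) / (b - a)"
    "right_slope (rescale a b c d) x = (d - c) / (b - a)" "rescale a b c d a = c" "rescale a b c d b = d"
proof -
  have eq: "rescale a b c d = (\<lambda>y. (d - c) / (b - a) * y + (c - (d - c) / (b - a) * a))"
    by (simp add: rescale_def fun_eq_iff)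
  show "rescale a b c d \<in> PL_real" "left_slope (rescale a b c d) x = (d - c) / (b - a)"
    "right_slope (rescale a b c d) x = (d - c) / (b - a)"
    unfolding eq using assms by (intro PL_real_affine; simp)+
  show "rescale a b c d a = c" by (simp add: rescale_def)
  have "k * b + (c - k * a) = c + k * (b - a)" for k by (simp add: algebra_simps)
  then have "rescale a b c d b = c + (d - c) / (b - a) * (b - a)" unfolding rescale_def .
  then show "rescale a b c d b = d" using assms by simp
qed

lemma jump_ratio_affine: "m > 0 \<Longrightarrow> jump_ratio (\<lambda>y. m * y + c) x = 1"
  using jump_ratio_eq_1[OF PL_real_affine(1)] PL_real_affine by simp

text \<open>The jumps and the initial slope determine a cornered function up to a homothety, and the
  ratio of the homothety is determined by the right end point, its first fixed point.\<close>

lemma up_cornered_unique: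
  assumes "up_cornered l a b" "up_cornered l' c d" "right_slope l a = right_slope l' c"
    "psi_up a b l = psi_up c d l'"
  shows "conj_between (rescale a b c d) l a b l' c d"
proof -
  define q where "q = Min (nodes a b l)"
  define q' where "q' = Min (nodes c d l')"
  note l = up_corneredD[OF assms(1) q_def] and l' = up_corneredD[OF assms(2) q'_def]
  note u = up_bumpD[OF l(1)] and u' = up_bumpD[OF l'(1)]
  let ?L = "right_slope l a"
  have L: "?L > 1" using up_slopes[OF l(1)] by simp
  \<comment> \<open>The affine map is chosen to carry the first node of l to that of l'.\<close>
  define A where "A = (q' - c) / (q - a)"
  have A: "A > 0" "A * (q - a) = q' - c" using l(2) l'(2) by (auto simp: A_def)
  define k where "k = (\<lambda>y. A * y + (c - A * a))"
  have k: "k \<in> PL_real" "left_slope k x = A" "right_slope k x = A" "jump_ratio k x = 1" for x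
    unfolding k_def using PL_real_affine[OF A(1)] jump_ratio_affine[OF A(1)] by auto
  have ka: "k (a + t) = c + A * t" for t by (simp add: k_def algebra_simps)
  have k0: "k a = c" using ka[of 0] by simp
  \<comment> \<open>Whether k takes b to d is not known yet, so the comparison runs up to the first
    of the two points b and \<open>inv k d\<close>.\<close>
  define m where "m = min b (inv k d)"
  have "m \<le> inv k d" by (simp add: m_def)
  then have km: "k m \<le> d" using PL_real_inv_less(4)[OF k(1)] by simp
  have m: "a < m" "m \<le> b" "\<And>y. y < m \<Longrightarrow> y < b \<and> k y < d"
    using u(2) u'(2) k0 PL_real_inv_less[OF k(1)] by (auto simp: m_def)
  have kq: "k q = q'" using ka[of "q - a"] A by simp
  have klq: "k (l q) = l' q'"
    using ka[of "?L * (q - a)"] l(5) l'(5) A(2) assms(3) by (simp add: mult.left_commute)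
  have *: "k (l y) = l' (k y)" if "a \<le> y" "y \<le> m" for y
  proof -
    have "jump_ratio (k \<circ> l) y = jump_ratio (l' \<circ> k) y" if y: "a < y" "y < m" for y
    proof -
      have kl: "c < k y" "y < q \<longleftrightarrow> k y < q'" "l q \<le> y \<longleftrightarrow> l' q' \<le> k y"
        using PL_realD(8)[OF k(1), of a y] PL_realD(8)[OF k(1), of y q] PL_realD(9)[OF k(1), of "l q" y] y k0 kq klq by auto
      have "jump_ratio l y = jump_ratio l' (k y)"
      proof (cases "y < q \<or> l q \<le> y")
        case True
        then show ?thesis using kl y m(3)[OF y(2)] l(6,7)[of y] l'(6,7)[of "k y"] by auto
      next
        case False
        \<comment> \<open>The logarithmic coordinate relative to q; it runs through [0, 1) as y runs
          through the fundamental domain from q to l q.\<close>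
        define s where "s = log ?L ((y - a) / (q - a))"
        have "1 \<le> (y - a) / (q - a)" "(y - a) / (q - a) < ?L"
          using False l(2,5) by (auto simp: field_simps)
        then have s: "s \<in> {0..<1}" "y = a + (q - a) * ?L powr s"
          using L l(2) y by (auto simp: s_def log_less_iff zero_le_log_cancel_iff)
        have "jump_ratio l y = phi l y" using l(8)[of y] False by simp
        also have "\<dots> = psi_up a b l s" using l(9) s by simp
        also have "\<dots> = phi l' (c + (q' - c) * ?L powr s)" using l'(9) s assms(3,4) by simp
        also have "c + (q' - c) * ?L powr s = k y" using s(2) ka[of "(q - a) * ?L powr s"] A(2) by (simp add: mult.assoc[symmetric])
        also have "phi l' (k y) = jump_ratio l' (k y)" using l'(8)[of "k y"] kl False by simp
        finally show ?thesis .
      qed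
      then show ?thesis using jump_ratio_comp[OF u(1) k(1)] jump_ratio_comp[OF k(1) u'(1)] k by simp
    qed
    moreover have "right_slope (k \<circ> l) a = right_slope (l' \<circ> k) a"
      using PL_real_comp(3)[OF u(1) k(1)] PL_real_comp(3)[OF k(1) u'(1)] k k0 u assms(3) by simp
    ultimately show ?thesis
      using eq_of_jumps[of "k \<circ> l" "l' \<circ> k" a m y] PL_real_comp(1)[OF u(1) k(1)] PL_real_comp(1)[OF k(1) u'(1)]
        m(1) that k0 u u' by simp
  qed
  \<comment> \<open>At m one of the two maps has a fixed point, hence so does the other; neither has
    one inside its bump, so both right ends are reached together.\<close>
  have kb: "k b = d"
  proof (cases "m = b")
    case True
    then have "l' (k b) = k b" using *[of b] m(1) u by simp
    moreover have "c < k b" using PL_realD(8)[OF k(1), of a b] k0 u by simp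
    ultimately show ?thesis using u'(5)[of "k b"] km True by fastforce
  next
    case False
    then have "m < b" "k m = d" using m(2) PL_realD(6)[OF k(1)] by (auto simp: m_def min_def split: if_splits)
    then have "k (l m) = k m" using *[of m] m(1) u' by simp
    then have "l m = m" using PL_realD(10)[OF k(1)] by simp
    then show ?thesis using u(5)[of m] m(1) \<open>m < b\<close> by simp
  qed
  then have "A * (b - a) = d - c" using ka[of "b - a"] by simp
  then have "A = (d - c) / (b - a)" using u(2) by (simp add: field_simps)
  then have keq: "k = rescale a b c d" by (simp add: k_def rescale_def fun_eq_iff)
  have "m = b" using kb PL_real_inv_less(5)[OF k(1), of d b] by (simp add: m_def)
  then show ?thesis using * kb k0 k unfolding conj_between_def keq[symmetric] by simp
qed

section \<open>Existence of cornered conjugates\<close>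

lemma powr_small:
  fixes L \<rho> e :: real
  assumes "L > 1" "\<rho> > 0" "e > 0"
  obtains i where "i \<ge> i0" "\<rho> * L powr (1 - real i) \<le> e"
proof -
  define i where "i = max i0 (nat \<lceil>1 + \<bar>log L (e / \<rho>)\<bar>\<rceil>)"
  have "real i \<ge> 1 + \<bar>log L (e / \<rho>)\<bar>" unfolding i_def by linarith
  then have "1 - real i \<le> log L (e / \<rho>)" by simp
  then have "L powr (1 - real i) \<le> e / \<rho>" using assms by (simp add: le_log_iff)
  then show ?thesis using assms by (intro that[of i]) (auto simp: i_def field_simps)
qed

text \<open>The conjugator linearizes \<open>f\<close> as far as a point beyond all nodes and is affine from there on.
  All nodes of the conjugate then lie in the fundamental domain before that point.\<close>

lemma linearize_up:
  assumes uf: "up_bump f a b" and e: "affine_start f a e" "a + e < b"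
    and z0: "a < z0" "z0 < a + e" "phi f z0 = 1"
  obtains l K M where "up_cornered l a b" "l \<in> PL_plus a b" "conj_between K f a b l a b"
    "nodes a b l \<subseteq> {K ((f ^^ M) z0)<..<l (K ((f ^^ M) z0))}"
proof -
  note u = up_bumpD[OF uf]
  obtain x2 where x2: "x2 < b" "\<And>y. x2 \<le> y \<Longrightarrow> y < b \<Longrightarrow> jump_ratio f y = 1"
    using no_jumps_ends[OF u(1,2)] by metis
  have z0b: "z0 < b" using z0 e by simp
  obtain M where M: "\<And>n. n \<ge> M \<Longrightarrow> x2 < (f ^^ n) z0" using up_reach[OF uf z0(1) z0b x2(1)] by blast
  \<comment> \<open>One step more than M, so that the linearization reaches Z = f P and covers both
    y and f y for every y up to P.\<close>
  define N where "N = Suc M"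
  define P where "P = (f ^^ M) z0"
  define Z where "Z = f P"
  let ?m = "right_slope f a"
  define L where "L = (\<lambda>y. ?m * y + (a - ?m * a))"
  have lam: "?m > 1" by (rule up_slopes[OF uf])
  have L: "L \<in> PL_real" "jump_ratio L x = 1" for x
    unfolding L_def using PL_real_affine(1)[of ?m] jump_ratio_affine[of ?m] lam by auto
  have LfP: "f y = L y" if "a \<le> y" "y \<le> a + e" for y
    using affine_startD[OF e(1), of "y - a"] that u by (simp add: L_def algebra_simps)
  have fN: "f ^^ n \<in> PL_real" "inv f ^^ n \<in> PL_real" "L ^^ n \<in> PL_real" for n
    using PL_real_funpow u PL_real_inv L by auto
  have Lj: "jump_ratio (L ^^ n) x = 1" for n x using L by (simp add: jump_ratio_funpow)
  \<comment> \<open>Pull back N steps by f, to where f and L agree, then push forward by L; up to Z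
    this conjugates f to the linear map L.\<close>
  define k1 where "k1 = (L ^^ N) \<circ> (inv f ^^ N)"
  have k1: "k1 \<in> PL_real" using PL_real_comp fN by (auto simp: k1_def)
  have inv_eq: "inv f ^^ N = inv (f ^^ N)" using u(6) by (simp add: inv_fn)
  have invf: "(inv f ^^ N) ((f ^^ N) y) = y" for y
    unfolding inv_eq using PL_realD(7)[OF fN(1)] by simp
  have k1j: "jump_ratio k1 ((f ^^ N) y) = 1 / jump_ratio (f ^^ N) y" for y
  proof -
    have "jump_ratio k1 z = jump_ratio (inv f ^^ N) z" for z
      using jump_ratio_comp[OF fN(2)[of N] fN(3)[of N], of z] by (simp only: Lj k1_def mult_1)
    then show ?thesis using jump_ratio_inv[OF fN(1), of N y] by (simp only: inv_eq)
  qed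
  have fNa: "(f ^^ n) a = a" "(inv f ^^ n) a = a" "(L ^^ n) a = a" for n
  proof -
    have "inv f a = a" using u(3) PL_real_inv_less(5)[OF u(1)] by simp
    moreover have "L a = a" by (simp add: L_def)
    ultimately show "(f ^^ n) a = a" "(inv f ^^ n) a = a" "(L ^^ n) a = a"
      using u(3) by (induction n; simp)+
  qed
  have k1a: "k1 a = a" by (simp add: k1_def fNa)
  have P: "a < P" "P < b" "x2 < P"
    using up_iter_mem[OF uf, of "int M" z0] z0 z0b M[of M] by (auto simp: P_def)
  then have PZ: "a < P" "P < b" "a < Z" "Z < b" "P < Z" "x2 < P" "Z = (f ^^ N) z0"
    using up_iter_mem[OF uf, of 1 P] u(5)[of P] by (auto simp: P_def Z_def N_def)
  have lin: "k1 (f y) = L (k1 y)" if y: "a \<le> y" "y \<le> Z" for y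
  proof -
    define w where "w = (inv f ^^ N) y"
    have w: "y = (f ^^ N) w" using PL_realD(6)[OF fN(1)] by (simp add: w_def inv_eq)
    have "a \<le> w" "w \<le> z0"
      using y PL_realD(9)[OF fN(1), of N a w] PL_realD(9)[OF fN(1), of N w z0] w PZ(7) fNa by auto
    then have "f w = L w" using z0 LfP by auto
    have "k1 (f y) = (L ^^ N) ((inv f ^^ N) ((f ^^ N) (f w)))" unfolding w k1_def by (simp add: funpow_swap1)
    also have "\<dots> = (L ^^ N) (L w)" unfolding invf \<open>f w = L w\<close> ..
    also have "\<dots> = L (k1 y)" by (simp add: k1_def w_def funpow_swap1)
    finally show ?thesis .
  qed
  define \<sigma> where "\<sigma> = left_slope k1 Z"
  have \<sigma>: "\<sigma> > 0" using slopes_pos k1 by (simp add: \<sigma>_def)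
  \<comment> \<open>Continuing with the left slope at Z leaves the modified map without a jump at Z
    or later.\<close>
  define v where "v = (\<lambda>y. \<sigma> * y + (k1 Z - \<sigma> * Z))"
  have v: "v \<in> PL_real" "v Z = k1 Z" "left_slope v x = \<sigma>" "right_slope v x = \<sigma>" for x
    unfolding v_def using PL_real_affine[OF \<sigma>] by auto
  define k where "k = (\<lambda>y. if y \<le> Z then k1 y else v y)"
  have k: "k \<in> PL_real" unfolding k_def by (rule PL_real_glue[OF k1 v(1)]) (simp add: v)
  have ka: "k a = a" using PZ k1a by (simp add: k_def)
  have kb: "a < k b" using PL_realD(8)[OF k, of a b] ka u by simp
  define B where "B = rescale a (k b) a b"
  note B = rescale_PL_real[OF kb u(2), folded B_def]
  define K where "K = B \<circ> k"
  have K: "K \<in> PL_real" "K a = a" "K b = b"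
    using PL_real_comp(1)[OF k B(1)] ka B by (auto simp: K_def)
  have Bj: "jump_ratio B x = 1" for x using jump_ratio_eq_1[OF B(1)] B by simp
  have Kj: "jump_ratio K y = jump_ratio k y" for y
    using jump_ratio_comp[OF k B(1)] Bj by (simp add: K_def)
  have kj1: "jump_ratio k y = jump_ratio k1 y" if "a < y" "y < Z" for y
    by (rule jump_ratio_cong[of a _ Z]) (use that k1 in \<open>auto simp: k_def\<close>)
  have kj2: "jump_ratio k y = 1" if "Z \<le> y" "y < b" for y
  proof (cases "y = Z")
    case True
    have "left_slope k Z = left_slope k1 Z"
      by (rule left_slope_cong[OF PZ(3) _ k1]) (simp add: k_def)
    moreover have "right_slope k Z = right_slope v Z"
    proof (rule right_slope_cong[OF PZ(4) _ v(1)])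
      show "k y = v y" if "Z \<le> y" for y using that v(2) by (cases "y = Z") (auto simp: k_def)
    qed
    ultimately show ?thesis using True jump_ratio_eq_1[OF k] v by (simp add: \<sigma>_def)
  next
    case False
    have "jump_ratio k y = jump_ratio v y"
      by (rule jump_ratio_cong[of Z _ b]) (use that False v in \<open>auto simp: k_def\<close>)
    then show ?thesis using jump_ratio_eq_1[OF v(1)] v by simp
  qed
  define l where "l = restr (K \<circ> f \<circ> inv K) a b"
  have "K \<circ> f \<circ> inv K \<in> PL_real" using K u PL_real_inv by (intro PL_real_comp(1))
  moreover have iK: "inv K a = a" "inv K b = b" using K PL_real_inv_less(5)[OF K(1)] by auto
  ultimately have lPL: "l \<in> PL_real" unfolding l_def using u K by (intro PL_real_restr) auto
  then have lplus: "l \<in> PL_plus a b" using PL_plus_iff[OF u(2)] by (auto simp: l_def restr_def)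
  have conj: "conj_between K f a b l a b"
    unfolding conj_between_def
  proof (intro conjI allI impI K)
    fix y assume y: "a \<le> y \<and> y \<le> b"
    show "K (f y) = l (K y)"
    proof (cases "y = a \<or> y = b")
      case True
      then show ?thesis using K u by (auto simp: l_def restr_def)
    next
      case False
      then have "a < K y" "K y < b" using y PL_realD(8)[OF K(1), of a y] PL_realD(8)[OF K(1), of y b] K by auto
      then show ?thesis using PL_realD(7)[OF K(1)] by (simp add: l_def restr_def)
    qed
  qed
  note cK = conj_betweenD[OF conj]
  have ul: "up_bump l a b" by (rule conj_up_bump[OF uf conj lPL])
  have lj: "jump_ratio l (K y) * jump_ratio k y = jump_ratio k (f y) * jump_ratio f y" if "a < y" "y < b" for y
  proof -
    have "jump_ratio (l \<circ> K) y = jump_ratio (K \<circ> f) y"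
      by (rule jump_ratio_cong[of a _ b]) (use that cK(4) PL_real_comp(1)[OF u(1) K(1)] in auto)
    then show ?thesis using jump_ratio_comp[OF K(1) lPL] jump_ratio_comp[OF u(1) K(1)] Kj by simp
  qed
  have kpos: "jump_ratio k y \<noteq> 0" for y using jump_ratio_pos[OF k, of y] by simp
  have nj: "jump_ratio l (K y) = 1" if y: "a < y" "y < b" "y \<le> P \<or> Z \<le> y" for y
  proof -
    consider "Z \<le> y" | "y = P" | "y < P" using y by linarith
    then show ?thesis
    proof cases
      case 1
      then have "jump_ratio k y = 1" "jump_ratio f y = 1" "jump_ratio k (f y) = 1"
        using y PZ x2 kj2 u(5)[of y] up_iter_mem(1)[OF uf, of 1 y] by auto
      then show ?thesis using lj[OF y(1,2)] by simp
    next
      \<comment> \<open>Here the hypothesis \<open>phi f z0 = 1\<close> enters: the jump of k1 at P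
        is the reciprocal of \<open>phi f y0\<close>, and y0 lies on the orbit of z0.\<close>
      case 2
      define y0 where "y0 = inv f z0"
      have y0: "f y0 = z0" "a < y0" "y0 < z0"
        using PL_realD(6)[OF u(1)] u(7)[of z0] PL_real_inv_less(2)[OF u(1), of a z0] z0 z0b u(3) by (auto simp: y0_def)
      have Py0: "P = (f ^^ N) y0" using y0 by (simp add: P_def N_def funpow_swap1)
      have "phi f y0 = jump_ratio (f ^^ N) y0"
        by (rule phi_eq_jump[OF uf]) (use y0 z0 z0b e x2 PZ Py0 in \<open>auto simp: affine_start_def\<close>)
      moreover have "phi f y0 = 1" using phi_step[OF u(6), of y0] y0 z0 by simp
      ultimately have "jump_ratio k P = 1" using k1j[of y0] kj1[of P] PZ Py0 by simp
      moreover have "jump_ratio k (f P) = 1" "jump_ratio f P = 1" using kj2[of Z] PZ x2 by (auto simp: Z_def)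
      ultimately show ?thesis using lj[OF y(1,2)] 2 by simp
    next
      case 3
      then have "f y < Z" using PL_realD(8)[OF u(1)] by (simp add: Z_def)
      moreover have "a < f y" using up_iter_mem(2)[OF uf, of 1 y] y by simp
      ultimately have "jump_ratio k (f y) = jump_ratio k1 (f y)" by (intro kj1)
      moreover have "jump_ratio k y = jump_ratio k1 y" using 3 y PZ by (intro kj1) auto
      moreover have "jump_ratio (k1 \<circ> f) y = jump_ratio (L \<circ> k1) y"
        by (rule jump_ratio_cong[of a _ Z]) (use y 3 PZ lin PL_real_comp(1)[OF k1 L(1)] in auto)
      then have "jump_ratio k1 (f y) * jump_ratio f y = jump_ratio k1 y"
        using jump_ratio_comp[OF u(1) k1] jump_ratio_comp[OF k1 L(1)] L by simp
      ultimately show ?thesis using lj[OF y(1,2)] kpos[of y] by simp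
    qed
  qed
  have KPZ: "l (K P) = K Z" using cK(4)[of P] PZ by (simp add: Z_def)
  have nd: "nodes a b l \<subseteq> {K P<..<l (K P)}"
  proof
    fix x assume x: "x \<in> nodes a b l"
    define y where "y = inv K x"
    have xy: "x = K y" using PL_realD(6)[OF K(1)] by (simp add: y_def)
    have "a < y" "y < b" "jump_ratio l (K y) \<noteq> 1" using x xy cK(5,7) by (auto simp: nodes_PL_real[OF lPL])
    then have "P < y" "y < Z" using nj[of y] by force+
    then show "x \<in> {K P<..<l (K P)}" unfolding KPZ xy using PL_realD(8)[OF K(1)] by simp
  qed
  have "K P \<in> {a<..<b}" using cK(5,7) PZ by auto
  then have "up_cornered l a b" unfolding up_cornered_def using ul nd by blast
  then show ?thesis using lplus conj nd unfolding P_def by (rule that)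
qed

text \<open>A shift in the class amounts to another reference point x0 with nontrivial
  \<open>phi\<close>. Cutting at z0 slightly before x0, with no nontrivial \<open>phi\<close> in
  between, makes the orbit of x0 yield the first node of the cornered conjugate, and the finite
  function then starts from it.\<close>

lemma up_cornered_exists:
  assumes uf: "up_bump f a b" and c: "c \<in> ff_class (psi_up a b f)" "c 0 \<noteq> 1"
  obtains l K where "up_cornered l a b" "l \<in> PL_plus a b" "conj_between K f a b l a b" "psi_up a b l = c"
proof -
  note u = up_bumpD[OF uf]
  let ?m = "right_slope f a"
  have lam: "?m > 1" by (rule up_slopes[OF uf])
  obtain e \<rho>0 where e: "affine_start f a e" "a + e < b" "0 < \<rho>0" "\<rho>0 \<le> e"
    and psi: "psi_up a b f = (\<lambda>s\<in>{0..<1}. phi f (a + \<rho>0 * ?m powr s))"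
    using psi_up_char[OF uf] by metis
  obtain t where t: "c \<in> finite_functions" "\<And>s. s \<in> {0..<1} \<Longrightarrow> c s = psi_up a b f (frac (s + t))"
    using c by (auto simp: ff_class_def)
  \<comment> \<open>The shift by t changes the scale by the power \<open>frac t\<close>; one further
    period back makes \<rho> strictly smaller than e.\<close>
  define \<rho> where "\<rho> = \<rho>0 * ?m powr (frac t - 1)"
  have "?m powr (frac t - 1) < ?m powr 0" using lam frac_lt_1[of t] by (intro powr_less_mono) auto
  then have "\<rho> < \<rho>0 * 1" unfolding \<rho>_def using lam e(3) by (intro mult_strict_left_mono) auto
  moreover have "0 < \<rho>" using e lam by (simp add: \<rho>_def)
  ultimately have \<rho>: "0 < \<rho>" "\<rho> < e" using e(4) by auto
  have cs: "c s = phi f (a + \<rho> * ?m powr s)" if s: "s \<in> {0..<1}" for s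
  proof -
    have "frac (s + frac t - 1) = frac (s + t)"
    proof -
      have "frac (y - of_int n) = frac y" for y :: real and n unfolding frac_def floor_diff_of_int by simp
      from this[of "s + frac t" 1] show ?thesis using frac_frac_add[of t s] by (simp add: add.commute)
    qed
    moreover have "s + frac t - 1 < 1" using s frac_lt_1[of t] by auto
    ultimately have "phi f (a + \<rho>0 * ?m powr (s + frac t - 1)) = phi f (a + \<rho>0 * ?m powr (frac (s + t)))"
      using phi_frac[OF uf e(1,3,4), of "s + frac t - 1"] by simp
    moreover have "\<rho>0 * ?m powr (s + frac t - 1) = \<rho> * ?m powr s"
      by (simp add: \<rho>_def mult.assoc powr_add[symmetric] algebra_simps)
    ultimately show ?thesis using t(2)[OF s] psi by (simp add: frac_lt_1)
  qed
  define x0 where "x0 = a + \<rho>"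
  have x0: "a < x0" "x0 < a + e" "x0 < b" "phi f x0 \<noteq> 1"
    using \<rho> e cs[of 0] c lam by (auto simp: x0_def)
  have ix0: "a < inv f x0" "inv f x0 < x0"
    using PL_real_inv_less(2)[OF u(1), of a x0] u(7)[of x0] x0 u(3) by auto
  define S where "S = {y \<in> {inv f x0..<x0}. phi f y \<noteq> 1}"
  have "finite S"
    by (rule finite_subset[OF _ finite_phi_near[OF uf e(1,2) ix0(1)]]) (use x0 e in \<open>auto simp: S_def\<close>)
  \<comment> \<open>The last point with nontrivial \<open>phi\<close> in the period before x0;
    between w and x0 there is room for the cut z0.\<close>
  define w where "w = Max (insert (inv f x0) S)"
  have w: "inv f x0 \<le> w" "w < x0" "\<And>y. y \<in> S \<Longrightarrow> y \<le> w"
    unfolding w_def using \<open>finite S\<close> ix0 by (auto simp: S_def)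
  define z0 where "z0 = (w + x0) / 2"
  have z0: "w < z0" "z0 < x0" using w by (auto simp: z0_def)
  have z1: "phi f y = 1" if "z0 \<le> y" "y < x0" for y
    using w(3)[of y] that z0 w(1) by (force simp: S_def)
  obtain l K M where l: "up_cornered l a b" "l \<in> PL_plus a b" "conj_between K f a b l a b"
    "nodes a b l \<subseteq> {K ((f ^^ M) z0)<..<l (K ((f ^^ M) z0))}"
    using linearize_up[OF uf e(1,2), of z0] z0 w(1) ix0 x0 z1 by auto
  note cK = conj_betweenD[OF l(3)]
  define P where "P = (f ^^ M) z0"
  define X where "X = (f ^^ M) x0"
  have z0b: "a < z0" "z0 < b" using z0 w ix0 x0 by auto
  have fz0: "x0 < f z0" using PL_real_inv_less(1)[OF u(1)] z0 w by fastforce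
  have fM: "f ^^ M \<in> PL_real" using u PL_real_funpow by blast
  have PX: "P < X" "X < f P" "a < P" "P < b" "X < b"
    using PL_realD(8)[OF fM] z0 fz0 up_iter_mem[OF uf, of "int M" z0] up_iter_mem[OF uf, of "int M" x0] z0b x0
    by (auto simp: P_def X_def funpow_swap1)
  have lPL: "l \<in> PL_real" using l(2) PL_plus_iff[OF u(2)] by blast
  have ul: "up_bump l a b" using l(1) by (simp add: up_cornered_def)
  define q where "q = Min (nodes a b l)"
  note lq = up_corneredD[OF l(1) q_def]
  have phil: "phi l (K y) = phi f y" if "a < y" "y < b" for y by (rule phi_conj[OF uf l(3) lPL that])
  have lKP: "l (K P) = K (f P)" using cK(4)[of P] PX by simp
  have jl: "jump_ratio l (K y) = phi f y" if y: "P \<le> y" "y < f P" for y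
  proof -
    have "y < b" using y up_iter_mem(1)[OF uf, of 1 P] PX by simp
    moreover have "K P \<le> K y" "K y < l (K P)" unfolding lKP using PL_realD(8,9)[OF cK(1)] y by auto
    then have "phi l (K y) = jump_ratio l (K y)"
      using phi_cornered[OF ul l(4)[folded P_def]] cK(5,7) PX by auto
    ultimately show ?thesis using phil[of y] y PX by simp
  qed
  have phifM: "phi f ((f ^^ M) y) = phi f y" for y using phi_shift[OF u(6), of "int M" y] by simp
  have qX: "q = K X"
    unfolding q_def
  proof (rule Min_eqI)
    show "finite (nodes a b l)" by (rule finite_nodes[OF lPL])
    show "K X \<in> nodes a b l"
      using jl[of X] PX x0(4) phifM cK(5,7) by (auto simp: nodes_PL_real[OF lPL] X_def[symmetric]) (metis X_def phifM)
    fix x assume x: "x \<in> nodes a b l"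
    define y where "y = inv K x"
    have xy: "x = K y" using PL_realD(6)[OF cK(1)] by (simp add: y_def)
    have "K P < K y" "K y < K (f P)" using x l(4) xy lKP P_def by auto
    then have y: "P < y" "y < f P" using PL_realD(8)[OF cK(1)] by auto
    have "X \<le> y"
    proof (rule ccontr)
      assume "\<not> X \<le> y"
      define y' where "y' = inv (f ^^ M) y"
      have y': "y = (f ^^ M) y'" using PL_realD(6)[OF fM] by (simp add: y'_def)
      have "z0 < y'" "y' < x0" using y(1) \<open>\<not> X \<le> y\<close> PL_realD(8,9)[OF fM] y' by (auto simp: P_def X_def)
      then have "phi f y = 1" using z1[of y'] phifM y' by simp
      then show False using jl[of y] y x xy by (auto simp: nodes_PL_real[OF lPL])
    qed
    then show "K X \<le> x" using xy PL_realD(9)[OF cK(1)] by simp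
  qed
  have sl: "right_slope l a = ?m" using conj_slopes(1)[OF l(3) u(1) lPL u(3,4,2)] .
  obtain e'' where e'': "affine_start K a e''" using affine_start_exists[OF cK(1) u(2)] by metis
  let ?\<kappa> = "right_slope K a"
  have "psi_up a b l s = c s" if s: "s \<in> {0..<1}" for s
  proof -
    \<comment> \<open>Far enough back K is affine. Comparing the reference points q and x0 there
      gives the scale of l as that of f times the slope of K, up to whole periods.\<close>
    obtain i where i: "i \<ge> 1" "\<rho> * ?m powr (1 - real i) \<le> e''"
      using powr_small[OF lam \<rho>(1), of e'' 1] e'' by (auto simp: affine_start_def)
    have small: "\<rho> * ?m powr (r - real i) \<le> e''" if "r < 1" for r
    proof -
      have "?m powr (r - real i) \<le> ?m powr (1 - real i)" using lam that by (intro powr_mono) auto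
      then have "\<rho> * ?m powr (r - real i) \<le> \<rho> * ?m powr (1 - real i)" using \<rho> by (intro mult_left_mono) auto
      with i show ?thesis by simp
    qed
    have Ks: "K (a + \<rho> * ?m powr (r - real i)) = a + ?\<kappa> * (\<rho> * ?m powr (r - real i))" if "r < 1" for r
      using affine_startD[OF e'' _ small[OF that]] \<rho> cK(2) by simp
    define j where "j = i + M"
    have "int_iter l (- int j) q = K (int_iter f (- int j) X)"
      unfolding qX by (rule int_iter_commute[of f l "{a<..<b}"])
        (use u PX up_iter_mem[OF uf] cK(4) PL_realD(3)[OF lPL] in auto)
    also have "int_iter f (- int j) X = int_iter f (- int i) x0"
      using int_iter_add[OF u(6), of "- int j" "int M" x0] by (simp add: X_def j_def)
    also have "\<dots> = a + \<rho> * ?m powr (0 - real i)"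
      unfolding x0_def using back_iter[OF uf e(1), of \<rho> i] \<rho> by simp
    also have "K \<dots> = a + ?\<kappa> * (\<rho> * ?m powr (0 - real i))" by (rule Ks) simp
    finally have "a + (q - a) * ?m powr (- real j) = a + ?\<kappa> * (\<rho> * ?m powr (0 - real i))"
      using back_iter[OF ul lq(4), of "q - a" j] lq(2) sl by simp
    then have qj: "(q - a) * ?m powr (- real j) = ?\<kappa> * (\<rho> * ?m powr (- real i))" by simp
    have fr: "frac (s - real n) = s" for n using s by (simp add: frac_unique_iff)
    have "psi_up a b l s = phi l (a + (q - a) * ?m powr s)" using lq(9) s sl by simp
    also have "\<dots> = phi l (a + (q - a) * ?m powr (s - real j))"
      using phi_frac[OF ul lq(4), of "q - a" "s - real j"] lq(2) s i sl fr[of j] by (simp add: j_def)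
    also have "(q - a) * ?m powr (s - real j) = ((q - a) * ?m powr (- real j)) * ?m powr s"
      by (simp add: powr_add[symmetric] mult.assoc)
    also have "\<dots> = ?\<kappa> * (\<rho> * ?m powr (s - real i))"
      unfolding qj by (simp add: powr_add[symmetric] mult.assoc)
    also have "a + \<dots> = K (a + \<rho> * ?m powr (s - real i))" using Ks s by simp
    also have "phi l \<dots> = phi f (a + \<rho> * ?m powr (s - real i))"
      using powr_region[OF uf e(1,2) \<rho>(1), of "s - real i"] \<rho> s by (intro phil) auto
    also have "\<dots> = phi f (a + \<rho> * ?m powr s)"
      using phi_frac[OF uf e(1) \<rho>(1), of "s - real i"] \<rho> s i fr[of i] by simp
    finally show ?thesis using cs[OF s] by simp
  qed
  moreover have "c \<in> extensional {0..<1}" "psi_up a b l \<in> extensional {0..<1}"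
    using t(1) psi_up_finite_function(1)[OF ul] by (auto simp: finite_functions_def PiE_def)
  ultimately have "psi_up a b l = c" by (metis extensionalityI)
  with l(1-3) show ?thesis by (rule that)
qed

section \<open>Minimum cornered functions and roots\<close>

lemma PL_plusD:
  assumes "a < b" "k \<in> PL_plus a b"
  shows "k \<in> PL_real" "k a = a" "k b = b" "y \<le> a \<or> b \<le> y \<Longrightarrow> k y = y"
  using assms PL_plus_iff[OF assms(1)] by auto

lemma restr_eq: "f a = a \<Longrightarrow> f b = b \<Longrightarrow> a \<le> y \<Longrightarrow> y \<le> b \<Longrightarrow> restr f a b y = f y"
  by (cases "y = a"; cases "y = b") (auto simp: restr_def)

lemma restr_off: "y \<le> a \<or> b \<le> y \<Longrightarrow> restr f a b y = y"
  by (auto simp: restr_def)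

lemma restr_PL_plus:
  assumes "f \<in> PL_real" "a < b" "f a = a" "f b = b" shows "restr f a b \<in> PL_plus a b"
  using PL_real_restr[OF assms] PL_plus_iff[OF assms(2)] by (auto simp: restr_def)

lemma PL_plus_eqI:
  assumes "a < b" "h \<in> PL_plus a b" "k \<in> PL_plus a b" "\<And>y. a < y \<Longrightarrow> y < b \<Longrightarrow> h y = k y"
  shows "h = k"
proof
  fix y
  show "h y = k y" using assms PL_plusD(4)[OF assms(1,2), of y] PL_plusD(4)[OF assms(1,3), of y]
    by (cases "a < y \<and> y < b") auto
qed

lemma PL_plus_inv:
  assumes "a < b" "k \<in> PL_plus a b" shows "inv k \<in> PL_plus a b"
  using assms PL_plus_iff[OF assms(1)] PL_real_inv(1)[of k] PL_real_inv_less(5)[of k] by auto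

lemma PL_plus_comp:
  assumes "a < b" "h \<in> PL_plus a b" "k \<in> PL_plus a b" shows "h \<circ> k \<in> PL_plus a b"
  using assms PL_plus_iff[OF assms(1)] PL_real_comp(1)[of k h] by auto

lemma PL_plus_int_iter:
  assumes "a < b" "k \<in> PL_plus a b" shows "int_iter k n \<in> PL_plus a b"
  using assms PL_plus_iff[OF assms(1)] PL_real_int_iter[of k n] int_iter_fix[OF PL_realD(3)[of k]] by auto

lemma bump_mem:
  assumes "f \<in> PL_real" "f a = a" "f b = b"
  shows "f y < b \<longleftrightarrow> y < b" "a < f y \<longleftrightarrow> a < y" "f y \<le> b \<longleftrightarrow> y \<le> b" "a \<le> f y \<longleftrightarrow> a \<le> y"
  using iter_mem[OF assms, of 1 y] by auto

lemma conj_between_restr: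
  assumes "conj_between k f a b l a b" "f \<in> PL_real" "f a = a" "f b = b" "a < b"
  shows "conj_between (restr k a b) f a b l a b" "restr k a b \<in> PL_plus a b"
    "right_slope (restr k a b) a = right_slope k a" "left_slope (restr k a b) b = left_slope k b"
proof -
  note k = conj_betweenD[OF assms(1)]
  have r: "restr k a b y = k y" if "a \<le> y" "y \<le> b" for y using restr_eq[of k a b y] k(2,3) that by simp
  show p: "restr k a b \<in> PL_plus a b" using k(1-3) assms(5) by (intro restr_PL_plus)
  have "restr k a b (f y) = l (restr k a b y)" if "a \<le> y" "y \<le> b" for y
    using that r k(4)[of y] bump_mem[OF assms(2-4), of y] by simp
  then show "conj_between (restr k a b) f a b l a b"
    unfolding conj_between_def using p PL_plusD[OF assms(5) p] by simp
  show "right_slope (restr k a b) a = right_slope k a"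
    by (rule right_slope_cong[OF assms(5) _ k(1)]) (use r in auto)
  show "left_slope (restr k a b) b = left_slope k b"
    by (rule left_slope_cong[OF assms(5) _ k(1)]) (use r in auto)
qed

lemma conj_PL_plus_iff:
  assumes "a < b" "f \<in> PL_real" "f a = a" "f b = b" "k \<in> PL_plus a b" "l \<in> PL_plus a b"
  shows "k \<circ> restr f a b \<circ> inv k = l \<longleftrightarrow> conj_between k f a b l a b"
proof -
  note k = PL_plusD[OF assms(1,5)] and l = PL_plusD[OF assms(1,6)]
  have r: "restr f a b y = f y" if "a \<le> y" "y \<le> b" for y using restr_eq[of f a b y] assms that by simp
  have "k \<circ> restr f a b \<circ> inv k = l \<longleftrightarrow> (\<forall>y. k (restr f a b y) = l (k y))"
  proof
    assume "k \<circ> restr f a b \<circ> inv k = l"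
    then have "k (restr f a b (inv k (k y))) = l (k y)" for y by (metis comp_apply)
    then show "\<forall>y. k (restr f a b y) = l (k y)" using PL_realD(7)[OF k(1)] by simp
  next
    assume *: "\<forall>y. k (restr f a b y) = l (k y)"
    have "k (restr f a b (inv k y)) = l y" for y using *[rule_format, of "inv k y"] PL_realD(6)[OF k(1)] by simp
    then show "k \<circ> restr f a b \<circ> inv k = l" by (simp add: fun_eq_iff)
  qed
  also have "\<dots> \<longleftrightarrow> (\<forall>y. a \<le> y \<and> y \<le> b \<longrightarrow> k (f y) = l (k y))"
  proof -
    have "k (restr f a b y) = l (k y)" if "\<not> (a \<le> y \<and> y \<le> b)" for y
      using that restr_off[of y a b f] k(4)[of y] l(4)[of y] by auto
    then show ?thesis using r by metis
  qed
  finally show ?thesis using k by (simp add: conj_between_def)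
qed

section \<open>Existence and uniqueness of the minimum cornered function\<close>

definition is_min_cornered :: "(real \<Rightarrow> real) \<Rightarrow> (real \<Rightarrow> real) \<Rightarrow> real \<Rightarrow> real \<Rightarrow> bool" where
  "is_min_cornered l f a b \<longleftrightarrow> l \<in> cornered a b \<and> psi a b l = min_ff f a b
     \<and> initial_slope a b l = initial_slope a b f"

lemma up_cornered_imp_up_bump: "up_cornered l a b \<Longrightarrow> up_bump l a b"
  by (simp add: up_cornered_def)

lemma right_slope_inv_fix:
  assumes "f \<in> PL_real" "f a = a"
  shows "right_slope (inv f) a = 1 / right_slope f a" "left_slope (inv f) a = 1 / left_slope f a"
  using PL_real_inv(2,3)[OF assms(1), of a] assms(2) by auto

lemma is_min_cornered_exists:
  assumes "bump f a b"
  obtains l k where "is_min_cornered l f a b" "k \<in> PL_plus a b" "conj_between k f a b l a b"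
proof -
  note u = bumpD[OF assms]
  note m = min_ff_in_class[OF assms]
  from bump_cases[OF assms] show ?thesis
  proof
    assume uf: "up_bump f a b"
    obtain l K where l: "up_cornered l a b" "l \<in> PL_plus a b" "conj_between K f a b l a b" "psi_up a b l = min_ff f a b"
      using up_cornered_exists[OF uf, of "min_ff f a b"] m psi_up_bump[OF uf] by metis
    have lPL: "l \<in> PL_real" using PL_plusD(1)[OF u(2) l(2)] .
    have "right_slope l a = right_slope f a" using conj_slopes(1)[OF l(3) u(1) lPL u(3,4,2)] .
    then have "is_min_cornered l f a b"
      unfolding is_min_cornered_def
      using cornered_iff[OF u(2)] l psi_up_bump[OF up_cornered_imp_up_bump[OF l(1)]] initial_slope_PL_real[OF u(1,2)]
        initial_slope_PL_real[OF lPL u(2)] by simp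
    with conj_between_restr(1,2)[OF l(3) u(1,3,4,2)] show ?thesis using that by blast
  next
    assume uf: "up_bump (inv f) a b"
    note ui = up_bumpD[OF uf]
    obtain l K where l: "up_cornered l a b" "l \<in> PL_plus a b" "conj_between K (inv f) a b l a b" "psi_up a b l = min_ff f a b"
      using up_cornered_exists[OF uf, of "min_ff f a b"] m psi_down_bump[OF uf u(1)] by metis
    have lPL: "l \<in> PL_real" "l a = a" "l b = b" using PL_plusD[OF u(2) l(2)] by auto
    have il: "inv l \<in> PL_plus a b" "inv l \<in> PL_real" "inv (inv l) = l"
      using PL_plus_inv[OF u(2) l(2)] PL_real_inv[OF lPL(1)] inv_inv_PL_real[OF lPL(1)] by auto
    have "conj_between K (inv (inv f)) a b (inv l) a b"
      by (rule conj_between_inverses[OF l(3) ui(1) lPL(1) ui(3,4)])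
    then have c: "conj_between K f a b (inv l) a b" using inv_inv_PL_real[OF u(1)] by simp
    have "right_slope (inv l) a = right_slope f a" using conj_slopes(1)[OF c u(1) il(2) u(3,4,2)] .
    moreover have "psi a b (inv l) = psi_up a b l"
      using psi_down_bump[of "inv l" a b] il l(1) by (simp add: up_cornered_def)
    ultimately have "is_min_cornered (inv l) f a b"
      unfolding is_min_cornered_def
      using cornered_iff[OF u(2)] l il initial_slope_PL_real[OF u(1,2)]
        initial_slope_PL_real[OF il(2) u(2)] by simp
    with conj_between_restr(1,2)[OF c u(1,3,4,2)] show ?thesis using that by blast
  qed
qed

text \<open>Stated for two bumps at once: for equal bumps the affine map is the identity and this is
  uniqueness, for conjugate bumps it says that the minimum cornered functions are affinely
  conjugate.\<close>

lemma is_min_cornered_unique: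
  assumes "bump f a b" "bump g c d" "is_min_cornered l f a b" "is_min_cornered l' g c d"
    "min_ff f a b = min_ff g c d" "right_slope f a = right_slope g c"
  shows "conj_between (rescale a b c d) l a b l' c d"
proof -
  note u = bumpD[OF assms(1)] and v = bumpD[OF assms(2)]
  have l: "l \<in> PL_plus a b" "up_cornered l a b \<or> up_cornered (inv l) a b" "psi a b l = min_ff f a b"
    "initial_slope a b l = initial_slope a b f"
    using assms(3) cornered_iff[OF u(2)] by (auto simp: is_min_cornered_def)
  have l': "l' \<in> PL_plus c d" "up_cornered l' c d \<or> up_cornered (inv l') c d" "psi c d l' = min_ff g c d"
    "initial_slope c d l' = initial_slope c d g"
    using assms(4) cornered_iff[OF v(2)] by (auto simp: is_min_cornered_def)
  note p = PL_plusD[OF u(2) l(1)] and p' = PL_plusD[OF v(2) l'(1)]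
  have ip: "inv l \<in> PL_real" "inv l a = a" "inv l b = b"
    "inv l' \<in> PL_real" "inv l' c = c" "inv l' d = d"
    using PL_plusD[OF u(2) PL_plus_inv[OF u(2) l(1)]] PL_plusD[OF v(2) PL_plus_inv[OF v(2) l'(1)]] by auto
  have s: "right_slope l a = right_slope l' c"
    using l(4) l'(4) assms(6) by (simp add: initial_slope_PL_real u v p p')
  have si: "right_slope (inv l) a = 1 / right_slope l a" "right_slope (inv l') c = 1 / right_slope l' c"
    using right_slope_inv_fix p p' by auto
  have pos: "right_slope l a > 0" using slopes_pos p by blast
  have down: "right_slope k x < 1" if "up_cornered (inv k) x y" "k \<in> PL_real" "k x = x" for k x y
    using up_slopes(1)[OF up_cornered_imp_up_bump[OF that(1)]] right_slope_inv_fix(1)[OF that(2,3)]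
      slopes_pos(2)[OF that(2), of x] by (simp add: less_divide_eq_1)
  have up: "right_slope k x > 1" if "up_cornered k x y" for k x y
    using up_slopes(1)[OF up_cornered_imp_up_bump[OF that]] .
  show ?thesis
  proof (cases "up_cornered l a b")
    case True
    \<comment> \<open>An increasing bump has initial slope above 1 and a decreasing one below 1, so
      equal slopes force the same direction.\<close>
    then have L: "up_cornered l' c d" using up[OF True] down[of l' c d] l'(2) p' s by auto
    show ?thesis
      using up_cornered_unique[OF True L s] psi_up_bump[OF up_cornered_imp_up_bump[OF True]]
        psi_up_bump[OF up_cornered_imp_up_bump[OF L]] l(3) l'(3) assms(5) by simp
  next
    case False
    then have T: "up_cornered (inv l) a b" using l by simp
    have L: "up_cornered (inv l') c d" using down[OF T p(1,2)] up[of l' c d] l'(2) s by auto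
    have "conj_between (rescale a b c d) (inv l) a b (inv l') c d"
      using up_cornered_unique[OF T L] psi_down_bump[OF up_cornered_imp_up_bump[OF T] p(1)]
        psi_down_bump[OF up_cornered_imp_up_bump[OF L] p'(1)] l(3) l'(3) assms(5) s si by simp
    from conj_between_inverses[OF this ip(1,4,2,3)]
    show ?thesis using inv_inv_PL_real p p' by simp
  qed
qed

lemma min_cornered_is_min_cornered:
  assumes "bump f a b" shows "is_min_cornered (min_cornered f a b) f a b"
proof -
  note u = bumpD[OF assms]
  obtain l where l: "is_min_cornered l f a b" using is_min_cornered_exists[OF assms] by blast
  have "l' = l" if l': "is_min_cornered l' f a b" for l'
  proof -
    have pl: "l \<in> PL_plus a b" "l' \<in> PL_plus a b"
      using l l' by (auto simp: is_min_cornered_def cornered_def)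
    have "rescale a b a b = id" using u(2) by (simp add: rescale_def fun_eq_iff)
    then have "conj_between id l' a b l a b" using is_min_cornered_unique[OF assms assms l' l] by simp
    then show ?thesis using pl u(2) by (intro PL_plus_eqI[of a b]) (auto simp: conj_between_def)
  qed
  then have "(THE l. is_min_cornered l f a b) = l" using l by blast
  then show ?thesis using l unfolding min_cornered_def is_min_cornered_def[symmetric] by simp
qed

lemma min_cornered_conj:
  assumes "bump f a b" "bump g c d" "conj_between h f a b g c d"
  shows "conj_between (rescale a b c d) (min_cornered f a b) a b (min_cornered g c d) c d"
proof (rule is_min_cornered_unique[OF assms(1,2)])
  note u = bumpD[OF assms(1)] and v = bumpD[OF assms(2)]
  show "min_ff f a b = min_ff g c d" using min_ff_conj[OF assms(1,3) v(1)] by simp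
  show "right_slope f a = right_slope g c" using conj_slopes(1)[OF assms(3) u(1) v(1) u(3,4,2)] by simp
qed (use assms min_cornered_is_min_cornered in auto)

lemma conj_to_min_spec:
  assumes "bump f a b"
  shows "conj_to_min f a b \<in> PL_plus a b"
    "conj_between (conj_to_min f a b) f a b (min_cornered f a b) a b"
proof -
  note u = bumpD[OF assms]
  obtain l k where l: "is_min_cornered l f a b" "k \<in> PL_plus a b" "conj_between k f a b l a b"
    using is_min_cornered_exists[OF assms] .
  have m: "is_min_cornered (min_cornered f a b) f a b" by (rule min_cornered_is_min_cornered[OF assms])
  have pm: "min_cornered f a b \<in> PL_plus a b" using m by (auto simp: is_min_cornered_def cornered_def)
  have "rescale a b a b = id" using u(2) by (simp add: rescale_def fun_eq_iff)
  then have "conj_between id l a b (min_cornered f a b) a b"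
    using is_min_cornered_unique[OF assms assms l(1) m] by simp
  from conj_between_comp[OF l(3) this] have "conj_between k f a b (min_cornered f a b) a b" by simp
  then have "\<exists>k. k \<in> PL_plus a b \<and> k \<circ> restr f a b \<circ> inv k = min_cornered f a b"
    using conj_PL_plus_iff[OF u(2,1,3,4) l(2) pm] l(2) by blast
  from someI_ex[OF this] show p: "conj_to_min f a b \<in> PL_plus a b"
    and "conj_between (conj_to_min f a b) f a b (min_cornered f a b) a b"
    using conj_PL_plus_iff[OF u(2,1,3,4) _ pm] unfolding conj_to_min_def[symmetric] by blast+
qed

section \<open>The centralizer and its generator\<close>

lemma centralizer_iff:
  assumes "bump f a b"
  shows "h \<in> centralizer a b (restr f a b) \<longleftrightarrow> h \<in> PL_plus a b \<and> conj_between h f a b f a b"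
proof (cases "h \<in> PL_plus a b")
  case True
  note u = bumpD[OF assms] 
  note h = PL_plusD[OF u(2) True]
  have r: "restr f a b y = f y" if "a \<le> y" "y \<le> b" for y using restr_eq[of f a b y] u that by simp
  have "h (restr f a b y) = restr f a b (h y)" if "\<not> (a \<le> y \<and> y \<le> b)" for y
    using that restr_off[of y a b f] h(4)[of y] by auto
  moreover have "h (restr f a b y) = restr f a b (h y) \<longleftrightarrow> h (f y) = f (h y)" if "a \<le> y \<and> y \<le> b" for y
    using that r[of y] r[of "h y"] bump_mem[OF h(1-3), of y] by auto
  ultimately have "h \<circ> restr f a b = restr f a b \<circ> h \<longleftrightarrow> (\<forall>y. a \<le> y \<and> y \<le> b \<longrightarrow> h (f y) = f (h y))"
    unfolding fun_eq_iff comp_apply by metis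
  then show ?thesis using True h by (simp add: centralizer_def conj_between_def)
qed (simp add: centralizer_def)

lemma slopes_int_iter:
  assumes "h \<in> PL_real" "h a = a"
  shows "right_slope (int_iter h n) a = right_slope h a powi n" "left_slope (int_iter h n) a = left_slope h a powi n"
proof -
  note b = PL_realD(3)[OF assms(1)]
  have Suc: "int_iter h (n + 1) = h \<circ> int_iter h n" for n using int_iter_Suc[OF b] by (simp add: fun_eq_iff)
  have fx: "int_iter h n a = a" for n by (rule int_iter_fix[OF b assms(2)])
  have *: "right_slope (int_iter h (n + 1)) a = right_slope h a * right_slope (int_iter h n) a"
    "left_slope (int_iter h (n + 1)) a = left_slope h a * left_slope (int_iter h n) a" for n
    unfolding Suc using PL_real_comp[OF PL_real_int_iter[OF assms(1)] assms(1)] fx by auto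
  show "right_slope (int_iter h n) a = right_slope h a powi n"
  proof (induction n rule: int_induct[of _ 0])
    case base show ?case unfolding int_iter_simps PL_real_id by simp
  next
    case (step1 i) then show ?case using assms by (simp add: * power_int_add_1')
  next
    case (step2 i)
    then show ?case using *(1)[of "i - 1"] assms power_int_add_1'[of "right_slope h a" "i - 1"] by simp
  qed
  show "left_slope (int_iter h n) a = left_slope h a powi n"
  proof (induction n rule: int_induct[of _ 0])
    case base show ?case unfolding int_iter_simps PL_real_id by simp
  next
    case (step1 i) then show ?case using assms by (simp add: * power_int_add_1')
  next
    case (step2 i)
    then show ?case using *(2)[of "i - 1"] assms power_int_add_1'[of "left_slope h a" "i - 1"] by simp
  qed
qed

text \<open>Initial slope 1 makes h the identity on a segment at a. As h commutes with f, it fixes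
  every point whose orbit enters this segment, that is, every point of the bump.\<close>

lemma conj_self_id:
  assumes "up_bump f a b" "conj_between h f a b f a b" "right_slope h a = 1" "a < y" "y < b"
  shows "h y = y"
proof -
  note u = up_bumpD[OF assms(1)] and h = conj_betweenD[OF assms(2)]
  obtain e where e: "affine_start h a e" using affine_start_exists[OF h(1) u(2)] by metis
  then have "a < a + e" by (simp add: affine_start_def)
  then obtain N where N: "int_iter f N y < a + e" using up_tends_a[OF assms(1,4,5)] by blast
  have "a < int_iter f N y" using up_iter_mem[OF assms(1)] assms by simp
  then have "h (int_iter f N y) = int_iter f N y"
    using affine_startD[OF e, of "int_iter f N y - a"] N assms(3) h(2) by simp
  moreover have "int_iter f N (h y) = h (int_iter f N y)"
    by (rule int_iter_commute[of f f "{a<..<b}"]) (use u h up_iter_mem[OF assms(1)] assms in auto)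
  ultimately show ?thesis using PL_realD(10)[OF PL_real_int_iter[OF u(1)]] by metis
qed

text \<open>A priori h is affine on a segment that depends on h. Going back by f, applying h there
  and returning gives a range that depends only on f and the slope of h; the finiteness of the set
  of slopes rests on this.\<close>

lemma conj_self_affine:
  assumes "up_bump f a b" "conj_between h f a b f a b" "affine_start f a e" "a + e < b"
    "0 < t" "t \<le> e" "right_slope h a * t \<le> e"
  shows "h (a + t) = a + right_slope h a * t"
proof -
  note u = up_bumpD[OF assms(1)] and h = conj_betweenD[OF assms(2)]
  obtain e' where e': "affine_start h a e'" using affine_start_exists[OF h(1) u(2)] by metis
  let ?m = "right_slope f a"
  have m: "?m > 1" by (rule up_slopes[OF assms(1)])
  obtain i where i: "t * ?m powr (1 - real i) \<le> e'"
    using powr_small[OF m assms(5), of e' 0] e' by (auto simp: affine_start_def)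
  have "?m powr (- real i) \<le> ?m powr (1 - real i)" using m by (intro powr_mono) auto
  then have "t * ?m powr (- real i) \<le> t * ?m powr (1 - real i)" using assms by (intro mult_left_mono) auto
  then have small: "t * ?m powr (- real i) \<le> e'" using i by simp
  have "int_iter f (- int i) (h (a + t)) = h (int_iter f (- int i) (a + t))"
    by (rule int_iter_commute[of f f "{a<..<b}"]) (use u h up_iter_mem[OF assms(1)] assms in auto)
  also have "int_iter f (- int i) (a + t) = a + t * ?m powr (- real i)"
    using assms by (intro back_iter) auto
  also have "h \<dots> = a + right_slope h a * (t * ?m powr (- real i))"
    using affine_startD[OF e' _ small] assms h(2) by simp
  also have "\<dots> = int_iter f (- int i) (a + right_slope h a * t)"
    using back_iter[OF assms(1,3), of "right_slope h a * t" i] assms slopes_pos(2)[OF h(1), of a] by (simp add: mult.assoc)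
  finally show ?thesis using PL_realD(10)[OF PL_real_int_iter[OF u(1)]] by metis
qed

lemma conj_between_int_iter:
  assumes "conj_between h f a b f a b" "f \<in> PL_real" "f a = a" "f b = b"
  shows "conj_between (int_iter h n) f a b f a b"
proof -
  note h = conj_betweenD[OF assms(1)]
  have hn: "int_iter h n \<in> PL_real" "int_iter h n a = a" "int_iter h n b = b"
    using PL_real_int_iter h int_iter_fix[OF PL_realD(3)[OF h(1)]] by auto
  have "int_iter h n (f y) = f (int_iter h n y)" if y: "a \<le> y" "y \<le> b" for y
    by (rule int_iter_commute[of h h "{a..b}"])
      (use y h(4) PL_realD(3)[OF h(1)] iter_mem[OF h(1-3), of n y] iter_mem[OF h(1-3), of _ y] in auto)
  then show ?thesis using hn by (simp add: conj_between_def)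
qed

text \<open>The initial slopes of the centralizer form a multiplicative group, which is discrete because
  the centralizer preserves the locally finite set where \<open>phi\<close> differs from 1.\<close>

lemma root_exists_up:
  assumes uf: "up_bump f a b"
  obtains h n where "h \<in> PL_plus a b" "centralizer a b (restr f a b) = range (int_iter h)"
    "n > 0" "h ^^ n = restr f a b"
proof -
  note u = up_bumpD[OF uf]
  have bf: "bump f a b" by (rule up_bump_imp_bump[OF uf])
  let ?m = "right_slope f a"
  have m: "?m > 1" by (rule up_slopes[OF uf])
  let ?C = "{h \<in> PL_plus a b. conj_between h f a b f a b}"
  let ?S = "(\<lambda>h. right_slope h a) ` ?C"
  have C: "centralizer a b (restr f a b) = ?C" using centralizer_iff[OF bf] by blast
  have Citer: "int_iter h n \<in> ?C" if "h \<in> ?C" for h n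
    using that PL_plus_int_iter[OF u(2)] conj_between_int_iter u by blast
  have Ccomp: "h \<circ> k \<in> ?C" if "h \<in> ?C" "k \<in> ?C" for h k
    using that PL_plus_comp[OF u(2)] conj_between_comp by blast
  obtain e \<rho> where e: "affine_start f a e" "a + e < b" "0 < \<rho>" "\<rho> \<le> e" "phi f (a + \<rho>) \<noteq> 1"
    using psi_up_char[OF uf] by metis
  \<comment> \<open>One period back from a + \<rho>, so that t times any slope between 1 and the
    slope of f stays within e.\<close>
  define t where "t = \<rho> / ?m"
  have t: "0 < t" "?m * t = \<rho>" "t \<le> e" using m e by (auto simp: t_def field_simps) (smt (verit) mult_le_cancel_left1)
  have "f (a + t) = a + \<rho>" using affine_startD[OF e(1), of t] t u by simp
  then have phit: "phi f (a + t) \<noteq> 1" using phi_step[OF u(6), of "a + t"] e by simp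
  have "finite (?S \<inter> {1..<?m})"
  proof -
    have "(\<lambda>\<alpha>. a + \<alpha> * t) ` (?S \<inter> {1..<?m}) \<subseteq> {y \<in> {a + t..a + e}. phi f y \<noteq> 1}"
    proof (rule image_subsetI)
      fix \<alpha> assume "\<alpha> \<in> ?S \<inter> {1..<?m}"
      then obtain h where h: "conj_between h f a b f a b" "right_slope h a = \<alpha>" "1 \<le> \<alpha>" "\<alpha> < ?m" by auto
      have "\<alpha> * t \<le> ?m * t" "1 * t \<le> \<alpha> * t" using h t by (auto intro!: mult_right_mono)
      then have at: "\<alpha> * t \<le> e" "t \<le> \<alpha> * t" using t e by auto
      have "h (a + t) = a + \<alpha> * t" using conj_self_affine[OF uf h(1) e(1,2) t(1,3)] at h by simp
      then have "phi f (a + \<alpha> * t) \<noteq> 1" using phi_conj[OF uf h(1) u(1), of "a + t"] phit t e by simp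
      then show "a + \<alpha> * t \<in> {y \<in> {a + t..a + e}. phi f y \<noteq> 1}" using at e by simp
    qed
    then have "finite ((\<lambda>\<alpha>. a + \<alpha> * t) ` (?S \<inter> {1..<?m}))"
      using finite_phi_near[OF uf e(1,2), of "a + t"] t by (meson finite_subset less_add_same_cancel1)
    moreover have "inj_on (\<lambda>\<alpha>. a + \<alpha> * t) (?S \<inter> {1..<?m})" using t by (auto simp: inj_on_def)
    ultimately show ?thesis by (rule finite_imageD)
  qed
  moreover have "?S \<inter> {1<..?m} \<subseteq> insert ?m (?S \<inter> {1..<?m})" by auto
  ultimately have fin: "finite (?S \<inter> {1<..?m})" by (meson finite.insertI finite_subset)
  have rf: "restr f a b \<in> ?C" "right_slope (restr f a b) a = ?m"
    using conj_between_restr[of f f a b f] u by (auto simp: conj_between_def)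
  then have "?m \<in> ?S" by (intro image_eqI[of _ _ "restr f a b"]) simp_all
  then have "?m \<in> ?S \<inter> {1<..?m}" using m by simp
  then have ne: "?S \<inter> {1<..?m} \<noteq> {}" by blast
  \<comment> \<open>The least slope above 1 belongs to a generator. The bound by the slope of f
    makes the set finite, and f itself makes it nonempty.\<close>
  define \<sigma> where "\<sigma> = Min (?S \<inter> {1<..?m})"
  have "\<sigma> \<in> ?S \<inter> {1<..?m}" unfolding \<sigma>_def by (rule Min_in[OF fin ne])
  then obtain h0 where h0: "h0 \<in> ?C" "right_slope h0 a = \<sigma>" "1 < \<sigma>" "\<sigma> \<le> ?m" by auto
  have h0P: "h0 \<in> PL_real" "h0 a = a" using h0(1) PL_plusD[OF u(2)] by auto
  have all: "\<exists>j. h = int_iter h0 j" if h: "h \<in> ?C" for h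
  proof -
    have hP: "h \<in> PL_real" "h a = a" using h PL_plusD[OF u(2)] by auto
    let ?\<alpha> = "right_slope h a"
    have \<alpha>: "?\<alpha> > 0" using slopes_pos hP by blast
    \<comment> \<open>Division with remainder in the multiplicative group of slopes: the remainder
      \<beta> lies in [1, \<sigma>) and is 1 by minimality.\<close>
    define j where "j = \<lfloor>log \<sigma> ?\<alpha>\<rfloor>"
    define \<beta> where "\<beta> = ?\<alpha> * \<sigma> powi (- j)"
    let ?h = "h \<circ> int_iter h0 (- j)"
    have hC: "?h \<in> ?C" using Ccomp[OF h Citer[OF h0(1)]] .
    have hs: "right_slope ?h a = \<beta>"
      using PL_real_comp(3)[OF PL_real_int_iter[OF h0P(1)] hP(1)] int_iter_fix[OF PL_realD(3)[OF h0P(1)] h0P(2)]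
        slopes_int_iter(1)[OF h0P] h0(2) by (simp add: \<beta>_def)
    have b1: "\<beta> = \<sigma> powr (log \<sigma> ?\<alpha> - of_int j)"
    proof -
      have "\<sigma> powi (- j) = \<sigma> powr (of_int (- j))" using h0(3) by (subst powr_real_of_int') auto
      moreover have "?\<alpha> = \<sigma> powr (log \<sigma> ?\<alpha>)" using h0(3) \<alpha> by simp
      ultimately show ?thesis unfolding \<beta>_def by (metis powr_add of_int_minus add_uminus_conv_diff)
    qed
    have j: "0 \<le> log \<sigma> ?\<alpha> - of_int j" "log \<sigma> ?\<alpha> - of_int j < 1" unfolding j_def by linarith+
    have "\<sigma> powr 0 \<le> \<beta>" unfolding b1 by (rule powr_mono) (use j h0(3) in auto)
    moreover have "\<beta> < \<sigma> powr 1" unfolding b1 by (rule powr_less_mono) (use j h0(3) in auto)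
    ultimately have b2: "1 \<le> \<beta>" "\<beta> < \<sigma>" using h0(3) by auto
    have "\<beta> = 1"
    proof (rule ccontr)
      assume "\<beta> \<noteq> 1"
      then have "\<beta> \<in> ?S \<inter> {1<..?m}" using b2 h0(4) hC hs by force
      then have "\<sigma> \<le> \<beta>" unfolding \<sigma>_def using fin by simp
      with b2 show False by simp
    qed
    then have "?h = id"
      using hC hs PL_plus_iff[OF u(2), of id] PL_real_id(1) conj_self_id[OF uf, of ?h]
      by (intro PL_plus_eqI[OF u(2)]) auto
    then have "h (int_iter h0 (- j) (int_iter h0 j y)) = int_iter h0 j y" for y by (metis comp_apply id_apply)
    then have "h = int_iter h0 j"
      using int_iter_add[OF PL_realD(3)[OF h0P(1)], of "- j" j] by (simp add: fun_eq_iff)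
    then show ?thesis ..
  qed
  have "centralizer a b (restr f a b) = range (int_iter h0)"
    unfolding C using all Citer[OF h0(1)] by blast
  moreover obtain j where j: "restr f a b = int_iter h0 j" using all[OF rf(1)] by blast
  have "\<sigma> powi j = ?m" using slopes_int_iter(1)[OF h0P, of j] rf(2) j h0(2) by simp
  then have "\<sigma> powr (of_int j) > \<sigma> powr 0" using h0(3) m by (subst powr_real_of_int') auto
  then have "j > 0" using h0(3) by (simp only: powr_less_cancel_iff of_int_0_less_iff)
  then have "h0 ^^ nat j = restr f a b" "nat j > 0" using j by (auto simp: int_iter_def)
  ultimately show ?thesis using h0(1) that by blast
qed

text \<open>A decreasing bump has the same centralizer as its inverse; inverting the generator makes
  a positive power equal to f again.\<close>

lemma root_gen_spec:
  assumes "bump f a b"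
  shows "root_gen f a b \<in> PL_plus a b" "centralizer a b (restr f a b) = range (int_iter (root_gen f a b))"
    "\<exists>n>0. root_gen f a b ^^ n = restr f a b"
proof -
  note u = bumpD[OF assms]
  have "\<exists>h. h \<in> PL_plus a b \<and> centralizer a b (restr f a b) = range (int_iter h)
     \<and> (\<exists>n::nat. n > 0 \<and> h ^^ n = restr f a b)"
    using bump_cases[OF assms]
  proof
    assume "up_bump f a b"
    then show ?thesis using root_exists_up by metis
  next
    assume uf: "up_bump (inv f) a b"
    note ui = up_bumpD[OF uf]
    obtain h n where h: "h \<in> PL_plus a b" "centralizer a b (restr (inv f) a b) = range (int_iter h)"
      "n > 0" "h ^^ n = restr (inv f) a b" using root_exists_up[OF uf] .
    have hP: "h \<in> PL_real" using PL_plusD[OF u(2) h(1)] by simp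
    have "conj_between k (inv f) a b (inv f) a b \<longleftrightarrow> conj_between k f a b f a b" for k
      using conj_between_inverses[of k f a b f a b] conj_between_inverses[of k "inv f" a b "inv f" a b]
        inv_inv_PL_real[OF u(1)] u ui by auto
    then have "centralizer a b (restr f a b) = centralizer a b (restr (inv f) a b)"
      using centralizer_iff[OF assms] centralizer_iff[OF up_bump_imp_bump[OF uf]] by blast
    also have "\<dots> = range (int_iter (inv h))"
    proof -
      have "int_iter (inv h) k = int_iter h (- k)" "int_iter h k = int_iter (inv h) (- k)" for k
        using int_iter_minus[OF PL_realD(3)[OF hP]] by auto
      then show ?thesis unfolding h(2) by blast
    qed
    finally have c: "centralizer a b (restr f a b) = range (int_iter (inv h))" .
    have rf: "restr f a b \<in> PL_real" using restr_PL_plus[OF u(1-4)] PL_plusD[OF u(2)] by blast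
    have "restr (inv f) a b (restr f a b y) = y" for y
      using bump_mem[OF u(1,3,4), of y] PL_realD(7)[OF u(1)] by (auto simp: restr_def)
    then have inv_r: "restr (inv f) a b = inv (restr f a b)"
      using PL_realD(6)[OF rf] by (metis ext)
    have "inv h ^^ n = inv (h ^^ n)" using PL_realD(3)[OF hP] by (simp add: inv_fn)
    also have "\<dots> = restr f a b" unfolding h(4) inv_r by (rule inv_inv_PL_real[OF rf])
    finally show ?thesis using c h(3) PL_plus_inv[OF u(2) h(1)] by blast
  qed
  from someI_ex[OF this] show "root_gen f a b \<in> PL_plus a b"
    "centralizer a b (restr f a b) = range (int_iter (root_gen f a b))"
    "\<exists>n>0. root_gen f a b ^^ n = restr f a b"
    unfolding root_gen_def[symmetric] by blast+
qed

section \<open>End slopes of conjugators between bumps\<close>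

lemma chain_slopes:
  assumes "bump f a b"
  shows "lam f (a, b) = right_slope (root_gen f a b) a" "mu f (a, b) = left_slope (root_gen f a b) b"
    "alpha f (a, b) = right_slope (conj_to_min f a b) a" "beta f (a, b) = left_slope (conj_to_min f a b) b"
    "lam f (a, b) > 0" "mu f (a, b) > 0" "alpha f (a, b) > 0" "beta f (a, b) > 0"
proof -
  note u = bumpD[OF assms]
  have r: "root_gen f a b \<in> PL_real" "conj_to_min f a b \<in> PL_real"
    using root_gen_spec(1)[OF assms] conj_to_min_spec(1)[OF assms] PL_plusD(1)[OF u(2)] by auto
  show eq: "lam f (a, b) = right_slope (root_gen f a b) a" "mu f (a, b) = left_slope (root_gen f a b) b"
    "alpha f (a, b) = right_slope (conj_to_min f a b) a" "beta f (a, b) = left_slope (conj_to_min f a b) b"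
    using r u(2) by (auto simp: lam_def mu_def alpha_def beta_def initial_slope_PL_real final_slope_PL_real)
  show "lam f (a, b) > 0" "mu f (a, b) > 0" "alpha f (a, b) > 0" "beta f (a, b) > 0"
    unfolding eq using slopes_pos r by auto
qed

lemma bump_slope_neq_1:
  assumes "bump f a b" shows "right_slope f a \<noteq> 1" "left_slope f b \<noteq> 1"
proof -
  note u = bumpD[OF assms]
  show "right_slope f a \<noteq> 1" "left_slope f b \<noteq> 1"
    using bump_cases[OF assms] up_slopes[of f a b] up_slopes[of "inv f" a b]
      right_slope_inv_fix[of f a] right_slope_inv_fix[of f b] u by auto
qed

text \<open>The element is m conjugated by k and cut off outside (c, d); conjugation keeps the
  slopes at the fixed end points.\<close>

lemma conj_transport:
  assumes "bump f a b" "bump g c d" "conj_between k f a b g c d" "m \<in> centralizer a b (restr f a b)"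
  obtains m' where "m' \<in> centralizer c d (restr g c d)" "right_slope m' c = right_slope m a"
    "left_slope m' d = left_slope m b"
proof -
  note u = bumpD[OF assms(1)] and v = bumpD[OF assms(2)]
  have m: "m \<in> PL_plus a b" "conj_between m f a b f a b"
    using assms(4) centralizer_iff[OF assms(1)] by auto
  note mD = PL_plusD[OF u(2) m(1)]
  let ?M = "k \<circ> m \<circ> inv k"
  have "conj_between ?M g c d g c d"
    using conj_between_comp[OF conj_between_inv[OF assms(3)] conj_between_comp[OF m(2) assms(3)]]
    by (simp add: comp_assoc)
  note M = conj_between_restr[OF this v(1,3,4,2)]
  have k: "k \<in> PL_real" using conj_betweenD(1)[OF assms(3)] .
  have "conj_between k m a b ?M c d"
    using conj_betweenD(1-3)[OF assms(3)] PL_realD(7)[OF k] by (auto simp: conj_between_def)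
  moreover have "?M \<in> PL_real" using k mD(1) PL_real_inv(1)[OF k] by (intro PL_real_comp(1))
  ultimately have "right_slope ?M c = right_slope m a" "left_slope ?M d = left_slope m b"
    using conj_slopes[of k m a b ?M c d] mD u by auto
  then show ?thesis using M centralizer_iff[OF assms(2)] by (intro that[of "restr ?M c d"]) auto
qed

lemma powi_eq_iff:
  fixes s :: real
  assumes "s > 0" "s \<noteq> 1" shows "s powi i = s powi j \<longleftrightarrow> i = j"
proof -
  have "s powi i = s powr of_int i" for i using assms by (subst powr_real_of_int') auto
  then show ?thesis using powr_inj[OF assms] by simp
qed

text \<open>The initial slopes of the two roots are powers of each other, with exponents i and j
  such that i j = 1. Positive powers of the roots give f and g, whose initial slopes agree, so i > 0
  and hence i = 1. The same i relates the final slopes.\<close>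

lemma lam_mu_conj:
  assumes "bump f a b" "bump g c d" "conj_between k f a b g c d"
  shows "lam g (c, d) = lam f (a, b)" "mu g (c, d) = mu f (a, b)"
proof -
  note u = bumpD[OF assms(1)] and v = bumpD[OF assms(2)]
  let ?R = "root_gen f a b" and ?Q = "root_gen g c d"
  note R = root_gen_spec[OF assms(1)] and Q = root_gen_spec[OF assms(2)]
  note RD = PL_plusD[OF u(2) R(1)] and QD = PL_plusD[OF v(2) Q(1)]
  have mem: "?R \<in> centralizer a b (restr f a b)" "?Q \<in> centralizer c d (restr g c d)"
    unfolding R(2) Q(2) by (rule range_eqI[of _ _ 1]; simp)+
  obtain i where i: "right_slope ?R a = right_slope ?Q c powi i" "left_slope ?R b = left_slope ?Q d powi i"
    using conj_transport[OF assms mem(1)] slopes_int_iter[OF QD(1,2)] slopes_int_iter[OF QD(1,3)]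
    unfolding Q(2) by (metis rangeE)
  obtain j where j: "right_slope ?Q c = right_slope ?R a powi j"
    using conj_transport[OF assms(2,1) conj_between_inv[OF assms(3)] mem(2)]
      slopes_int_iter[OF RD(1,2)] unfolding R(2) by (metis rangeE)
  obtain n where n: "n > 0" "?R ^^ n = restr f a b" using R(3) by blast
  obtain m where m: "m > 0" "?Q ^^ m = restr g c d" using Q(3) by blast
  let ?s = "right_slope ?Q c"
  have rs: "right_slope (restr f a b) a = right_slope f a"
    by (rule right_slope_cong[OF u(2) _ u(1)]) (use restr_eq[of f a b] u in auto)
  have rs': "right_slope (restr g c d) c = right_slope g c"
    by (rule right_slope_cong[OF v(2) _ v(1)]) (use restr_eq[of g c d] v in auto)
  have "right_slope ?R a powi int n = right_slope f a"
    using slopes_int_iter(1)[OF RD(1,2), of "int n"] n rs by simp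
  moreover have sm: "?s powi int m = right_slope g c"
    using slopes_int_iter(1)[OF QD(1,2), of "int m"] m rs' by simp
  moreover have "right_slope g c = right_slope f a"
    using conj_slopes(1)[OF assms(3) u(1) v(1) u(3,4,2)] .
  ultimately have "?s powi (i * int n) = ?s powi int m" unfolding i by (simp add: power_int_mult)
  moreover have s: "?s > 0" "?s \<noteq> 1"
    using slopes_pos[OF QD(1)] sm bump_slope_neq_1(1)[OF assms(2)] by auto
  ultimately have "i * int n = int m" using powi_eq_iff by blast
  then have "i > 0" using n m by (metis of_nat_0_less_iff zero_less_mult_pos2)
  have "?s powi (i * j) = ?s powi 1" using i(1) j by (simp add: power_int_mult)
  then have "i * j = 1" using powi_eq_iff[OF s] by blast
  then have "i = 1" using \<open>i > 0\<close> zmult_eq_1_iff by auto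
  then show "lam g (c, d) = lam f (a, b)" "mu g (c, d) = mu f (a, b)"
    using i chain_slopes(1,2)[OF assms(1)] chain_slopes(1,2)[OF assms(2)] by auto
qed

lemma conj_between_slopes_comp:
  assumes "conj_between k f a b l c d" "k' \<in> PL_real"
  shows "right_slope (k' \<circ> k) a = right_slope k' c * right_slope k a"
    "left_slope (k' \<circ> k) b = left_slope k' d * left_slope k b"
  using PL_real_comp(2,3)[OF conj_betweenD(1)[OF assms(1)] assms(2)] conj_betweenD(2,3)[OF assms(1)] by auto

text \<open>Compose h with the map to the minimum cornered function of g, the affine map to that of
  f, and the way back to f. The result centralizes f, so it is a power of the root, and the formulas
  are the chain rule for its end slopes.\<close>

lemma conj_slopes_param:
  assumes "bump f a b" "bump g c d" "conj_between h f a b g c d"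
  obtains n where
    "right_slope h a = alpha f (a, b) / (b - a) * ((d - c) / alpha g (c, d)) * lam f (a, b) powi n"
    "left_slope h b = beta f (a, b) / (b - a) * ((d - c) / beta g (c, d)) * mu f (a, b) powi n"
proof -
  note u = bumpD[OF assms(1)] and v = bumpD[OF assms(2)]
  let ?k = "conj_to_min f a b" and ?l = "conj_to_min g c d" and ?R = "root_gen f a b"
  let ?B = "rescale c d a b"
  note k = conj_to_min_spec[OF assms(1)] and l = conj_to_min_spec[OF assms(2)] and R = root_gen_spec[OF assms(1)]
  note kD = PL_plusD[OF u(2) k(1)] and lD = PL_plusD[OF v(2) l(1)] and RD = PL_plusD[OF u(2) R(1)]
  note B = min_cornered_conj[OF assms(2,1) conj_between_inv[OF assms(3)]]
  note B' = rescale_PL_real[OF v(2) u(2)]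
  have ik: "inv ?k \<in> PL_real" using PL_real_inv kD by blast
  note c1 = conj_between_comp[OF assms(3) l(2)]
  note c2 = conj_between_comp[OF c1 B]
  note c3 = conj_between_comp[OF c2 conj_between_inv[OF k(2)]]
  let ?z = "inv ?k \<circ> (?B \<circ> (?l \<circ> h))"
  note r = conj_between_restr[OF c3 u(1,3,4,2)]
  have "restr ?z a b \<in> range (int_iter ?R)" using r centralizer_iff[OF assms(1)] R(2) by blast
  then obtain n where n: "restr ?z a b = int_iter ?R n" by blast
  have pos: "alpha f (a, b) > 0" "alpha g (c, d) > 0" "beta f (a, b) > 0" "beta g (c, d) > 0"
    using chain_slopes[OF assms(1)] chain_slopes[OF assms(2)] by auto
  have "right_slope ?z a = 1 / right_slope ?k a * ((b - a) / (d - c) * (right_slope ?l c * right_slope h a))"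
    using conj_between_slopes_comp(1)[OF c2 ik] conj_between_slopes_comp(1)[OF c1 B'(1)]
      conj_between_slopes_comp(1)[OF assms(3) lD(1)] B' right_slope_inv_fix(1)[OF kD(1,2)] by simp
  then have 1: "lam f (a, b) powi n = 1 / alpha f (a, b) * ((b - a) / (d - c) * (alpha g (c, d) * right_slope h a))"
    using r(3) n slopes_int_iter(1)[OF RD(1,2), of n] chain_slopes[OF assms(1)] chain_slopes[OF assms(2)] by simp
  have "left_slope ?z b = 1 / left_slope ?k b * ((b - a) / (d - c) * (left_slope ?l d * left_slope h b))"
    using conj_between_slopes_comp(2)[OF c2 ik] conj_between_slopes_comp(2)[OF c1 B'(1)]
      conj_between_slopes_comp(2)[OF assms(3) lD(1)] B' right_slope_inv_fix(2)[OF kD(1,3)] by simp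
  then have 2: "mu f (a, b) powi n = 1 / beta f (a, b) * ((b - a) / (d - c) * (beta g (c, d) * left_slope h b))"
    using r(4) n slopes_int_iter(2)[OF RD(1,3), of n] chain_slopes[OF assms(1)] chain_slopes[OF assms(2)] by simp
  have "x = A / w * (w' / B) * (1 / A * (w / w' * (B * x)))"
    if "A > 0" "B > 0" "w > 0" "w' > 0" for A B w w' x :: real
    using that by simp
  from this[of _ _ "b - a" "d - c"] show ?thesis
    by (intro that[of n]) (use pos u(2) v(2) 1 2 in auto)
qed

text \<open>Applying the n-th power of the root of f before the standard conjugator realises every
  exponent n, the same one at both ends.\<close>

lemma conj_slopes_param_exists:
  assumes "bump f a b" "bump g c d" "conj_between h f a b g c d"
  obtains k where "conj_between k f a b g c d"
    "right_slope k a = alpha f (a, b) / (b - a) * ((d - c) / alpha g (c, d)) * lam f (a, b) powi n"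
    "left_slope k b = beta f (a, b) / (b - a) * ((d - c) / beta g (c, d)) * mu f (a, b) powi n"
proof -
  note u = bumpD[OF assms(1)] and v = bumpD[OF assms(2)]
  let ?k = "conj_to_min f a b" and ?l = "conj_to_min g c d" and ?R = "root_gen f a b"
  let ?A = "rescale a b c d"
  note k = conj_to_min_spec[OF assms(1)] and l = conj_to_min_spec[OF assms(2)] and R = root_gen_spec[OF assms(1)]
  note kD = PL_plusD[OF u(2) k(1)] and lD = PL_plusD[OF v(2) l(1)] and RD = PL_plusD[OF u(2) R(1)]
  note A = min_cornered_conj[OF assms]
  note A' = rescale_PL_real[OF u(2) v(2)]
  have il: "inv ?l \<in> PL_real" using PL_real_inv lD by blast
  have "int_iter ?R n \<in> centralizer a b (restr f a b)" unfolding R(2) by blast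
  then have c0: "conj_between (int_iter ?R n) f a b f a b" using centralizer_iff[OF assms(1)] by blast
  note c1 = conj_between_comp[OF c0 k(2)]
  note c2 = conj_between_comp[OF c1 A]
  note c3 = conj_between_comp[OF c2 conj_between_inv[OF l(2)]]
  let ?z = "inv ?l \<circ> (?A \<circ> (?k \<circ> int_iter ?R n))"
  have "right_slope ?z a = 1 / alpha g (c, d) * ((d - c) / (b - a) * (alpha f (a, b) * lam f (a, b) powi n))"
    using conj_between_slopes_comp(1)[OF c2 il] conj_between_slopes_comp(1)[OF c1 A'(1)]
      conj_between_slopes_comp(1)[OF c0 kD(1)] A' right_slope_inv_fix(1)[OF lD(1,2)]
      slopes_int_iter(1)[OF RD(1,2), of n] chain_slopes[OF assms(1)] chain_slopes[OF assms(2)] by simp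
  moreover have "left_slope ?z b = 1 / beta g (c, d) * ((d - c) / (b - a) * (beta f (a, b) * mu f (a, b) powi n))"
    using conj_between_slopes_comp(2)[OF c2 il] conj_between_slopes_comp(2)[OF c1 A'(1)]
      conj_between_slopes_comp(2)[OF c0 kD(1)] A' right_slope_inv_fix(2)[OF lD(1,3)]
      slopes_int_iter(2)[OF RD(1,3), of n] chain_slopes[OF assms(1)] chain_slopes[OF assms(2)] by simp
  ultimately show ?thesis using c3 by (intro that[of ?z]) (auto simp: mult_ac)
qed

section \<open>Dyadic germs\<close>

lemma dyadic_of_int [simp]: "dyadic (of_int m)"
  unfolding dyadic_def by (rule exI[of _ m], rule exI[of _ 0]) simp

lemma dyadic_0 [simp]: "dyadic 0" and dyadic_1 [simp]: "dyadic 1"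
  using dyadic_of_int[of 0] dyadic_of_int[of 1] by simp_all

lemma dyadic_add:
  assumes "dyadic x" "dyadic y" shows "dyadic (x + y)"
proof -
  obtain m p :: int and n q :: nat where xy: "x = of_int m / 2 ^ n" "y = of_int p / 2 ^ q"
    using assms unfolding dyadic_def by blast
  have "x + y = of_int (m * 2 ^ q + p * 2 ^ n) / 2 ^ (n + q)"
    unfolding xy by (simp add: field_simps power_add)
  then show ?thesis unfolding dyadic_def by blast
qed

lemma dyadic_minus: assumes "dyadic x" shows "dyadic (- x)"
proof -
  obtain m :: int and n :: nat where "x = of_int m / 2 ^ n"
    using assms unfolding dyadic_def by blast
  then have "- x = of_int (- m) / 2 ^ n" by simp
  then show ?thesis unfolding dyadic_def by blast
qed

lemma dyadic_diff: "dyadic x \<Longrightarrow> dyadic y \<Longrightarrow> dyadic (x - y)"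
  using dyadic_add[of x "- y"] dyadic_minus[of y] by simp

lemma dyadic_add_cancel: "dyadic y \<Longrightarrow> dyadic (x + y) \<longleftrightarrow> dyadic x" "dyadic y \<Longrightarrow> dyadic (y + x) \<longleftrightarrow> dyadic x"
  "dyadic y \<Longrightarrow> dyadic (x - y) \<longleftrightarrow> dyadic x" "dyadic y \<Longrightarrow> dyadic (y - x) \<longleftrightarrow> dyadic x"
proof -
  assume y: "dyadic y"
  show 1: "dyadic (x + y) \<longleftrightarrow> dyadic x" using dyadic_add[of x y] dyadic_diff[of "x + y" y] y by auto
  show "dyadic (y + x) \<longleftrightarrow> dyadic x" using 1 by (simp only: add.commute)
  show "dyadic (x - y) \<longleftrightarrow> dyadic x" using dyadic_diff[of x y] dyadic_add[of "x - y" y] y by auto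
  show "dyadic (y - x) \<longleftrightarrow> dyadic x" using dyadic_diff[of y x] dyadic_diff[of y "y - x"] y by auto
qed

definition pow2 :: "real \<Rightarrow> bool" where "pow2 m \<longleftrightarrow> (\<exists>k::int. m = 2 powi k)"

lemma pow2_1 [simp]: "pow2 1"
  unfolding pow2_def by (rule exI[of _ 0]) simp

lemma pow2_mult: "pow2 m \<Longrightarrow> pow2 n \<Longrightarrow> pow2 (m * n)"
  unfolding pow2_def by (metis power_int_add zero_neq_numeral)

lemma pow2_inverse: "pow2 m \<Longrightarrow> pow2 (1 / m)"
  unfolding pow2_def by (metis power_int_minus inverse_eq_divide)

lemma dyadic_pow2_mult: 
  assumes "pow2 m" shows "dyadic (m * x) \<longleftrightarrow> dyadic x"
proof -
  have 1: "dyadic (2 * x)" if "dyadic x" for x using dyadic_add[OF that that] by simp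
  have 2: "dyadic (x / 2)" if x: "dyadic x" for x
  proof -
    obtain m :: int and n :: nat where "x = of_int m / 2 ^ n"
      using x unfolding dyadic_def by blast
    then have "x / 2 = of_int m / 2 ^ Suc n" by simp
    then show ?thesis unfolding dyadic_def by blast
  qed
  have 3: "dyadic (2 powi k * x)" if "dyadic x" for k x
  proof (induction k rule: int_induct[of _ 0])
    case (step1 i)
    then show ?case using 1[of "2 powi i * x"] by (simp add: power_int_add_1 mult_ac)
  next
    case (step2 i)
    then show ?case using 2[of "2 powi i * x"] by (simp add: power_int_diff)
  qed (use that in simp)
  obtain k where m: "m = 2 powi k" using assms by (auto simp: pow2_def)
  have eq: "2 powi (- k) * (m * x) = x" unfolding m by (simp add: power_int_minus)
  show ?thesis
  proof
    assume "dyadic (m * x)"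
    from 3[OF this, where k = "- k"] show "dyadic x" unfolding eq .
  next
    assume "dyadic x"
    from 3[OF this, where k = k] show "dyadic (m * x)" unfolding m .
  qed
qed

lemma dyadic_dense:
  assumes "u < v" obtains x where "dyadic x" "u < x" "x < v"
proof -
  obtain n where n: "1 / 2 ^ n < v - u"
    using real_arch_pow_inv[of "v - u" "1/2"] assms by (auto simp: power_one_over)
  define x where "x = of_int (\<lfloor>u * 2 ^ n\<rfloor> + 1) / (2 ^ n :: real)"
  have "of_int \<lfloor>u * 2 ^ n\<rfloor> \<le> u * 2 ^ n" "u * 2 ^ n < of_int \<lfloor>u * 2 ^ n\<rfloor> + 1" by linarith+
  then have "u < x" "x \<le> u + 1 / 2 ^ n" by (auto simp: x_def field_simps)
  moreover have "dyadic x" unfolding dyadic_def x_def by blast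
  ultimately show ?thesis using n by (intro that[of x]) auto
qed

section \<open>Germs of elements of F\<close>

definition dyadic_slopes :: "(real \<Rightarrow> real) \<Rightarrow> real \<Rightarrow> bool" where
  "dyadic_slopes K x \<longleftrightarrow> pow2 (left_slope K x) \<and> pow2 (right_slope K x)
     \<and> (\<not> dyadic x \<longrightarrow> left_slope K x = right_slope K x)"

text \<open>The clause on the value at x makes the condition stable under composition and inversion,
  since a node of the second factor is tested at the image point. On (0, 1) it characterises F, see
  \<open>thompson_F_iff\<close>.\<close>

definition dyadic_germ :: "(real \<Rightarrow> real) \<Rightarrow> real \<Rightarrow> bool" where
  "dyadic_germ K x \<longleftrightarrow> dyadic_slopes K x \<and> (dyadic (K x) \<longleftrightarrow> dyadic x)"

lemma dyadic_germ_comp: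
  assumes "f \<in> PL_real" "g \<in> PL_real" "dyadic_germ f x" "dyadic_germ g (f x)"
  shows "dyadic_germ (g \<circ> f) x"
  using assms by (auto simp: dyadic_germ_def dyadic_slopes_def PL_real_comp pow2_mult)

lemma dyadic_germ_inv:
  assumes "f \<in> PL_real" "dyadic_germ f x" shows "dyadic_germ (inv f) (f x)"
  using assms PL_real_inv(2,3)[OF assms(1), of x] PL_realD(7)[OF assms(1), of x]
  by (auto simp: dyadic_germ_def dyadic_slopes_def pow2_inverse)

lemma dyadic_germ_id: "dyadic_germ id x"
  unfolding dyadic_germ_def dyadic_slopes_def PL_real_id by simp

lemma dyadic_germ_int_iter:
  assumes "f \<in> PL_real" "\<And>x. dyadic_germ f x" shows "dyadic_germ (int_iter f n) x"
proof -
  have *: "dyadic_germ (f ^^ n) x" if "f \<in> PL_real" "\<And>x. dyadic_germ f x" for f n x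
  proof (induction n)
    case 0
    show ?case unfolding funpow.simps by (rule dyadic_germ_id)
  next
    case (Suc n)
    show ?case unfolding funpow.simps
      by (rule dyadic_germ_comp[OF PL_real_funpow[OF that(1)] that(1) Suc that(2)])
  qed
  have "dyadic_germ (inv f) x" for x
    using dyadic_germ_inv[OF assms(1) assms(2), of "inv f x"] PL_realD(6)[OF assms(1)] by simp
  then show ?thesis unfolding int_iter_def using * assms PL_real_inv(1) by auto
qed

lemma dyadic_slopes_cong:
  assumes "u < x" "x < v" "\<And>y. u < y \<Longrightarrow> y < v \<Longrightarrow> f y = g y" "g \<in> PL_real"
  shows "dyadic_slopes f x \<longleftrightarrow> dyadic_slopes g x" "dyadic_germ f x \<longleftrightarrow> dyadic_germ g x"
  using left_slope_cong[of u x f g] right_slope_cong[of x v f g] assms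
  by (auto simp: dyadic_slopes_def dyadic_germ_def)

text \<open>With powers of 2 as slopes, nearby dyadic points have values that differ by dyadic
  numbers, so dyadic values spread from x0 over the connected interval along the dense set of dyadic
  points. If K x is dyadic, comparison with a dyadic point close to x shows that x is
  dyadic.\<close>

lemma dyadic_slopes_imp_germ:
  assumes K: "K \<in> PL_real" and sl: "\<And>x. u < x \<Longrightarrow> x < v \<Longrightarrow> dyadic_slopes K x"
    and x0: "u < x0" "x0 < v" "dyadic x0" "dyadic (K x0)" and x: "u < x" "x < v"
  shows "dyadic_germ K x"
proof -
  have *: "dyadic (K y)" if y: "u < y" "y < v" "dyadic y" for y
  proof (rule connected_induction[of "{u<..<v}" dyadic "\<lambda>x. dyadic (K x)" x0 y])
    fix T a assume T: "openin (top_of_set {u<..<v}) T" "a \<in> T"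
    then have "open T" by (simp add: openin_open_eq)
    then obtain e where "e > 0" "ball a e \<subseteq> T" using T(2) open_contains_ball by blast
    moreover obtain z where "dyadic z" "a < z" "z < a + e" using dyadic_dense[of a "a + e"] \<open>e > 0\<close> by auto
    ultimately show "\<exists>z. z \<in> T \<and> dyadic z" by (intro exI[of _ z]) (auto simp: subset_iff dist_real_def)
  next
    fix a assume a: "a \<in> {u<..<v}"
    obtain e where "e > 0" and l: "\<And>y. a - e < y \<Longrightarrow> y \<le> a \<Longrightarrow> K y = K a + left_slope K a * (y - a)"
      and r: "\<And>y. a \<le> y \<Longrightarrow> y < a + e \<Longrightarrow> K y = K a + right_slope K a * (y - a)"
      using PL_real_local[OF K] by blast
    have sa: "dyadic_slopes K a" using sl a by simp
    have "dyadic (K z)" if z: "w \<in> {a - e<..<a + e}" "z \<in> {a - e<..<a + e}" "dyadic w" "dyadic z" "dyadic (K w)" for w z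
    \<comment> \<open>At a dyadic a, possibly a node, both points are compared with a itself; at a
      nondyadic a there is no node, and w and z are compared directly.\<close>
    proof (cases "dyadic a")
      case True
      have "dyadic (K y) \<longleftrightarrow> dyadic (K a)" if "y \<in> {a - e<..<a + e}" "dyadic y" for y
      proof -
        have "dyadic (left_slope K a * (y - a))" "dyadic (right_slope K a * (y - a))"
          using sa that True dyadic_pow2_mult dyadic_diff by (auto simp: dyadic_slopes_def)
        moreover have "K y = K a + left_slope K a * (y - a) \<or> K y = K a + right_slope K a * (y - a)"
          using l[of y] r[of y] that by (metis greaterThanLessThan_iff linear)
        ultimately show ?thesis using dyadic_add_cancel(1) by metis
      qed
      then show ?thesis using z by blast
    next
      case False
      then have eq: "left_slope K a = right_slope K a" using sa by (simp add: dyadic_slopes_def)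
      have K: "K y = K a + right_slope K a * (y - a)" if "y \<in> {a - e<..<a + e}" for y
        using l[of y] r[of y] that unfolding eq by (metis greaterThanLessThan_iff linear)
      have "K z = K w + right_slope K a * (z - w)" using K[OF z(1)] K[OF z(2)] by (simp add: algebra_simps)
      moreover have "dyadic (right_slope K a * (z - w))"
        using sa z dyadic_pow2_mult dyadic_diff by (auto simp: dyadic_slopes_def)
      ultimately show ?thesis using z dyadic_add by simp
    qed
    moreover have "openin (top_of_set {u<..<v}) ({u<..<v} \<inter> {a - e<..<a + e})" by (intro openin_open_Int) simp
    moreover have "a \<in> {u<..<v} \<inter> {a - e<..<a + e}" using a \<open>e > 0\<close> by simp
    ultimately show "\<exists>T. openin (top_of_set {u<..<v}) T \<and> a \<in> T \<and>
        (\<forall>x\<in>T. \<forall>y\<in>T. dyadic x \<and> dyadic y \<and> dyadic (K x) \<longrightarrow> dyadic (K y))" by blast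
  qed (use y x0 in auto)
  have "dyadic x" if Kx: "dyadic (K x)"
  proof (rule ccontr)
    assume nd: "\<not> dyadic x"
    obtain e where "e > 0" and r: "\<And>y. x \<le> y \<Longrightarrow> y < x + e \<Longrightarrow> K y = K x + right_slope K x * (y - x)"
      using PL_real_local[OF K] by metis
    obtain y where y: "dyadic y" "x < y" "y < min v (x + e)"
      using dyadic_dense[of x "min v (x + e)"] x \<open>e > 0\<close> by auto
    then have "K y = K x + right_slope K x * (y - x)" "dyadic (K y)" using *[of y] r[of y] x by auto
    then have "dyadic (K x + right_slope K x * (y - x))" by metis
    then have "dyadic (right_slope K x * (y - x))" using Kx dyadic_add_cancel by blast
    then have "dyadic (y - x)" using sl[OF x] dyadic_pow2_mult by (auto simp: dyadic_slopes_def)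
    then show False using dyadic_add_cancel(4)[OF y(1), of x] nd by simp
  qed
  then show ?thesis using *[of x] sl[OF x] x by (auto simp: dyadic_germ_def)
qed

text \<open>All real points are covered, so that the condition passes to iterates without side
  conditions: outside [0, 1] the map is the identity, and 0 and 1, where the extension may jump, are
  dyadic.\<close>

lemma thompson_F_imp_dyadic_germ:
  assumes "f \<in> thompson_F" shows "dyadic_germ f x"
proof -
  have f: "f \<in> PL_plus 0 1" "\<And>x. x \<in> nodes 0 1 f \<Longrightarrow> dyadic x"
    "\<And>x. x \<in> {0<..<1} - nodes 0 1 f \<Longrightarrow> \<exists>k::int. (f has_real_derivative 2 powi k) (at x)"
    using assms by (auto simp: thompson_F_def)
  have P: "f \<in> PL_real" and off: "\<And>x. x \<notin> {0<..<1} \<Longrightarrow> f x = x" using PL_plus_iff[of 0 1 f] f(1) by auto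
  have 1: "pow2 (right_slope f y)" if y: "y \<notin> {0, 1}" "jump_ratio f y = 1" for y
  proof (cases "y \<in> {0<..<1}")
    case True
    then obtain k :: int where "(f has_real_derivative 2 powi k) (at y)"
      using f(3)[of y] y by (auto simp: nodes_PL_real[OF P])
    then have "right_slope f y = 2 powi k" using DERIV_unique deriv_PL_real[OF P y(2)] by blast
    then show ?thesis by (auto simp: pow2_def)
  next
    case False
    then have "y < 0 \<or> 1 < y" using y by auto
    then obtain v where "y < v" "\<And>z. y \<le> z \<Longrightarrow> z < v \<Longrightarrow> f z = id z"
    proof
      assume "y < 0" then show ?thesis using off by (intro that[of 0]) auto
    next
      assume "1 < y" then show ?thesis using off by (intro that[of "y + 1"]) auto
    qed
    then have "right_slope f y = right_slope id y" by (intro right_slope_cong) (auto simp: PL_real_id)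
    then show ?thesis by (simp only: PL_real_id pow2_1)
  qed
  have sl: "dyadic_slopes f y" for y
  proof -
    \<comment> \<open>The slopes at y are read off from points close to y on either side that have
      no jump and differ from 0 and 1.\<close>
    obtain e where e: "e > 0"
      "\<And>z. y - e < z \<Longrightarrow> z < y \<Longrightarrow> left_slope f z = left_slope f y \<and> right_slope f z = left_slope f y"
      "\<And>z. y < z \<Longrightarrow> z < y + e \<Longrightarrow> left_slope f z = right_slope f y \<and> right_slope f z = right_slope f y"
      using slopes_near[OF P] by blast
    have "infinite ({y - e<..<y} - {0, 1})" "infinite ({y<..<y + e} - {0, 1})" using e(1) by auto
    then obtain z w where "z \<in> {y - e<..<y} - {0, 1}" "w \<in> {y<..<y + e} - {0, 1}"
      by (metis all_not_in_conv finite.emptyI)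
    then have "pow2 (left_slope f y)" "pow2 (right_slope f y)"
      using 1[of z] 1[of w] e(2)[of z] e(3)[of w] jump_ratio_eq_1[OF P] by auto
    moreover have "left_slope f y = right_slope f y" if "\<not> dyadic y"
    proof (cases "y \<in> {0<..<1}")
      case True
      then show ?thesis using f(2)[of y] that jump_ratio_eq_1[OF P] by (auto simp: nodes_PL_real[OF P])
    next
      case False
      have "y \<noteq> 0" "y \<noteq> 1" using that by auto
      then have "y < 0 \<or> 1 < y" using False by auto
      then obtain u v where "u < y" "y < v" "\<And>z. u < z \<Longrightarrow> z < v \<Longrightarrow> f z = id z"
      proof
        assume "y < 0" then show ?thesis using off by (intro that[of "y - 1" 0]) auto
      next
        assume "1 < y" then show ?thesis using off by (intro that[of 1 "y + 1"]) auto
      qed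
      then have "right_slope f y = right_slope id y" "left_slope f y = left_slope id y"
        by (auto intro!: right_slope_cong left_slope_cong simp: PL_real_id(1))
      then show ?thesis by (simp only: PL_real_id)
    qed
    ultimately show ?thesis by (auto simp: dyadic_slopes_def)
  qed
  show ?thesis
  proof (rule dyadic_slopes_imp_germ[OF P sl])
    \<comment> \<open>The interval contains x and the base point -1, a dyadic point that f
      fixes.\<close>
    show "min x (-1) - 1 < -1" "-1 < max x 1 + 1" "min x (-1) - 1 < x" "x < max x 1 + 1" by auto
    show "dyadic (-1)" "dyadic (f (-1))" using off[of "-1"] dyadic_minus[of 1] by auto
  qed
qed

lemma thompson_F_iff: "f \<in> thompson_F \<longleftrightarrow> f \<in> PL_plus 0 1 \<and> (\<forall>x. 0 < x \<and> x < 1 \<longrightarrow> dyadic_germ f x)"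
proof
  assume "f \<in> thompson_F"
  then show "f \<in> PL_plus 0 1 \<and> (\<forall>x. 0 < x \<and> x < 1 \<longrightarrow> dyadic_germ f x)"
    using thompson_F_imp_dyadic_germ by (auto simp: thompson_F_def)
next
  assume f: "f \<in> PL_plus 0 1 \<and> (\<forall>x. 0 < x \<and> x < 1 \<longrightarrow> dyadic_germ f x)"
  then have P: "f \<in> PL_real" using PL_plus_iff[of 0 1 f] by auto
  have "dyadic x" if "x \<in> nodes 0 1 f" for x
    using that f jump_ratio_eq_1[OF P] by (auto simp: nodes_PL_real[OF P] dyadic_germ_def dyadic_slopes_def)
  moreover have "\<exists>k::int. (f has_real_derivative 2 powi k) (at x)" if "x \<in> {0<..<1} - nodes 0 1 f" for x
  proof -
    have "jump_ratio f x = 1" "pow2 (right_slope f x)"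
      using that f by (auto simp: nodes_PL_real[OF P] dyadic_germ_def dyadic_slopes_def)
    then show ?thesis using deriv_PL_real[OF P] unfolding pow2_def by metis
  qed
  ultimately show "f \<in> thompson_F" using f by (auto simp: thompson_F_def)
qed

section \<open>Propagation along a bump and dyadic interpolation\<close>

lemma dyadic_germ_propagate_up:
  assumes "up_bump f a b" "conj_between h f a b g c d" "g \<in> PL_real"
    and "\<And>x. dyadic_germ f x" "\<And>x. dyadic_germ g x"
    and "e > 0" "\<And>x. a < x \<Longrightarrow> x < a + e \<Longrightarrow> dyadic_germ h x" and x: "a < x" "x < b"
  shows "dyadic_germ h x"
proof -
  note u = up_bumpD[OF assms(1)] and h = conj_betweenD[OF assms(2)]
  have bg: "bij g" by (rule PL_realD(3)[OF assms(3)])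
  obtain N where N: "int_iter f N x < a + e" using up_tends_a[OF assms(1) x, of "a + e"] assms(6) by auto
  have Nx: "a < int_iter f N x" using up_iter_mem[OF assms(1)] x by simp
  \<comment> \<open>N is so low that \<open>int_iter f N\<close> carries x into the segment where h
    is already dyadic; h equals this composite on the whole bump.\<close>
  let ?k = "int_iter g (- N) \<circ> (h \<circ> int_iter f N)"
  have eq: "h y = ?k y" if "a < y" "y < b" for y
  proof -
    have "int_iter g N (h y) = h (int_iter f N y)"
      by (rule int_iter_commute[of f g "{a<..<b}"]) (use u h bg up_iter_mem[OF assms(1)] that in auto)
    then show ?thesis using int_iter_add[OF bg, of "- N" N "h y"] by simp
  qed
  have P: "int_iter f N \<in> PL_real" "int_iter g (- N) \<in> PL_real" using PL_real_int_iter u assms(3) by auto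
  have "dyadic_germ (h \<circ> int_iter f N) x"
    using dyadic_germ_comp[OF P(1) h(1)] dyadic_germ_int_iter[OF u(1) assms(4)] assms(7) N Nx by blast
  then have "dyadic_germ ?k x"
    using dyadic_germ_comp[OF PL_real_comp(1)[OF P(1) h(1)] P(2)] dyadic_germ_int_iter[OF assms(3,5)] by blast
  then show ?thesis
    using dyadic_slopes_cong(2)[where f = h and g = ?k, OF x eq] PL_real_comp(1)[OF PL_real_comp(1)[OF P(1) h(1)] P(2)] by blast
qed

lemma dyadic_germ_propagate:
  assumes "bump f a b" "conj_between h f a b g c d" "g \<in> PL_real"
    and "\<And>x. dyadic_germ f x" "\<And>x. dyadic_germ g x"
    and "e > 0" "\<And>x. a < x \<Longrightarrow> x < a + e \<Longrightarrow> dyadic_germ h x" and x: "a < x" "x < b"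
  shows "dyadic_germ h x"
  using bump_cases[OF assms(1)]
proof
  assume "up_bump f a b"
  then show ?thesis by (rule dyadic_germ_propagate_up) (use assms in auto)
next
  note u = bumpD[OF assms(1)]
  assume uf: "up_bump (inv f) a b"
  have c: "conj_between h (inv f) a b (inv g) c d" using assms u by (intro conj_between_inverses)
  have "dyadic_germ (inv k) y" if "k \<in> PL_real" "\<And>x. dyadic_germ k x" for k y
    using dyadic_germ_inv[OF that(1) that(2), of "inv k y"] PL_realD(6)[OF that(1)] by simp
  then have "\<And>x. dyadic_germ (inv f) x" "\<And>x. dyadic_germ (inv g) x" using assms u by auto
  then show ?thesis
    by (rule dyadic_germ_propagate_up[OF uf c PL_real_inv(1)[OF assms(3)]]) (use assms in auto)
qed

text \<open>The slopes \<open>2 ^ (j + 1)\<close> and \<open>2 ^ j\<close> are consecutive, so that solving for the node involves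
  no division except by a power of 2.\<close>

lemma dyadic_map_exists:
  assumes "dyadic u" "dyadic v" "dyadic u'" "dyadic v'" "u < v" "u' < v'"
  obtains K where "K \<in> PL_real" "K u = u'" "K v = v'" "\<And>x. u < x \<Longrightarrow> x < v \<Longrightarrow> dyadic_germ K x"
proof -
  \<comment> \<open>The average slope then lies between p, the j-th power of 2, and 2 p.\<close>
  define j where "j = \<lfloor>log 2 ((v' - u') / (v - u))\<rfloor>"
  define p :: real where "p = 2 powi j"
  have p: "p > 0" "pow2 p" "pow2 (2 * p)"
    using pow2_def power_int_1_right[of 2] pow2_mult[of 2 p] by (auto simp: p_def) (metis power_int_1_right)+
  have pp: "p = 2 powr of_int j" unfolding p_def by (subst powr_real_of_int') auto
  have q: "(v' - u') / (v - u) > 0" using assms by simp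
  have "of_int j \<le> log 2 ((v' - u') / (v - u))" "log 2 ((v' - u') / (v - u)) < of_int j + 1"
    unfolding j_def by linarith+
  then have "p \<le> (v' - u') / (v - u)" "(v' - u') / (v - u) < 2 powr (of_int j + 1)"
    using q by (auto simp: pp le_log_iff log_less_iff)
  then have pb: "p * (v - u) \<le> v' - u'" "v' - u' < 2 * p * (v - u)"
    using assms by (auto simp: pp powr_add field_simps)
  \<comment> \<open>The solution of 2 p (z - u) + p (v - z) = v' - u'.\<close>
  define z where "z = u + ((v' - u') / p - (v - u))"
  have z: "u \<le> z" "z < v" using pb p(1) by (auto simp: z_def field_simps)
  have "dyadic (1 / p * (v' - u'))" using dyadic_pow2_mult[OF pow2_inverse[OF p(2)]] assms dyadic_diff by blast
  then have dz: "dyadic z" unfolding z_def using assms by (intro dyadic_add dyadic_diff) auto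
  define K1 where "K1 = (\<lambda>y. 2 * p * y + (u' - 2 * p * u))"
  define K2 where "K2 = (\<lambda>y. p * y + (v' - p * v))"
  have K1: "K1 \<in> PL_real" "left_slope K1 x = 2 * p" "right_slope K1 x = 2 * p" "K1 u = u'" for x
    unfolding K1_def using PL_real_affine[of "2 * p"] p(1) by auto
  have K2: "K2 \<in> PL_real" "left_slope K2 x = p" "right_slope K2 x = p" "K2 v = v'" for x
    unfolding K2_def using PL_real_affine[of p] p(1) by auto
  have Kz: "K1 z = K2 z" using p(1) by (simp add: K1_def K2_def z_def field_simps)
  have d1: "dyadic (K1 x) \<longleftrightarrow> dyadic x" for x
  proof -
    have "dyadic (u' - 2 * p * u)" using dyadic_pow2_mult[OF p(3)] assms dyadic_diff by blast
    then show ?thesis unfolding K1_def using dyadic_add_cancel(1) dyadic_pow2_mult[OF p(3)] by blast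
  qed
  have d2: "dyadic (K2 x) \<longleftrightarrow> dyadic x" for x
  proof -
    have "dyadic (v' - p * v)" using dyadic_pow2_mult[OF p(2)] assms dyadic_diff by blast
    then show ?thesis unfolding K2_def using dyadic_add_cancel(1) dyadic_pow2_mult[OF p(2)] by blast
  qed
  let ?K = "\<lambda>y. if y \<le> z then K1 y else K2 y"
  have l: "left_slope ?K x = 2 * p" if "x \<le> z" for x
    using left_slope_cong[of "x - 1" x ?K K1] K1 that by auto
  have r: "right_slope ?K x = p" if "z \<le> x" for x
  proof -
    have "?K y = K2 y" if "x \<le> y" for y using that \<open>z \<le> x\<close> Kz by (cases "y = z") auto
    then show ?thesis using right_slope_cong[of x "x + 1" ?K K2] K2 by auto
  qed
  have r1: "right_slope ?K x = 2 * p" if "x < z" for x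
    using right_slope_cong[of x z ?K K1] K1 that by auto
  have l1: "left_slope ?K x = p" if "z < x" for x
    using left_slope_cong[of z x ?K K2] K2 that by auto
  have "dyadic_germ ?K x" for x
  proof -
    consider "x < z" | "x = z" | "z < x" by linarith
    then show ?thesis
      by cases (use l[of x] r[of x] l1[of x] r1[of x] d1[of x] d2[of x] p dz in \<open>auto simp: dyadic_germ_def dyadic_slopes_def\<close>)
  qed
  moreover have "?K \<in> PL_real" by (rule PL_real_glue[OF K1(1) K2(1) Kz])
  ultimately show ?thesis using z K1 K2 by (intro that[of ?K]) auto
qed

section \<open>Bump domains and gluing\<close>

lemma PL_plus_01:
  assumes "f \<in> PL_plus 0 1"
  shows "f \<in> PL_real" "f 0 = 0" "f 1 = 1" "x \<le> 0 \<or> 1 \<le> x \<Longrightarrow> f x = x"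
  using PL_plusD[OF _ assms] by auto

lemma closed_fixpoints: "f \<in> PL_real \<Longrightarrow> closed {x. f x = x}"
  by (intro closed_Collect_eq PL_real_continuous continuous_on_id)

lemma frontier_fixset:
  assumes "f \<in> PL_real"
  shows "x \<in> top_of_set {0<..<1} frontier_of fixset f \<Longrightarrow> f x = x"
    "0 < a \<Longrightarrow> a < 1 \<Longrightarrow> f a = a \<Longrightarrow> (\<And>e. e > 0 \<Longrightarrow> \<exists>y. \<bar>y - a\<bar> < e \<and> f y \<noteq> y) \<Longrightarrow>
      a \<in> top_of_set {0<..<1} frontier_of fixset f"
proof -
  have "fixset f = {0<..<1} \<inter> {x. f x = x}" by (auto simp: fixset_def)
  then have cl: "closedin (top_of_set {0<..<1}) (fixset f)"
    using closedin_closed_Int[OF closed_fixpoints[OF assms], of "{0<..<1}"] by simp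
  then show "x \<in> top_of_set {0<..<1} frontier_of fixset f \<Longrightarrow> f x = x"
    using frontier_of_subset_closedin by (auto simp: fixset_def)
  assume a: "0 < a" "a < 1" "f a = a" "\<And>e. e > 0 \<Longrightarrow> \<exists>y. \<bar>y - a\<bar> < e \<and> f y \<noteq> y"
  have "a \<notin> top_of_set {0<..<1} interior_of fixset f"
  proof
    assume "a \<in> top_of_set {0<..<1} interior_of fixset f"
    then obtain T where T: "openin (top_of_set {0<..<1}) T" "a \<in> T" "T \<subseteq> fixset f"
      by (auto simp: interior_of_def)
    then have "open T" by (simp add: openin_open_eq)
    then obtain e where "e > 0" "ball a e \<subseteq> T" using T(2) open_contains_ball by blast
    then show False using a(4)[of e] T(3) by (force simp: fixset_def dist_real_def)
  qed
  moreover have "a \<in> fixset f" using a by (simp add: fixset_def)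
  then have "a \<in> top_of_set {0<..<1} closure_of fixset f"
    using cl closure_of_closedin by blast
  ultimately show "a \<in> top_of_set {0<..<1} frontier_of fixset f" by (simp add: frontier_of_def)
qed

text \<open>If an end point of a component of moved points were itself moved, the component could be
  enlarged across it, against maximality. Conversely, the fixed end points of a bump lie in the
  frontier or outside (0, 1), so no connected set in the complement can pass them.\<close>

lemma bump_domain_iff:
  assumes "f \<in> PL_plus 0 1"
  shows "bump_domain f a b \<longleftrightarrow> 0 \<le> a \<and> b \<le> 1 \<and> bump f a b"
proof -
  note f = PL_plus_01[OF assms]
  let ?X = "{0<..<1} - top_of_set {0<..<1} frontier_of fixset f"
  have X: "x \<in> ?X" if "0 < x" "x < 1" "f x \<noteq> x" for x using that frontier_fixset(1)[OF f(1)] by auto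
  show ?thesis
  proof
    assume R: "0 \<le> a \<and> b \<le> 1 \<and> bump f a b"
    then have u: "0 \<le> a" "b \<le> 1" "a < b" "f a = a" "f b = b" "\<And>y. a < y \<Longrightarrow> y < b \<Longrightarrow> f y \<noteq> y"
      using bumpD[of f a b] by auto
    have nX: "a \<notin> ?X" "b \<notin> ?X"
    proof -
      have fr: "\<exists>y. \<bar>y - a\<bar> < e \<and> f y \<noteq> y" if e: "e > 0" for e
      proof -
        obtain h where "0 < h" "h < e" "h < b - a" using field_lbound_gt_zero[of e "b - a"] e u(3) by auto
        then show ?thesis using u(6)[of "a + h"] by (intro exI[of _ "a + h"]) auto
      qed
      have "a \<in> top_of_set {0<..<1} frontier_of fixset f" if "0 < a"
        by (rule frontier_fixset(2)[OF f(1)]) (use that u fr in auto)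
      then show "a \<notin> ?X" by auto
      have fr: "\<exists>y. \<bar>y - b\<bar> < e \<and> f y \<noteq> y" if e: "e > 0" for e
      proof -
        obtain h where "0 < h" "h < e" "h < b - a" using field_lbound_gt_zero[of e "b - a"] e u(3) by auto
        then show ?thesis using u(6)[of "b - h"] by (intro exI[of _ "b - h"]) auto
      qed
      have "b \<in> top_of_set {0<..<1} frontier_of fixset f" if "b < 1"
        by (rule frontier_fixset(2)[OF f(1)]) (use that u fr in auto)
      then show "b \<notin> ?X" by auto
    qed
    have "{a<..<b} \<in> components ?X"
      unfolding in_components_maximal
    proof (intro conjI allI impI)
      show "{a<..<b} \<noteq> {}" using u by simp
      show "{a<..<b} \<subseteq> ?X" using u X by auto
      show "connected {a<..<b}" by simp
      fix D assume D: "D \<noteq> {} \<and> {a<..<b} \<subseteq> D \<and> D \<subseteq> ?X \<and> connected D"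
      define m where "m = (a + b) / 2"
      have m: "a < m" "m < b" "m \<in> D" using u D by (auto simp: m_def subset_iff)
      have int: "z \<in> D" if "x \<in> D" "y \<in> D" "x \<le> z" "z \<le> y" for x y z
        using D that connected_contains_Icc[of D x y] by auto
      have "z \<in> {a<..<b}" if "z \<in> D" for z
      proof (rule ccontr)
        assume "z \<notin> {a<..<b}"
        then have "a \<in> D \<or> b \<in> D" using int[OF that m(3), of a] int[OF m(3) that, of b] m by auto
        then show False using nX D by blast
      qed
      then show "D = {a<..<b}" using D by blast
    qed
    then show "bump_domain f a b" using u by (simp add: bump_domain_def)
  next
    assume L: "bump_domain f a b"
    then have c: "{a<..<b} \<in> components ?X" and nf: "\<And>y. a < y \<Longrightarrow> y < b \<Longrightarrow> f y \<noteq> y"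
      by (auto simp: bump_domain_def)
    from c have C: "{a<..<b} \<noteq> {}" "{a<..<b} \<subseteq> ?X"
      and max: "\<And>D. D \<noteq> {} \<Longrightarrow> {a<..<b} \<subseteq> D \<Longrightarrow> D \<subseteq> ?X \<Longrightarrow> connected D \<Longrightarrow> D = {a<..<b}"
      unfolding in_components_maximal by auto
    have ab: "a < b" using C(1) by simp
    have "{a<..<b} \<subseteq> {0<..<1}" using C(2) by blast
    then have ab': "0 \<le> a" "b \<le> 1" using ab by (auto simp: greaterThanLessThan_subseteq_greaterThanLessThan)
    have op: "open {x. f x \<noteq> x}" using closed_fixpoints[OF f(1)] by (simp add: closed_def Collect_neg_eq)
    have "f a = a"
    proof (rule ccontr)
      assume na: "f a \<noteq> a"
      then have "a \<noteq> 0" using f by metis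
      then have a0: "0 < a" using ab' by simp
      obtain e where e: "e > 0" "\<And>y. \<bar>y - a\<bar> < e \<Longrightarrow> f y \<noteq> y"
        using op na unfolding open_contains_ball by (force simp: subset_iff dist_real_def abs_minus_commute)
      obtain h where h: "0 < h" "h < e" "h < a" using field_lbound_gt_zero[of e a] e a0 by auto
      have "{a - h<..<b} = {a<..<b}"
      proof (rule max)
        show "{a - h<..<b} \<subseteq> ?X"
        proof
          fix y assume y: "y \<in> {a - h<..<b}"
          have "f y \<noteq> y" using nf[of y] e(2)[of y] y h by (cases "a < y") auto
          then show "y \<in> ?X" using y h ab' by (intro X) auto
        qed
      qed (use ab h in auto)
      moreover have "a \<in> {a - h<..<b}" using h ab by simp
      ultimately show False by auto
    qed
    moreover have "f b = b"
    proof (rule ccontr)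
      assume nb: "f b \<noteq> b"
      then have "b \<noteq> 1" using f by metis
      then have b1: "0 < 1 - b" using ab' by simp
      obtain e where e: "e > 0" "\<And>y. \<bar>y - b\<bar> < e \<Longrightarrow> f y \<noteq> y"
        using op nb unfolding open_contains_ball by (force simp: subset_iff dist_real_def abs_minus_commute)
      obtain h where h: "0 < h" "h < e" "h < 1 - b" using field_lbound_gt_zero[of e "1 - b"] e b1 by auto
      have "{a<..<b + h} = {a<..<b}"
      proof (rule max)
        show "{a<..<b + h} \<subseteq> ?X"
        proof
          fix y assume y: "y \<in> {a<..<b + h}"
          have "f y \<noteq> y" using nf[of y] e(2)[of y] y h by (cases "y < b") auto
          then show "y \<in> ?X" using y h ab' by (intro X) auto
        qed
      qed (use ab h in auto)
      moreover have "b \<in> {a<..<b + h}" using h ab by simp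
      ultimately show False by auto
    qed
    ultimately show "0 \<le> a \<and> b \<le> 1 \<and> bump f a b" using ab ab' nf f(1) by (auto simp: bump_def)
  qed
qed

lemma bump_domainD:
  assumes "f \<in> PL_plus 0 1" "bump_domain f a b"
  shows "bump f a b" "0 \<le> a" "b \<le> 1" "a < b" "f a = a" "f b = b" "a < y \<Longrightarrow> y < b \<Longrightarrow> f y \<noteq> y"
  using assms bump_domain_iff[OF assms(1)] bumpD[of f a b] by auto

lemma fixpoint_not_in_bump:
  assumes "f \<in> PL_plus 0 1" "bump_domain f a b" "f p = p" shows "p \<le> a \<or> b \<le> p"
  using bump_domainD(7)[OF assms(1,2), of p] assms(3) by force

lemma bump_domain_unique:
  assumes "f \<in> PL_plus 0 1" "bump_domain f a b" "bump_domain f a' b'" "max a a' < min b b'"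
  shows "a = a' \<and> b = b'"
  using fixpoint_not_in_bump[OF assms(1,2), of a'] fixpoint_not_in_bump[OF assms(1,2), of b']
    fixpoint_not_in_bump[OF assms(1,3), of a] fixpoint_not_in_bump[OF assms(1,3), of b]
    bump_domainD[OF assms(1,2)] bump_domainD[OF assms(1,3)] assms(4) by auto

lemma bump_domain_exists:
  assumes "f \<in> PL_plus 0 1" "f x \<noteq> x"
  obtains a b where "bump_domain f a b" "a < x" "x < b"
proof -
  note f = PL_plus_01[OF assms(1)]
  have x: "0 < x" "x < 1" using f(4)[of x] assms(2) by force+
  have "closed ({0..x} \<inter> {x. f x = x})" "closed ({x..1} \<inter> {x. f x = x})"
    using closed_fixpoints[OF f(1)] by (auto intro!: closed_Int)
  then have c: "compact ({0..x} \<inter> {x. f x = x})" "compact ({x..1} \<inter> {x. f x = x})"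
    using bounded_subset[of "{0..x}"] bounded_subset[of "{x..1}"] by (auto simp: compact_eq_bounded_closed)
  have "0 \<in> {0..x} \<inter> {x. f x = x}" "1 \<in> {x..1} \<inter> {x. f x = x}" using f x by auto
  then have ne: "{0..x} \<inter> {x. f x = x} \<noteq> {}" "{x..1} \<inter> {x. f x = x} \<noteq> {}" by blast+
  obtain a where a: "a \<in> {0..x} \<inter> {x. f x = x}" "\<And>y. y \<in> {0..x} \<inter> {x. f x = x} \<Longrightarrow> y \<le> a"
    using compact_attains_sup[OF c(1) ne(1)] by blast
  obtain b where b: "b \<in> {x..1} \<inter> {x. f x = x}" "\<And>y. y \<in> {x..1} \<inter> {x. f x = x} \<Longrightarrow> b \<le> y"
    using compact_attains_inf[OF c(2) ne(2)] by blast
  have ax: "a \<le> x" "f a = a" "0 \<le> a" "x \<le> b" "f b = b" "b \<le> 1" using a(1) b(1) by auto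
  then have ab: "a < x" "x < b" using assms(2) by (auto simp: less_le)
  have "f y \<noteq> y" if "a < y" "y < b" for y
    using a(2)[of y] b(2)[of y] that ax by (cases "y \<le> x") auto
  then have "bump f a b" using ab ax f(1) by (auto simp: bump_def)
  then have "bump_domain f a b" using bump_domain_iff[OF assms(1)] ax by simp
  then show ?thesis using ab by (rule that)
qed

section \<open>The finite set of bump ends\<close>

text \<open>The points 0 and 1 are included so that consecutive elements cut the whole of [0, 1]
  into bump domains and intervals of fixed points.\<close>

definition bump_ends :: "(real \<Rightarrow> real) \<Rightarrow> real set" where
  "bump_ends f = {0, 1} \<union> {p. \<exists>q. bump_domain f p q \<or> bump_domain f q p}"

lemma bump_endsD:
  assumes "f \<in> PL_plus 0 1" "p \<in> bump_ends f" shows "0 \<le> p" "p \<le> 1" "f p = p"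
proof -
  have "0 \<le> p \<and> p \<le> 1 \<and> f p = p"
  proof (cases "p \<in> {0, 1}")
    case True
    then show ?thesis using PL_plus_01[OF assms(1)] by auto
  next
    case False
    then obtain q where "bump_domain f p q \<or> bump_domain f q p" using assms(2) by (auto simp: bump_ends_def)
    then show ?thesis using bump_domainD[OF assms(1), of p q] bump_domainD[OF assms(1), of q p] by auto
  qed
  then show "0 \<le> p" "p \<le> 1" "f p = p" by auto
qed

text \<open>On each side of a fixed point x the difference f y - y is (slope - 1) times y - x, so
  that side consists of fixed points if the slope is 1 and of moved points otherwise.\<close>

lemma fix_near:
  assumes "f \<in> PL_real" "f x = x"
  obtains e where "e > 0" "(\<forall>y. x < y \<and> y < x + e \<longrightarrow> f y = y) \<or> (\<forall>y. x < y \<and> y < x + e \<longrightarrow> f y \<noteq> y)"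
    "(\<forall>y. x - e < y \<and> y < x \<longrightarrow> f y = y) \<or> (\<forall>y. x - e < y \<and> y < x \<longrightarrow> f y \<noteq> y)"
    "right_slope f x \<noteq> 1 \<Longrightarrow> (\<forall>y. x < y \<and> y < x + e \<longrightarrow> f y \<noteq> y)"
    "left_slope f x \<noteq> 1 \<Longrightarrow> (\<forall>y. x - e < y \<and> y < x \<longrightarrow> f y \<noteq> y)"
    "right_slope f x = 1 \<Longrightarrow> (\<forall>y. x < y \<and> y < x + e \<longrightarrow> f y = y)"
    "left_slope f x = 1 \<Longrightarrow> (\<forall>y. x - e < y \<and> y < x \<longrightarrow> f y = y)"
proof -
  obtain e where e: "e > 0" "\<And>y. x - e < y \<Longrightarrow> y \<le> x \<Longrightarrow> f y = f x + left_slope f x * (y - x)"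
    "\<And>y. x \<le> y \<Longrightarrow> y < x + e \<Longrightarrow> f y = f x + right_slope f x * (y - x)"
    using PL_real_local[OF assms(1)] by blast
  have r: "f y = y \<longleftrightarrow> right_slope f x = 1" if "x < y" "y < x + e" for y
  proof -
    have "f y - y = (right_slope f x - 1) * (y - x)" using e(3)[of y] that assms(2) by (simp add: algebra_simps)
    then show ?thesis using that by (metis diff_gt_0_iff_gt eq_iff_diff_eq_0 less_irrefl mult_eq_0_iff)
  qed
  have l: "f y = y \<longleftrightarrow> left_slope f x = 1" if "x - e < y" "y < x" for y
  proof -
    have "f y - y = (left_slope f x - 1) * (y - x)" using e(2)[of y] that assms(2) by (simp add: algebra_simps)
    then show ?thesis using that by (metis eq_iff_diff_eq_0 less_irrefl mult_eq_0_iff)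
  qed
  show ?thesis by (rule that[of e]) (use e(1) r l in blast)+
qed

text \<open>An accumulation point x of bump ends is fixed by continuity. By \<open>fix_near\<close>
  each side of x is, near x, entirely fixed or entirely moved, whereas a bump end on that side is a
  fixed point next to moved ones.\<close>

lemma finite_bump_ends:
  assumes "f \<in> PL_plus 0 1" shows "finite (bump_ends f)"
proof (rule ccontr)
  note f = PL_plus_01[OF assms]
  let ?S = "bump_ends f"
  assume "infinite ?S"
  moreover have "?S \<subseteq> {0..1}" using bump_endsD[OF assms] by auto
  ultimately obtain x where x: "x islimpt ?S" "0 \<le> x" "x \<le> 1"
    using compact_eq_Bolzano_Weierstrass[of "{0..1::real}"] by auto
  have "closed {x. f x = x}" by (rule closed_fixpoints[OF f(1)])
  moreover have "x islimpt {x. f x = x}" using x(1) bump_endsD[OF assms] by (auto intro: islimpt_subset)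
  ultimately have "f x = x" by (auto simp: closed_limpt)
  from fix_near[OF f(1) this] obtain e where e: "e > 0"
    "(\<forall>y. x < y \<and> y < x + e \<longrightarrow> f y = y) \<or> (\<forall>y. x < y \<and> y < x + e \<longrightarrow> f y \<noteq> y)"
    "(\<forall>y. x - e < y \<and> y < x \<longrightarrow> f y = y) \<or> (\<forall>y. x - e < y \<and> y < x \<longrightarrow> f y \<noteq> y)"
    by metis
  \<comment> \<open>Keeps 0 and 1 out of the punctured neighbourhood of x, so that the point p found
    there is an end of an actual bump domain.\<close>
  define d where "d = Min (insert e ((\<lambda>p. \<bar>p - x\<bar>) ` ({0, 1} - {x})))"
  have "d > 0" "d \<le> e" using e(1) by (auto simp: d_def)
  have d: "d \<le> \<bar>p - x\<bar>" if "p \<in> {0, 1}" "p \<noteq> x" for p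
    unfolding d_def by (rule Min_le) (use that in auto)
  obtain p where p: "p \<in> ?S" "p \<noteq> x" "\<bar>p - x\<bar> < d"
    using x(1) \<open>d > 0\<close> unfolding islimpt_approachable by (metis dist_real_def)
  then have "p \<notin> {0, 1}" using d[of p] by auto
  then obtain q where "bump_domain f p q \<or> bump_domain f q p" using p(1) by (auto simp: bump_ends_def)
  then obtain z where z: "f z \<noteq> z" "\<bar>z - x\<bar> < e" "z \<noteq> x" "z < x \<longleftrightarrow> p < x"
  proof
    assume b: "bump_domain f p q"
    \<comment> \<open>Stopping at x and at x + e puts the moved point z close to x and on the same
      side as p.\<close>
    define c where "c = Min {q, x + e, if p < x then x else q}"
    have c: "p < c" "c \<le> q" "c \<le> x + e" "p < x \<Longrightarrow> c \<le> x"
      using p \<open>d \<le> e\<close> bump_domainD(4)[OF assms b] by (auto simp: c_def)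
    define z where "z = (p + c) / 2"
    have "p < z" "z < c" using c(1) by (auto simp: z_def)
    then show ?thesis
      using that[of z] bump_domainD(7)[OF assms b, of z] c p \<open>d \<le> e\<close>
      by (cases "p < x") (auto simp: abs_less_iff)
  next
    assume b: "bump_domain f q p"
    define c where "c = Max {q, x - e, if p > x then x else q}"
    have c: "c < p" "q \<le> c" "x - e \<le> c" "x < p \<Longrightarrow> x \<le> c"
      using p \<open>d \<le> e\<close> bump_domainD(4)[OF assms b] by (auto simp: c_def)
    define z where "z = (p + c) / 2"
    have "c < z" "z < p" using c(1) by (auto simp: z_def)
    then show ?thesis
      using that[of z] bump_domainD(7)[OF assms b, of z] c p \<open>d \<le> e\<close>
      by (cases "p < x") (auto simp: abs_less_iff)
  qed
  have "f p = p" using bump_endsD[OF assms p(1)] by simp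
  moreover have "\<bar>p - x\<bar> < e" using p \<open>d \<le> e\<close> by simp
  ultimately show False using e z p by (cases "p < x") (auto simp: abs_less_iff)
qed

section \<open>Gluing pieces over consecutive end points\<close>

definition adjacent :: "real set \<Rightarrow> real \<Rightarrow> real \<Rightarrow> bool" where
  "adjacent E u v \<longleftrightarrow> u \<in> E \<and> v \<in> E \<and> u < v \<and> (\<forall>e\<in>E. e \<le> u \<or> v \<le> e)"

lemma adjacent_pred:
  assumes "finite E" "v \<in> E" "u \<in> E" "u < v"
  obtains w where "adjacent E w v" "u \<le> w"
proof -
  let ?F = "{e \<in> E. e < v}"
  have F: "finite ?F" "?F \<noteq> {}" using assms by auto
  have "Max ?F \<in> ?F" by (rule Max_in[OF F])
  moreover have "\<And>e. e \<in> ?F \<Longrightarrow> e \<le> Max ?F" using F by simp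
  ultimately show ?thesis using assms by (intro that[of "Max ?F"]) (auto simp: adjacent_def not_less)
qed

lemma adjacent_cover:
  assumes "finite E" "u \<in> E" "v \<in> E" "u < x" "x < v" "x \<notin> E"
  obtains s t where "adjacent E s t" "s < x" "x < t"
proof -
  let ?F = "{e \<in> E. x < e}"
  have F: "finite ?F" "?F \<noteq> {}" using assms by auto
  have t: "Min ?F \<in> ?F" by (rule Min_in[OF F])
  moreover have m: "\<And>e. e \<in> ?F \<Longrightarrow> Min ?F \<le> e" using F by simp
  ultimately obtain w where w: "adjacent E w (Min ?F)" "u \<le> w"
    using adjacent_pred[of E "Min ?F" u] assms by auto
  have "w \<le> x"
  proof (rule ccontr)
    assume "\<not> w \<le> x"
    then have "Min ?F \<le> w" using w by (intro m) (auto simp: adjacent_def)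
    then show False using w by (simp add: adjacent_def)
  qed
  moreover have "w \<noteq> x" using w assms by (auto simp: adjacent_def)
  ultimately show ?thesis using w t by (intro that[of w "Min ?F"]) auto
qed

text \<open>The function h prescribes values at the points of E, which makes neighbouring pieces
  meet; the pieces are attached from left to right.\<close>

lemma glue_pieces:
  assumes E: "finite E" "0 \<in> E" "1 \<in> E" "E \<subseteq> {0..1}" and h: "h 0 = 0" "h 1 = 1"
    and K: "\<And>u v. adjacent E u v \<Longrightarrow> K u v \<in> PL_real \<and> K u v u = h u \<and> K u v v = h v"
  obtains H where "H \<in> PL_plus 0 1" "\<And>u v x. adjacent E u v \<Longrightarrow> u \<le> x \<Longrightarrow> x \<le> v \<Longrightarrow> H x = K u v x"
proof -
  have "\<exists>H\<in>PL_real. (\<forall>x\<le>0. H x = x) \<and> H e = h e \<and>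
     (\<forall>u v x. adjacent E u v \<and> v \<le> e \<and> u \<le> x \<and> x \<le> v \<longrightarrow> H x = K u v x)" if "e \<in> E" for e
    using that
  proof (induction "card {x \<in> E. x < e}" arbitrary: e rule: less_induct)
    case less
    show ?case
    proof (cases "e = 0")
      case True
      have "\<not> (adjacent E u v \<and> v \<le> 0)" for u v using E(4) by (auto simp: adjacent_def subset_iff)
      then show ?thesis using True h PL_real_id(1) by (intro bexI[of _ id]) auto
    next
      case False
      then have "0 < e" using E(4) less.prems by force
      then obtain w where w: "adjacent E w e" "0 \<le> w" using adjacent_pred[OF E(1) less.prems E(2)] by blast
      have "{x \<in> E. x < w} \<subset> {x \<in> E. x < e}" using w by (auto simp: adjacent_def)
      then have "card {x \<in> E. x < w} < card {x \<in> E. x < e}" using E(1) by (intro psubset_card_mono) auto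
      then obtain H where H: "H \<in> PL_real" "\<forall>x\<le>0. H x = x" "H w = h w"
        "\<forall>u v x. adjacent E u v \<and> v \<le> w \<and> u \<le> x \<and> x \<le> v \<longrightarrow> H x = K u v x"
        using less.hyps[of w] w by (auto simp: adjacent_def)
      let ?H = "\<lambda>y. if y \<le> w then H y else K w e y"
      have "?H \<in> PL_real" using H K[OF w(1)] by (intro PL_real_glue) auto
      moreover have "?H x = K u v x" if uv: "adjacent E u v" "v \<le> e" "u \<le> x" "x \<le> v" for u v x
      proof (cases "v \<le> w")
        case True
        then show ?thesis using H uv by auto
      next
        case False
        then have "v = e" "u = w" using uv w by (force simp: adjacent_def)+
        then show ?thesis using uv H K[OF w(1)] by (cases "x = w") auto
      qed
      moreover have "?H e = h e" using K[OF w(1)] w by (auto simp: adjacent_def)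
      ultimately show ?thesis using H(2) w(2) by (intro bexI[of _ ?H]) auto
    qed
  qed
  from this[OF E(3)] obtain H where H: "H \<in> PL_real" "\<forall>x\<le>0. H x = x" "H 1 = h 1"
    "\<forall>u v x. adjacent E u v \<and> v \<le> 1 \<and> u \<le> x \<and> x \<le> v \<longrightarrow> H x = K u v x" by blast
  let ?H = "restr H 0 1"
  have eq: "?H x = H x" if "0 \<le> x" "x \<le> 1" for x using restr_eq[of H 0 1 x] H h that by simp
  have "?H \<in> PL_plus 0 1" using H h by (intro restr_PL_plus) auto
  moreover have "?H x = K u v x" if "adjacent E u v" "u \<le> x" "x \<le> v" for u v x
  proof -
    have "0 \<le> u" "v \<le> 1" using that E(4) by (auto simp: adjacent_def)
    then show ?thesis using eq[of x] H(4) that by auto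
  qed
  ultimately show ?thesis by (rule that)
qed

lemma adjacent_bump_or_fixed:
  assumes "f \<in> PL_plus 0 1" "adjacent (bump_ends f) u v"
  shows "bump_domain f u v \<or> (\<forall>x. u \<le> x \<and> x \<le> v \<longrightarrow> f x = x)"
proof (cases "\<exists>x. u < x \<and> x < v \<and> f x \<noteq> x")
  case True
  then obtain x where x: "u < x" "x < v" "f x \<noteq> x" by blast
  obtain a b where ab: "bump_domain f a b" "a < x" "x < b" using bump_domain_exists[OF assms(1) x(3)] .
  have uv: "u \<in> bump_ends f" "v \<in> bump_ends f" "\<And>e. e \<in> bump_ends f \<Longrightarrow> e \<le> u \<or> v \<le> e"
    using assms(2) by (auto simp: adjacent_def)
  have "a \<in> bump_ends f" "b \<in> bump_ends f" using ab by (auto simp: bump_ends_def)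
  then have "a \<le> u" "v \<le> b" using uv(3)[of a] uv(3)[of b] x ab by auto
  moreover have "u \<le> a \<or> b \<le> u" "v \<le> a \<or> b \<le> v"
    using fixpoint_not_in_bump[OF assms(1) ab(1)] bump_endsD[OF assms(1)] uv by auto
  ultimately have "a = u" "b = v" using x ab by auto
  then show ?thesis using ab by simp
next
  case False
  have "f u = u" "f v = v" using bump_endsD[OF assms(1)] assms(2) by (auto simp: adjacent_def)
  then have "f x = x" if "u \<le> x" "x \<le> v" for x using False that by (cases "x = u"; cases "x = v") auto
  then show ?thesis by blast
qed

lemma bump_domain_adjacent:
  assumes "f \<in> PL_plus 0 1" "bump_domain f a b" shows "adjacent (bump_ends f) a b"
  unfolding adjacent_def
  using bump_domainD[OF assms] fixpoint_not_in_bump[OF assms] bump_endsD[OF assms(1)] assms(2)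
  by (auto simp: bump_ends_def)

section \<open>Bump chains\<close>

lemma bump_chain_iff:
  "bump_chain f C \<longleftrightarrow> C \<noteq> [] \<and> (\<forall>D\<in>set C. bump_domain f (fst D) (snd D))
     \<and> successively (\<lambda>D D'. snd D = fst D' \<and> \<not> dyadic (snd D)) C
     \<and> dyadic (fst (hd C)) \<and> dyadic (snd (last C))"
  by (auto simp: bump_chain_def successively_conv_nth)

lemma bump_chainD:
  assumes "bump_chain f C"
  shows "C \<noteq> []" "i < length C \<Longrightarrow> bump_domain f (fst (C ! i)) (snd (C ! i))"
    "Suc i < length C \<Longrightarrow> snd (C ! i) = fst (C ! Suc i)" "Suc i < length C \<Longrightarrow> \<not> dyadic (snd (C ! i))"
    "dyadic (fst (C ! 0))" "Suc i = length C \<Longrightarrow> dyadic (snd (C ! i))"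
proof -
  show C: "C \<noteq> []" using assms by (simp add: bump_chain_def)
  show "i < length C \<Longrightarrow> bump_domain f (fst (C ! i)) (snd (C ! i))"
    using assms by (auto simp: bump_chain_iff)
  show "Suc i < length C \<Longrightarrow> snd (C ! i) = fst (C ! Suc i)" "Suc i < length C \<Longrightarrow> \<not> dyadic (snd (C ! i))"
    using assms by (auto simp: bump_chain_def)
  show "dyadic (fst (C ! 0))" using assms C by (simp add: bump_chain_def hd_conv_nth)
  have "Suc i = length C \<Longrightarrow> i = length C - 1" by simp
  then show "Suc i = length C \<Longrightarrow> dyadic (snd (C ! i))"
    using assms C by (simp add: bump_chain_def last_conv_nth)
qed

lemma bump_domain_unique_left:
  assumes "f \<in> PL_plus 0 1" "bump_domain f a b" "bump_domain f a b'" shows "b = b'"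
  using bump_domain_unique[OF assms] bump_domainD(4)[OF assms(1,2)] bump_domainD(4)[OF assms(1,3)] by simp

lemma bump_domain_unique_right:
  assumes "f \<in> PL_plus 0 1" "bump_domain f a b" "bump_domain f a' b" shows "a = a'"
  using bump_domain_unique[OF assms] bump_domainD(4)[OF assms(1,2)] bump_domainD(4)[OF assms(1,3)] by simp

text \<open>Walking left from a common bump, both chains run through the same bumps while the left
  end is nondyadic, and both stop at the first dyadic one.\<close>

lemma bump_chain_index_unique:
  assumes "f \<in> PL_plus 0 1" "bump_chain f C" "bump_chain f C'"
  shows "i < length C \<Longrightarrow> j < length C' \<Longrightarrow> C ! i = C' ! j \<Longrightarrow> i = j \<and> C ! 0 = C' ! 0"
proof (induction i arbitrary: j)
  case 0
  show ?case
  proof (cases j)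
    case (Suc j')
    then have "\<not> dyadic (fst (C' ! j))" using bump_chainD(3,4)[OF assms(3), of j'] 0 by simp
    then show ?thesis using 0 bump_chainD(5)[OF assms(2)] by simp
  qed (use 0 in simp)
next
  case (Suc i)
  have l: "snd (C ! i) = fst (C ! Suc i)" "\<not> dyadic (fst (C ! Suc i))"
    using bump_chainD(3,4)[OF assms(2), of i] Suc.prems by auto
  show ?case
  proof (cases j)
    case 0
    then show ?thesis using Suc.prems l bump_chainD(5)[OF assms(3)] by simp
  next
    case (Suc j')
    then have "snd (C' ! j') = snd (C ! i)" using bump_chainD(3)[OF assms(3), of j'] Suc.prems l by simp
    moreover from this have "fst (C ! i) = fst (C' ! j')"
      using bump_domain_unique_right[OF assms(1), of "fst (C ! i)" "snd (C ! i)" "fst (C' ! j')"]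
        bump_chainD(2)[OF assms(2), of i] bump_chainD(2)[OF assms(3), of j'] Suc Suc.prems by auto
    ultimately have "C ! i = C' ! j'" by (simp add: prod_eq_iff)
    then show ?thesis using Suc.IH[of j'] Suc.prems Suc by simp
  qed
qed

text \<open>Each bump is determined by its left end, so one chain is a prefix of the other. A proper
  prefix would stop at a point that is dyadic as a last end and nondyadic as an inner end.\<close>

lemma bump_chain_eqI:
  assumes "f \<in> PL_plus 0 1" "bump_chain f C" "bump_chain f C'" "C ! 0 = C' ! 0"
  shows "C = C'"
proof -
  have eq: "C ! i = C' ! i" if "i < length C" "i < length C'" for i
    using that
  proof (induction i)
    case (Suc i)
    then have "fst (C ! Suc i) = fst (C' ! Suc i)"
      using bump_chainD(3)[OF assms(2), of i] bump_chainD(3)[OF assms(3), of i] by simp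
    moreover from this have "snd (C ! Suc i) = snd (C' ! Suc i)"
      using bump_domain_unique_left[OF assms(1), of "fst (C ! Suc i)" "snd (C ! Suc i)" "snd (C' ! Suc i)"]
        bump_chainD(2)[OF assms(2), of "Suc i"] bump_chainD(2)[OF assms(3), of "Suc i"] Suc.prems by simp
    ultimately show ?case by (simp add: prod_eq_iff)
  qed (use assms in simp)
  have le: False if "bump_chain f X" "bump_chain f Y" "length X < length Y"
    "\<And>i. i < length X \<Longrightarrow> X ! i = Y ! i" for X Y
  proof -
    define n where "n = length X - 1"
    have n: "Suc n = length X" using bump_chainD(1)[OF that(1)] by (simp add: n_def)
    show False using bump_chainD(6)[OF that(1) n] bump_chainD(4)[OF that(2), of n] that(3,4) n by simp
  qed
  have "length C = length C'"
  proof (cases "length C" "length C'" rule: linorder_cases)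
    case less
    have "C ! i = C' ! i" if "i < length C" for i using eq that less by simp
    then show ?thesis using le[OF assms(2,3) less] by blast
  next
    case greater
    have "C' ! i = C ! i" if "i < length C'" for i using eq that greater by simp
    then show ?thesis using le[OF assms(3,2) greater] by blast
  qed
  then show ?thesis using eq by (intro nth_equalityI) auto
qed

lemma bump_chain_unique:
  assumes "f \<in> PL_plus 0 1" "bump_chain f C" "bump_chain f C'" "i < length C" "j < length C'" "C ! i = C' ! j"
  shows "C = C'" "i = j"
  using bump_chain_index_unique[OF assms] bump_chain_eqI[OF assms(1-3)] by auto

text \<open>An element of F has no node at a nondyadic point. The slope there differs from 1 on the
  side of the given bump, hence on the other side too, where another bump must begin.\<close>

lemma bump_domain_extend:
  assumes "f \<in> thompson_F" "\<not> dyadic p"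
  shows "bump_domain f a p \<Longrightarrow> \<exists>b. bump_domain f p b" "bump_domain f p b \<Longrightarrow> \<exists>a. bump_domain f a p"
proof -
  have f: "f \<in> PL_plus 0 1" using assms by (simp add: thompson_F_def)
  note fP = PL_plus_01[OF f]
  have s: "left_slope f p = right_slope f p"
    using thompson_F_imp_dyadic_germ[OF assms(1), of p] assms(2) by (simp add: dyadic_germ_def dyadic_slopes_def)
  have p: "p \<noteq> 0" "p \<noteq> 1" using assms(2) by auto
  show "\<exists>b. bump_domain f p b" if b: "bump_domain f a p"
  proof -
    note d = bump_domainD[OF f b]
    obtain e where e: "e > 0" "right_slope f p \<noteq> 1 \<Longrightarrow> (\<forall>y. p < y \<and> y < p + e \<longrightarrow> f y \<noteq> y)"
      using fix_near[OF fP(1) d(6)] by metis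
    have nf: "f y \<noteq> y" if "p < y" "y < p + e" for y
      using e(2) bump_slope_neq_1(2)[OF d(1)] s that by auto
    define y where "y = p + e / 2"
    have y: "p < y" "y < p + e" using e by (auto simp: y_def)
    obtain a' b' where ab: "bump_domain f a' b'" "a' < y" "y < b'" using bump_domain_exists[OF f nf[OF y]] .
    have "p \<le> a'" using fixpoint_not_in_bump[OF f ab(1) d(6)] y ab by auto
    moreover have "\<not> p < a'" using nf[of a'] bump_domainD(5)[OF f ab(1)] ab y by auto
    ultimately show ?thesis using ab(1) by (metis less_eq_real_def)
  qed
  show "\<exists>a. bump_domain f a p" if b: "bump_domain f p b"
  proof -
    note d = bump_domainD[OF f b]
    obtain e where e: "e > 0" "left_slope f p \<noteq> 1 \<Longrightarrow> (\<forall>y. p - e < y \<and> y < p \<longrightarrow> f y \<noteq> y)"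
      using fix_near[OF fP(1) d(5)] by metis
    have nf: "f y \<noteq> y" if "p - e < y" "y < p" for y
      using e(2) bump_slope_neq_1(1)[OF d(1)] s that by auto
    define y where "y = p - e / 2"
    have y: "p - e < y" "y < p" using e by (auto simp: y_def)
    obtain a' b' where ab: "bump_domain f a' b'" "a' < y" "y < b'" using bump_domain_exists[OF f nf[OF y]] .
    have "b' \<le> p" using fixpoint_not_in_bump[OF f ab(1) d(5)] y ab by auto
    moreover have "\<not> b' < p" using nf[of b'] bump_domainD(6)[OF f ab(1)] ab y by auto
    ultimately show ?thesis using ab(1) by (metis less_eq_real_def)
  qed
qed

text \<open>Extend to the right and then to the left until a dyadic end is met; finiteness of the
  set of bump ends makes both processes stop.\<close>

lemma bump_chain_exists:
  assumes "f \<in> thompson_F" "bump_domain f a b"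
  obtains C i where "bump_chain f C" "i < length C" "C ! i = (a, b)"
proof -
  have f: "f \<in> PL_plus 0 1" using assms by (simp add: thompson_F_def)
  let ?R = "\<lambda>L. L \<noteq> [] \<and> (\<forall>D\<in>set L. bump_domain f (fst D) (snd D))
     \<and> successively (\<lambda>D D'. snd D = fst D' \<and> \<not> dyadic (snd D)) L \<and> dyadic (snd (last L))"
  note fin = finite_bump_ends[OF f]
  have right: "\<exists>L. ?R L \<and> hd L = (a, b)" if "bump_domain f a b" for a b
    using that
  proof (induction "card {p \<in> bump_ends f. b < p}" arbitrary: a b rule: less_induct)
    case less
    show ?case
    proof (cases "dyadic b")
      case True
      then show ?thesis using less.prems by (intro exI[of _ "[(a, b)]"]) simp
    next
      case False
      obtain b' where b': "bump_domain f b b'" using bump_domain_extend(1)[OF assms(1) False less.prems] by blast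
      have "b < b'" "b' \<in> bump_ends f" using bump_domainD(4)[OF f b'] b' by (auto simp: bump_ends_def)
      then have "{p \<in> bump_ends f. b' < p} \<subset> {p \<in> bump_ends f. b < p}" by auto
      then have "card {p \<in> bump_ends f. b' < p} < card {p \<in> bump_ends f. b < p}"
        using fin by (intro psubset_card_mono) auto
      from less.hyps[OF this b'] obtain L where "?R L" "hd L = (b, b')" by blast
      then show ?thesis using less.prems False
        by (intro exI[of _ "(a, b) # L"]) (auto simp: successively_Cons)
    qed
  qed
  have left: "\<exists>A. bump_chain f (A @ L)" if "?R L" for L
    using that
  proof (induction "card {p \<in> bump_ends f. p < fst (hd L)}" arbitrary: L rule: less_induct)
    case less
    show ?case
    proof (cases "dyadic (fst (hd L))")
      case True
      then show ?thesis using less.prems by (intro exI[of _ "[]"]) (simp add: bump_chain_iff)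
    next
      case False
      have "bump_domain f (fst (hd L)) (snd (hd L))" using less.prems by simp
      then obtain a' where a': "bump_domain f a' (fst (hd L))" using bump_domain_extend(2)[OF assms(1) False] by blast
      have "a' < fst (hd L)" "a' \<in> bump_ends f" using bump_domainD(4)[OF f a'] a' by (auto simp: bump_ends_def)
      then have "{p \<in> bump_ends f. p < a'} \<subset> {p \<in> bump_ends f. p < fst (hd L)}" by auto
      then have "card {p \<in> bump_ends f. p < fst (hd ((a', fst (hd L)) # L))} < card {p \<in> bump_ends f. p < fst (hd L)}"
        using fin by (simp add: psubset_card_mono)
      from less.hyps[OF this] obtain A where "bump_chain f (A @ ((a', fst (hd L)) # L))"
        using less.prems a' False by (auto simp: successively_Cons)
      then show ?thesis by (intro exI[of _ "A @ [(a', fst (hd L))]"]) simp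
    qed
  qed
  obtain L where L: "?R L" "hd L = (a, b)" using right[OF assms(2)] by blast
  obtain A where "bump_chain f (A @ L)" using left[OF L(1)] by blast
  moreover have "(A @ L) ! length A = (a, b)" using L by (simp add: hd_conv_nth nth_append)
  ultimately show ?thesis using L by (intro that[of "A @ L" "length A"]) auto
qed

lemma inj_on_bump_chain_key:
  assumes "f \<in> PL_plus 0 1" shows "inj_on (\<lambda>C. fst (hd C)) {C. bump_chain f C}"
proof (rule inj_onI)
  fix C C' assume "C \<in> {C. bump_chain f C}" "C' \<in> {C. bump_chain f C}" and eq: "fst (hd C) = fst (hd C')"
  then have C: "bump_chain f C" "bump_chain f C'" by auto
  then have hd: "hd C = C ! 0" "hd C' = C' ! 0" using bump_chainD(1) by (auto simp: hd_conv_nth)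
  have "bump_domain f (fst (C ! 0)) (snd (C ! 0))" "bump_domain f (fst (C' ! 0)) (snd (C' ! 0))"
    using bump_chainD(1,2) C by blast+
  then have "snd (C ! 0) = snd (C' ! 0)" using bump_domain_unique_left[OF assms] eq hd by metis
  then have "C ! 0 = C' ! 0" using eq hd by (simp add: prod_eq_iff)
  then show "C = C'" using bump_chain_eqI[OF assms C] by simp
qed

lemma finite_bump_chains:
  assumes "f \<in> PL_plus 0 1" shows "finite {C. bump_chain f C}"
proof (rule finite_imageD[OF _ inj_on_bump_chain_key[OF assms]])
  have "bump_domain f (fst (hd C)) (snd (hd C))" if "bump_chain f C" for C
    using that by (simp add: bump_chain_iff)
  then have "(\<lambda>C. fst (hd C)) ` {C. bump_chain f C} \<subseteq> bump_ends f" by (auto simp: bump_ends_def)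
  then show "finite ((\<lambda>C. fst (hd C)) ` {C. bump_chain f C})"
    using finite_bump_ends[OF assms] finite_subset by blast
qed

section \<open>The ordered list of chains\<close>

text \<open>The left end of the first bump is an injective key on bump chains only, not on all
  lists, so the locale is interpreted relative to the set itself.\<close>

lemma (in linorder) sorted_key_list_of_set_inj_on:
  assumes "inj_on f S" "finite S"
  shows "set (sorted_key_list_of_set f S) = S" "sorted (map f (sorted_key_list_of_set f S))"
    "distinct (map f (sorted_key_list_of_set f S))"
proof -
  interpret folding_insort_key "(\<le>)" "(<)" S f
    by unfold_locales (rule assms)
  show "set (sorted_key_list_of_set f S) = S"
    by (rule set_sorted_key_list_of_set[OF subset_refl assms(2)])
  show "sorted (map f (sorted_key_list_of_set f S))"
    by (rule sorted_sorted_key_list_of_set[OF subset_refl])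
  show "distinct (map f (sorted_key_list_of_set f S))"
    by (rule distinct_sorted_key_list_of_set[OF subset_refl])
qed
definition chains_list :: "(real \<Rightarrow> real) \<Rightarrow> (real \<times> real) list list" where
  "chains_list f = sorted_key_list_of_set (\<lambda>C. fst (hd C)) {C. bump_chain f C}"

lemma chains_list:
  assumes "f \<in> PL_plus 0 1"
  shows "set (chains_list f) = {C. bump_chain f C}" "sorted (map (\<lambda>C. fst (hd C)) (chains_list f))"
    "distinct (map (\<lambda>C. fst (hd C)) (chains_list f))"
  unfolding chains_list_def
  by (rule sorted_key_list_of_set_inj_on[OF inj_on_bump_chain_key[OF assms] finite_bump_chains[OF assms]])+

text \<open>A chain cannot cross a dyadic fixed point, because its inner end points are
  nondyadic.\<close>

lemma bump_chain_before:
  assumes "f \<in> PL_plus 0 1" "bump_chain f C" "f p = p" "dyadic p" "fst (C ! 0) < p" "i < length C"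
  shows "fst (C ! i) < p"
  using assms(6)
proof (induction i)
  case (Suc i)
  have "bump_domain f (fst (C ! i)) (snd (C ! i))" using bump_chainD(2)[OF assms(2)] Suc by simp
  from fixpoint_not_in_bump[OF assms(1) this assms(3)] have "snd (C ! i) \<le> p" using Suc by auto
  moreover have "snd (C ! i) \<noteq> p" using bump_chainD(4)[OF assms(2)] Suc assms(4) by blast
  ultimately show ?case using bump_chainD(3)[OF assms(2)] Suc by simp
qed (use assms in simp)

lemma bump_chain_increasing:
  assumes "f \<in> PL_plus 0 1" "bump_chain f C" shows "sorted_wrt (<) (map fst C)"
proof -
  have "successively (\<lambda>D D'. fst D < fst D') C"
  proof (subst successively_conv_nth, intro allI impI)
    fix i assume "Suc i < length C"
    then show "fst (C ! i) < fst (C ! Suc i)"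
      using bump_chainD(3)[OF assms(2), of i] bump_chainD(2)[OF assms(2), of i] bump_domainD(4)[OF assms(1)] by simp
  qed
  then have "sorted_wrt (\<lambda>D D'. fst D < fst D') C"
    by (subst (asm) successively_conv_sorted_wrt) (auto simp: transp_def)
  then show ?thesis by (simp add: sorted_wrt_map)
qed

text \<open>A later chain starts at a dyadic fixed point, which the earlier chain cannot cross by
  \<open>bump_chain_before\<close>.\<close>

lemma concat_chains_increasing:
  assumes "f \<in> PL_plus 0 1" 
  shows "(\<forall>C\<in>set xs. bump_chain f C) \<Longrightarrow> sorted_wrt (\<lambda>C C'. fst (hd C) < fst (hd C')) xs \<Longrightarrow>
    sorted_wrt (<) (map fst (concat xs))"
proof (induction xs)
  case (Cons C xs)
  have C: "bump_chain f C" using Cons by simp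
  have "fst D < fst D'" if D: "D \<in> set C" "C' \<in> set xs" "D' \<in> set C'" for D C' D'
  proof -
    have C': "bump_chain f C'" using Cons D by simp
    obtain i where i: "i < length C" "D = C ! i" using D(1) by (metis in_set_conv_nth)
    obtain j where j: "j < length C'" "D' = C' ! j" using D(3) by (metis in_set_conv_nth)
    have h: "hd C = C ! 0" "hd C' = C' ! 0" using C C' bump_chainD(1) by (auto simp: hd_conv_nth)
    have "fst (hd C) < fst (hd C')" using Cons.prems(2) D(2) by simp
    then have "fst (C ! 0) < fst (C' ! 0)" unfolding h .
    moreover have "bump_domain f (fst (C' ! 0)) (snd (C' ! 0))" using bump_chainD(1,2)[OF C'] by blast
    ultimately have "fst D < fst (C' ! 0)"
      using bump_chain_before[OF assms C _ bump_chainD(5)[OF C'] _ i(1)] i bump_domainD(5)[OF assms] by blast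
    moreover have "fst (C' ! 0) \<le> fst D'"
    proof (cases j)
      case (Suc j')
      have "map fst C' ! 0 = fst (C' ! 0)" using j by (intro nth_map) auto
      with Suc show ?thesis using bump_chain_increasing[OF assms C'] j sorted_wrt_nth_less[of "(<)" "map fst C'" 0 j] by simp
    qed (use j in simp)
    ultimately show ?thesis by simp
  qed
  then show ?case using Cons bump_chain_increasing[OF assms C] by (auto simp: sorted_wrt_append)
qed simp

text \<open>After concatenation the division into chains is forgotten and all bump domains remain,
  from left to right. In this form f and g can be compared before anything is known about dyadic
  points under \<open>h\<close>.\<close>

lemma concat_chains_list:
  assumes "f \<in> thompson_F"
  shows "set (concat (chains_list f)) = {(a, b). bump_domain f a b}"
    "sorted_wrt (<) (map fst (concat (chains_list f)))"
proof -
  have f: "f \<in> PL_plus 0 1" using assms by (simp add: thompson_F_def)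
  note cl = chains_list[OF f]
  have "D \<in> set (concat (chains_list f)) \<longleftrightarrow> bump_domain f (fst D) (snd D)" for D
  proof
    assume "D \<in> set (concat (chains_list f))"
    then show "bump_domain f (fst D) (snd D)" using cl(1) by (auto simp: bump_chain_iff)
  next
    assume "bump_domain f (fst D) (snd D)"
    then obtain C i where "bump_chain f C" "i < length C" "C ! i = D"
      using bump_chain_exists[OF assms] by (metis prod.collapse)
    then show "D \<in> set (concat (chains_list f))" using cl(1) by auto
  qed
  note iff = this
  show "set (concat (chains_list f)) = {(a, b). bump_domain f a b}"
  proof (rule set_eqI)
    show "D \<in> set (concat (chains_list f)) \<longleftrightarrow> D \<in> {(a, b). bump_domain f a b}" for D
      unfolding iff by (simp add: case_prod_beta)
  qed
  have "sorted_wrt (<) (map (\<lambda>C. fst (hd C)) (chains_list f))"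
    using cl(2,3) strict_sorted_iff by blast
  then have "sorted_wrt (\<lambda>C C'. fst (hd C) < fst (hd C')) (chains_list f)" by (simp add: sorted_wrt_map)
  then show "sorted_wrt (<) (map fst (concat (chains_list f)))"
    using cl(1) by (intro concat_chains_increasing[OF f]) auto
qed

section \<open>Transport of bumps and chains by a conjugator\<close>

lemma conj_bump_domain:
  assumes "f \<in> PL_plus 0 1" "g \<in> PL_plus 0 1" "h \<in> PL_plus 0 1" "\<And>y. h (f y) = g (h y)"
  shows "bump_domain f a b \<longleftrightarrow> bump_domain g (h a) (h b)"
    "bump_domain f a b \<Longrightarrow> conj_between h f a b g (h a) (h b)"
proof -
  note f = PL_plus_01[OF assms(1)] and g = PL_plus_01[OF assms(2)] and h = PL_plus_01[OF assms(3)]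
  have fx: "g (h y) = h y \<longleftrightarrow> f y = y" for y
    using PL_realD(10)[OF h(1), of "f y" y] assms(4)[of y] by simp
  have "(\<forall>y. h a < y \<and> y < h b \<longrightarrow> g y \<noteq> y) \<longleftrightarrow> (\<forall>y. a < y \<and> y < b \<longrightarrow> f y \<noteq> y)"
  proof
    assume *: "\<forall>y. h a < y \<and> y < h b \<longrightarrow> g y \<noteq> y"
    show "\<forall>y. a < y \<and> y < b \<longrightarrow> f y \<noteq> y" using * PL_realD(8)[OF h(1)] fx by metis
  next
    assume *: "\<forall>y. a < y \<and> y < b \<longrightarrow> f y \<noteq> y"
    show "\<forall>y. h a < y \<and> y < h b \<longrightarrow> g y \<noteq> y"
      using * PL_realD(8)[OF h(1)] fx PL_realD(6)[OF h(1)] by metis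
  qed
  moreover have "0 \<le> h a \<longleftrightarrow> 0 \<le> a" "h b \<le> 1 \<longleftrightarrow> b \<le> 1" "h a < h b \<longleftrightarrow> a < b"
    using PL_realD(9)[OF h(1), of 0 a] PL_realD(9)[OF h(1), of b 1] PL_realD(8)[OF h(1), of a b] h by auto
  ultimately show "bump_domain f a b \<longleftrightarrow> bump_domain g (h a) (h b)"
    unfolding bump_domain_iff[OF assms(1)] bump_domain_iff[OF assms(2)] bump_def
    using fx f(1) g(1) by auto
  show "bump_domain f a b \<Longrightarrow> conj_between h f a b g (h a) (h b)"
    using h assms(4) by (simp add: conj_between_def)
qed

lemma bump_chain_map:
  assumes "\<And>a b. bump_domain f a b \<longleftrightarrow> bump_domain g (h a) (h b)" "inj h"
    and d: "\<And>x. dyadic (h x) \<longleftrightarrow> dyadic x"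
  shows "bump_chain g (map (map_prod h h) C) \<longleftrightarrow> bump_chain f C"
proof (cases "C = []")
  case False
  have "successively (\<lambda>D D'. snd D = fst D' \<and> \<not> dyadic (snd D)) (map (map_prod h h) C) \<longleftrightarrow>
      successively (\<lambda>D D'. snd D = fst D' \<and> \<not> dyadic (snd D)) C"
    unfolding successively_map using d assms(2) by (simp add: inj_eq)
  moreover have "(\<forall>D\<in>set (map (map_prod h h) C). bump_domain g (fst D) (snd D)) \<longleftrightarrow> (\<forall>D\<in>set C. bump_domain f (fst D) (snd D))"
    using assms(1) by auto
  ultimately show ?thesis using False d unfolding bump_chain_iff by (simp add: hd_map last_map)
qed (simp add: bump_chain_def)

text \<open>Both sides are sorted lists without repetition of the same set of chains.\<close>

lemma chains_list_map:
  assumes "f \<in> PL_plus 0 1" "g \<in> PL_plus 0 1" "h \<in> PL_plus 0 1" "\<And>y. h (f y) = g (h y)"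
    and "\<And>x. dyadic (h x) \<longleftrightarrow> dyadic x"
  shows "chains_list g = map (map (map_prod h h)) (chains_list f)"
proof -
  note h = PL_plus_01[OF assms(3)]
  note bd = conj_bump_domain(1)[OF assms(1-4)]
  note ch = bump_chain_map[OF bd PL_realD(4)[OF h(1)] assms(5)]
  note cf = chains_list[OF assms(1)] and cg = chains_list[OF assms(2)]
  let ?F = "map (map_prod h h)"
  have "C \<in> ?F ` {C. bump_chain f C}" if C: "bump_chain g C" for C
  proof -
    let ?B = "map (map_prod (inv h) (inv h)) C"
    have "map_prod h h (map_prod (inv h) (inv h) D) = D" for D
      by (cases D) (simp add: PL_realD(6)[OF h(1)])
    then have "?F ?B = C" unfolding map_map by (intro map_idI) simp
    then show ?thesis using C ch[of ?B] by (metis (mono_tags, lifting) imageI mem_Collect_eq)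
  qed
  then have img: "{C. bump_chain g C} = ?F ` {C. bump_chain f C}" using ch by auto
  have key: "map (\<lambda>C. fst (hd C)) (map ?F (chains_list f)) = map h (map (\<lambda>C. fst (hd C)) (chains_list f))"
    using cf(1) bump_chainD(1)[of f] by (auto simp: hd_map)
  have "sorted (map h xs)" if "sorted xs" for xs
    using that PL_realD(9)[OF h(1)] by (simp add: sorted_map)
  then have sorted: "sorted (map (\<lambda>C. fst (hd C)) (map ?F (chains_list f)))" unfolding key using cf(2) by blast
  have inj: "inj h" by (rule PL_realD(4)[OF h(1)])
  have distinct: "distinct (map (\<lambda>C. fst (hd C)) (map ?F (chains_list f)))"
    unfolding key by (subst distinct_map) (use cf(3) inj in \<open>auto intro: inj_on_subset\<close>)
  have sets: "set (chains_list g) = set (map ?F (chains_list f))" using cf(1) cg(1) img by simp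
  have "inj_on (\<lambda>C. fst (hd C)) (set (chains_list g) \<union> set (map ?F (chains_list f)))"
    unfolding sets[symmetric] cg(1) Un_absorb by (rule inj_on_bump_chain_key[OF assms(2)])
  from map_sorted_distinct_set_unique[OF this cg(2,3) sorted distinct sets] show ?thesis .
qed

section \<open>The invariant\<close>

text \<open>The exponents are negated for symmetry and added for transitivity.\<close>

lemma chain_rel_sym_trans:
  assumes "f \<in> PL_plus 0 1" "bump_chain f C"
  shows "(x, y) \<in> chain_rel f C \<Longrightarrow> (y, x) \<in> chain_rel f C"
    "(x, y) \<in> chain_rel f C \<Longrightarrow> (y, z) \<in> chain_rel f C \<Longrightarrow> (x, z) \<in> chain_rel f C"
proof -
  have pos: "lam f (C ! i) > 0" "mu f (C ! i) > 0" if "i < length C" for i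
    using chain_slopes(5,6)[OF bump_domainD(1)[OF assms(1) bump_chainD(2)[OF assms(2) that]]] by simp_all
  have C: "0 < length C" using bump_chainD(1)[OF assms(2)] by simp
  have flip: "s powi (- i) * q = t powi (- j) * p" if "s powi i * p = t powi j * q" "s > 0" "t > 0"
    for s t p q :: real and i j
    using that by (simp add: power_int_minus field_simps)
  have comp: "s powi (i + i') * p = t powi (j + j') * r"
    if 1: "s powi i * p = t powi j * q" and 2: "s powi i' * q = t powi j' * r" and "s > 0" "t > 0"
    for s t p q r :: real and i i' j j'
  proof -
    have "s powi (i + i') * p = s powi i' * (s powi i * p)" using that by (simp add: power_int_add)
    also have "\<dots> = t powi j * (s powi i' * q)" unfolding 1 by simp
    also have "\<dots> = t powi (j + j') * r" unfolding 2 using that by (simp add: power_int_add)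
    finally show ?thesis .
  qed
  show "(y, x) \<in> chain_rel f C" if xy: "(x, y) \<in> chain_rel f C"
  proof -
    obtain m n where *: "length x = length C" "length y = length C"
      "2 powi m * x ! 0 = lam f (C ! 0) powi n 0 * y ! 0"
      "\<And>i. Suc i < length C \<Longrightarrow> mu f (C ! i) powi n i * x ! Suc i = lam f (C ! Suc i) powi n (Suc i) * y ! Suc i"
      using xy unfolding chain_rel_def by blast
    have "2 powi (- m) * y ! 0 = lam f (C ! 0) powi (- n 0) * x ! 0"
      using flip[OF *(3)] pos C by simp
    moreover have "mu f (C ! i) powi (- n i) * y ! Suc i = lam f (C ! Suc i) powi (- n (Suc i)) * x ! Suc i"
      if "Suc i < length C" for i
      using flip[OF *(4)[OF that]] pos that by simp
    ultimately show ?thesis unfolding chain_rel_def using *(1,2)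
      by (intro CollectI case_prodI conjI exI[of _ "- m"] exI[of _ "\<lambda>i. - n i"]) auto
  qed
  show "(x, z) \<in> chain_rel f C" if xy: "(x, y) \<in> chain_rel f C" and yz: "(y, z) \<in> chain_rel f C"
  proof -
    obtain m n where *: "length x = length C" "length y = length C"
      "2 powi m * x ! 0 = lam f (C ! 0) powi n 0 * y ! 0"
      "\<And>i. Suc i < length C \<Longrightarrow> mu f (C ! i) powi n i * x ! Suc i = lam f (C ! Suc i) powi n (Suc i) * y ! Suc i"
      using xy unfolding chain_rel_def by blast
    obtain m' n' where **: "length z = length C"
      "2 powi m' * y ! 0 = lam f (C ! 0) powi n' 0 * z ! 0"
      "\<And>i. Suc i < length C \<Longrightarrow> mu f (C ! i) powi n' i * y ! Suc i = lam f (C ! Suc i) powi n' (Suc i) * z ! Suc i"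
      using yz unfolding chain_rel_def by blast
    have "2 powi (m + m') * x ! 0 = lam f (C ! 0) powi (n 0 + n' 0) * z ! 0"
      using comp[OF *(3) **(2)] pos C by simp
    moreover have "mu f (C ! i) powi (n i + n' i) * x ! Suc i = lam f (C ! Suc i) powi (n (Suc i) + n' (Suc i)) * z ! Suc i"
      if "Suc i < length C" for i
      using comp[OF *(4)[OF that] **(3)[OF that]] pos that by simp
    ultimately show ?thesis unfolding chain_rel_def using *(1) **(1)
      by (intro CollectI case_prodI conjI exI[of _ "m + m'"] exI[of _ "\<lambda>i. n i + n' i"]) auto
  qed
qed

lemma chain_rel_refl: "length x = length C \<Longrightarrow> (x, x) \<in> chain_rel f C"
  unfolding chain_rel_def by (intro CollectI case_prodI conjI exI[of _ 0] exI[of _ "\<lambda>_. 0"]) auto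

lemma length_chain_vec [simp]: "length (chain_vec f C) = length C"
  by (simp add: chain_vec_def)

definition chain_class :: "(real \<Rightarrow> real) \<Rightarrow> (real \<times> real) list \<Rightarrow> real list set" where
  "chain_class f C = chain_rel f C `` {chain_vec f C}"

lemma Delta_chains_list: "Delta f = map (chain_class f) (chains_list f)"
  by (simp add: Delta_def chains_list_def chain_class_def)

lemma chain_class_eq_iff:
  assumes "f \<in> PL_plus 0 1" "bump_chain f C" "chain_rel g C' = chain_rel f C" "length C' = length C"
  shows "chain_class f C = chain_class g C' \<longleftrightarrow> (chain_vec g C', chain_vec f C) \<in> chain_rel f C"
proof -
  note st = chain_rel_sym_trans[OF assms(1,2)]
  have "(chain_vec g C', chain_vec g C') \<in> chain_rel f C" using assms(4) by (simp add: chain_rel_refl)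
  then have "chain_rel f C `` {chain_vec f C} = chain_rel f C `` {chain_vec g C'} \<longleftrightarrow>
      (chain_vec g C', chain_vec f C) \<in> chain_rel f C"
    using st by blast
  then show ?thesis unfolding chain_class_def assms(3) .
qed

lemma chain_vec_nth:
  assumes "C \<noteq> []"
  shows "chain_vec f C ! 0 = alpha f (C ! 0) / width (C ! 0)"
    "Suc i < length C \<Longrightarrow> chain_vec f C ! Suc i =
       alpha f (C ! Suc i) / width (C ! Suc i) * (width (C ! i) / beta f (C ! i))"
proof -
  have *: "j < length C \<Longrightarrow> chain_vec f C ! j = alpha f (C ! j) / width (C ! j)
       * (if j = 0 then 1 else width (C ! (j - 1)) / beta f (C ! (j - 1)))" for j
    by (simp add: chain_vec_def)
  show "chain_vec f C ! 0 = alpha f (C ! 0) / width (C ! 0)" using *[of 0] assms by simp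
  show "Suc i < length C \<Longrightarrow> chain_vec f C ! Suc i =
       alpha f (C ! Suc i) / width (C ! Suc i) * (width (C ! i) / beta f (C ! i))" using *[of "Suc i"] by simp
qed

lemma chain_pos:
  assumes "f \<in> PL_plus 0 1" "bump_chain f C" "i < length C"
  shows "alpha f (C ! i) > 0" "beta f (C ! i) > 0" "width (C ! i) > 0"
proof -
  note b = bump_domainD[OF assms(1) bump_chainD(2)[OF assms(2,3)]]
  show "alpha f (C ! i) > 0" "beta f (C ! i) > 0" using chain_slopes(7,8)[OF b(1)] by simp_all
  show "width (C ! i) > 0" using b(4) by (simp add: width_def case_prod_beta)
qed

text \<open>The relation between the two vectors says that the slopes which the bumpwise conjugators
  prescribe start with a power of 2 and match at the inner end points of the chain.\<close>

lemma chain_slopes_iff: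
  assumes "f \<in> PL_plus 0 1" "g \<in> PL_plus 0 1" "bump_chain f C" "bump_chain g C'" "length C' = length C"
    and R: "\<And>i. i < length C \<Longrightarrow> R i = alpha f (C ! i) / width (C ! i) * (width (C' ! i) / alpha g (C' ! i)) * lam f (C ! i) powi n i"
    and S: "\<And>i. i < length C \<Longrightarrow> S i = beta f (C ! i) / width (C ! i) * (width (C' ! i) / beta g (C' ! i)) * mu f (C ! i) powi n i"
  shows "t = R 0 \<longleftrightarrow> t * chain_vec g C' ! 0 = lam f (C ! 0) powi n 0 * chain_vec f C ! 0"
    "Suc i < length C \<Longrightarrow> S i = R (Suc i) \<longleftrightarrow>
      mu f (C ! i) powi n i * chain_vec g C' ! Suc i = lam f (C ! Suc i) powi n (Suc i) * chain_vec f C ! Suc i"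
proof -
  note p = chain_pos[OF assms(1,3)] and p' = chain_pos[OF assms(2,4), unfolded assms(5)]
  have ne: "C \<noteq> []" "C' \<noteq> []" using bump_chainD(1) assms by auto
  have alg1: "t = A / w * (w' / A') * l \<longleftrightarrow> t * (A' / w') = l * (A / w)"
    if "A > 0" "w > 0" "A' > 0" "w' > 0" for A w A' w' l :: real
    using that by (auto simp: field_simps)
  have alg2: "B / w * (w' / B') * m = A / v * (v' / A') * l \<longleftrightarrow> m * (A' / v' * (w' / B')) = l * (A / v * (w / B))"
    if "B > 0" "w > 0" "B' > 0" "w' > 0" "A > 0" "v > 0" "A' > 0" "v' > 0"
    for A B A' B' v w v' w' l m :: real
    using that by (simp add: field_simps)
  show "t = R 0 \<longleftrightarrow> t * chain_vec g C' ! 0 = lam f (C ! 0) powi n 0 * chain_vec f C ! 0"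
    unfolding chain_vec_nth(1)[OF ne(1)] chain_vec_nth(1)[OF ne(2)]
    using R[of 0] alg1[of "alpha f (C ! 0)" "width (C ! 0)" "alpha g (C' ! 0)" "width (C' ! 0)"] p[of 0] p'[of 0] ne
    by simp
  show "S i = R (Suc i) \<longleftrightarrow>
      mu f (C ! i) powi n i * chain_vec g C' ! Suc i = lam f (C ! Suc i) powi n (Suc i) * chain_vec f C ! Suc i"
    if i: "Suc i < length C"
  proof -
    have i': "i < length C" "Suc i < length C'" using i assms(5) by auto
    show ?thesis
      unfolding chain_vec_nth(2)[OF ne(1) i] chain_vec_nth(2)[OF ne(2) i'(2)] S[OF i'(1)] R[OF i]
      by (rule alg2) (use p[of i] p[of "Suc i"] p'[of i] p'[of "Suc i"] i in auto)
  qed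
qed

text \<open>Only \<open>lam\<close> and \<open>mu\<close> occur in the relation, and these are
  conjugacy invariants by \<open>lam_mu_conj\<close>; so classes for f and for g can be compared at
  all.\<close>

lemma chain_rel_map:
  assumes "f \<in> PL_plus 0 1" "g \<in> PL_plus 0 1" "h \<in> PL_plus 0 1" "\<And>y. h (f y) = g (h y)"
    and "bump_chain f C"
  shows "chain_rel g (map (map_prod h h) C) = chain_rel f C"
proof -
  have "lam g (map (map_prod h h) C ! i) = lam f (C ! i)" "mu g (map (map_prod h h) C ! i) = mu f (C ! i)"
    if i: "i < length C" for i
  proof -
    obtain a b where ab: "C ! i = (a, b)" by force
    have bd: "bump_domain f a b" using bump_chainD(2)[OF assms(5) i] ab by simp
    note cj = conj_bump_domain[OF assms(1-4)]
    have "bump g (h a) (h b)" using bump_domainD(1)[OF assms(2)] cj(1) bd by blast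
    from lam_mu_conj[OF bump_domainD(1)[OF assms(1) bd] this cj(2)[OF bd]]
    show "lam g (map (map_prod h h) C ! i) = lam f (C ! i)" "mu g (map (map_prod h h) C ! i) = mu f (C ! i)"
      using i ab by simp_all
  qed
  moreover have "0 < length C" using bump_chainD(1)[OF assms(5)] by simp
  ultimately show ?thesis unfolding chain_rel_def by (auto simp: Suc_lessD)
qed

lemma conj_slopes_param_chain:
  assumes "f \<in> PL_plus 0 1" "g \<in> PL_plus 0 1" "h \<in> PL_plus 0 1" "\<And>y. h (f y) = g (h y)"
    and "bump_domain f (fst D) (snd D)"
  shows "\<exists>n. right_slope h (fst D) = alpha f D / width D * (width (map_prod h h D) / alpha g (map_prod h h D)) * lam f D powi n
     \<and> left_slope h (snd D) = beta f D / width D * (width (map_prod h h D) / beta g (map_prod h h D)) * mu f D powi n"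
    "\<exists>k. conj_between k f (fst D) (snd D) g (h (fst D)) (h (snd D)) \<and>
      right_slope k (fst D) = alpha f D / width D * (width (map_prod h h D) / alpha g (map_prod h h D)) * lam f D powi j
     \<and> left_slope k (snd D) = beta f D / width D * (width (map_prod h h D) / beta g (map_prod h h D)) * mu f D powi j"
proof -
  obtain a b where D: "D = (a, b)" by force
  then have bd: "bump_domain f a b" using assms(5) by simp
  note cj = conj_bump_domain[OF assms(1-4)]
  have g: "bump g (h a) (h b)" using bump_domainD(1)[OF assms(2)] cj(1) bd by blast
  note f = bump_domainD(1)[OF assms(1) bd]
  show "\<exists>n. right_slope h (fst D) = alpha f D / width D * (width (map_prod h h D) / alpha g (map_prod h h D)) * lam f D powi n
     \<and> left_slope h (snd D) = beta f D / width D * (width (map_prod h h D) / beta g (map_prod h h D)) * mu f D powi n"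
    by (rule conj_slopes_param[OF f g cj(2)[OF bd]]) (auto simp: D width_def)
  show "\<exists>k. conj_between k f (fst D) (snd D) g (h (fst D)) (h (snd D)) \<and>
      right_slope k (fst D) = alpha f D / width D * (width (map_prod h h D) / alpha g (map_prod h h D)) * lam f D powi j
     \<and> left_slope k (snd D) = beta f D / width D * (width (map_prod h h D) / beta g (map_prod h h D)) * mu f D powi j"
    by (rule conj_slopes_param_exists[OF f g cj(2)[OF bd], of j]) (auto simp: D width_def)
qed

section \<open>From conjugacy in F to equal invariants\<close>

text \<open>An element of F has a power of 2 as right slope at the start of a chain and no node at
  the nondyadic inner ends. By \<open>chain_slopes_iff\<close> these facts are the equations of the
  relation, with the exponents of \<open>conj_slopes_param\<close>.\<close>

lemma Delta_eq_if_conj: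
  assumes "f \<in> thompson_F" "g \<in> thompson_F" "h \<in> thompson_F" "\<And>y. h (f y) = g (h y)"
  shows "Delta f = Delta g"
proof -
  have P: "f \<in> PL_plus 0 1" "g \<in> PL_plus 0 1" "h \<in> PL_plus 0 1" using assms by (auto simp: thompson_F_def)
  have germ: "dyadic_germ h x" for x by (rule thompson_F_imp_dyadic_germ[OF assms(3)])
  then have d: "dyadic (h x) \<longleftrightarrow> dyadic x" for x by (simp add: dyadic_germ_def)
  let ?F = "map (map_prod h h)"
  have "chain_class g (?F C) = chain_class f C" if C: "bump_chain f C" for C
  proof -
    have C': "bump_chain g (?F C)"
      using bump_chain_map[OF conj_bump_domain(1)[OF P assms(4)] PL_realD(4)[OF PL_plus_01(1)[OF P(3)]] d] C by blast
    have "\<forall>i\<in>{..<length C}. \<exists>n. right_slope h (fst (C ! i)) = alpha f (C ! i) / width (C ! i) * (width (?F C ! i) / alpha g (?F C ! i)) * lam f (C ! i) powi n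
     \<and> left_slope h (snd (C ! i)) = beta f (C ! i) / width (C ! i) * (width (?F C ! i) / beta g (?F C ! i)) * mu f (C ! i) powi n"
    proof
      fix i assume "i \<in> {..<length C}"
      then show "\<exists>n. right_slope h (fst (C ! i)) = alpha f (C ! i) / width (C ! i) * (width (?F C ! i) / alpha g (?F C ! i)) * lam f (C ! i) powi n
     \<and> left_slope h (snd (C ! i)) = beta f (C ! i) / width (C ! i) * (width (?F C ! i) / beta g (?F C ! i)) * mu f (C ! i) powi n"
        using conj_slopes_param_chain(1)[OF P assms(4) bump_chainD(2)[OF C, of i]] by simp
    qed
    from bchoice[OF this] obtain n where
      n: "\<And>i. i < length C \<Longrightarrow> right_slope h (fst (C ! i)) = alpha f (C ! i) / width (C ! i) * (width (?F C ! i) / alpha g (?F C ! i)) * lam f (C ! i) powi n i"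
       "\<And>i. i < length C \<Longrightarrow> left_slope h (snd (C ! i)) = beta f (C ! i) / width (C ! i) * (width (?F C ! i) / beta g (?F C ! i)) * mu f (C ! i) powi n i"
      by auto
    note iff = chain_slopes_iff[OF P(1,2) C C' length_map n]
    obtain m :: int where m: "right_slope h (fst (C ! 0)) = 2 powi m"
      using germ[of "fst (C ! 0)"] by (auto simp: dyadic_germ_def dyadic_slopes_def pow2_def)
    have "left_slope h (snd (C ! i)) = right_slope h (fst (C ! Suc i))" if "Suc i < length C" for i
      using germ[of "snd (C ! i)"] bump_chainD(3,4)[OF C that] by (auto simp: dyadic_germ_def dyadic_slopes_def)
    then have "(chain_vec g (?F C), chain_vec f C) \<in> chain_rel f C"
      unfolding chain_rel_def using iff(1)[of "2 powi m"] iff(2) m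
      by (intro CollectI case_prodI conjI exI[of _ m] exI[of _ n]) auto
    then show ?thesis
      using chain_class_eq_iff[OF P(1) C chain_rel_map[OF P assms(4) C]] by simp
  qed
  moreover have "set (chains_list f) = {C. bump_chain f C}" by (rule chains_list(1)[OF P(1)])
  ultimately show ?thesis
    unfolding Delta_chains_list chains_list_map[OF P assms(4) d] by simp
qed

section \<open>Construction of a conjugator in F\<close>

text \<open>Every bump belongs to a chain, and the outer ends of a chain are dyadic.\<close>

lemma nondyadic_end_inner:
  assumes "f \<in> thompson_F" "x \<in> bump_ends f" "\<not> dyadic x"
  obtains C i where "bump_chain f C" "Suc i < length C" "x = snd (C ! i)"
proof -
  have "x \<noteq> 0" "x \<noteq> 1" using assms(3) by auto
  then obtain q where "bump_domain f x q \<or> bump_domain f q x" using assms(2) by (auto simp: bump_ends_def)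
  then show ?thesis
  proof
    assume "bump_domain f x q"
    then obtain C i where C: "bump_chain f C" "i < length C" "C ! i = (x, q)" using bump_chain_exists[OF assms(1)] by metis
    have "i \<noteq> 0" using bump_chainD(5)[OF C(1)] C(3) assms(3) by (metis fst_conv)
    then obtain j where j: "i = Suc j" by (cases i) auto
    then have "snd (C ! j) = x" using bump_chainD(3)[OF C(1), of j] C by simp
    then show ?thesis using C j that by blast
  next
    assume "bump_domain f q x"
    then obtain C i where C: "bump_chain f C" "i < length C" "C ! i = (q, x)" using bump_chain_exists[OF assms(1)] by metis
    have "Suc i \<noteq> length C" using bump_chainD(6)[OF C(1), of i] C(3) assms(3) by auto
    then show ?thesis using C that[of C i] by simp
  qed
qed

lemma bump_chain_first_le:
  assumes "f \<in> PL_plus 0 1" "bump_chain f C" "i < length C" shows "fst (C ! 0) \<le> fst (C ! i)"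
proof (cases i)
  case (Suc j)
  have "map fst C ! 0 < map fst C ! i"
    using bump_chain_increasing[OF assms(1,2)] assms(3) Suc by (intro sorted_wrt_nth_less) auto
  moreover have "map fst C ! 0 = fst (C ! 0)" using assms(3) by (intro nth_map) auto
  ultimately show ?thesis using assms(3) by simp
qed simp

text \<open>The one-sided slopes at x are attained at all nearby points of that side, and finitely
  many exceptions can be avoided.\<close>

lemma pow2_slopes_closure:
  assumes "H \<in> PL_real" "finite E" "u < x" "x < v" "\<And>y. u < y \<Longrightarrow> y < v \<Longrightarrow> y \<notin> E \<Longrightarrow> dyadic_germ H y"
  shows "pow2 (left_slope H x)" "pow2 (right_slope H x)"
proof -
  obtain e where e: "e > 0"
    "\<And>z. x - e < z \<Longrightarrow> z < x \<Longrightarrow> left_slope H z = left_slope H x \<and> right_slope H z = left_slope H x"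
    "\<And>z. x < z \<Longrightarrow> z < x + e \<Longrightarrow> left_slope H z = right_slope H x \<and> right_slope H z = right_slope H x"
    using slopes_near[OF assms(1)] by blast
  have "infinite ({max u (x - e)<..<x} - E)" "infinite ({x<..<min v (x + e)} - E)"
    using e(1) assms(2-4) by (auto intro!: Diff_infinite_finite)
  then obtain z w where "z \<in> {max u (x - e)<..<x} - E" "w \<in> {x<..<min v (x + e)} - E"
    by (metis all_not_in_conv finite.emptyI)
  then show "pow2 (left_slope H x)" "pow2 (right_slope H x)"
    using e(2)[of z] e(3)[of w] assms(5)[of z] assms(5)[of w] assms(3,4)
    by (auto simp: dyadic_germ_def dyadic_slopes_def)
qed

text \<open>Of \<open>h\<close> only the values at bump ends survive. On a bump domain it is
  replaced by \<open>k\<close>, on an interval of fixed points by any map with dyadic germs. The two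
  assumptions relating chains of f and g ensure that \<open>h\<close> maps dyadic ends, and only
  these, to dyadic points.\<close>

lemma build_conjugator:
  assumes F: "f \<in> thompson_F" "g \<in> thompson_F" and h: "h \<in> PL_plus 0 1" "\<And>y. h (f y) = g (h y)"
    and k: "\<And>a b. bump_domain f a b \<Longrightarrow> conj_between (k a b) f a b g (h a) (h b)"
    and chain: "\<And>C. bump_chain f C \<Longrightarrow> bump_chain g (map (map_prod h h) C)"
    and chain': "\<And>C'. bump_chain g C' \<Longrightarrow> \<exists>C. bump_chain f C \<and> C' = map (map_prod h h) C"
    and start: "\<And>C. bump_chain f C \<Longrightarrow> pow2 (right_slope (k (fst (C ! 0)) (snd (C ! 0))) (fst (C ! 0)))"
    and match: "\<And>C i. bump_chain f C \<Longrightarrow> Suc i < length C \<Longrightarrow>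
      left_slope (k (fst (C ! i)) (snd (C ! i))) (snd (C ! i)) =
      right_slope (k (fst (C ! Suc i)) (snd (C ! Suc i))) (fst (C ! Suc i))"
  obtains H where "H \<in> thompson_F" "\<And>y. H (f y) = g (H y)"
proof -
  have P: "f \<in> PL_plus 0 1" "g \<in> PL_plus 0 1" using F by (auto simp: thompson_F_def)
  note f = PL_plus_01[OF P(1)] and g = PL_plus_01[OF P(2)] and h' = PL_plus_01[OF h(1)]
  note cj = conj_bump_domain[OF P h]
  have germ: "dyadic_germ f x" "dyadic_germ g x" for x using thompson_F_imp_dyadic_germ F by auto
  define E where "E = bump_ends f"
  have E: "finite E" "0 \<in> E" "1 \<in> E" "E \<subseteq> {0..1}"
  proof -
    show "finite E" unfolding E_def by (rule finite_bump_ends[OF P(1)])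
    show "0 \<in> E" "1 \<in> E" by (simp_all add: E_def bump_ends_def)
    show "E \<subseteq> {0..1}" unfolding E_def using bump_endsD(1,2)[OF P(1)] by (meson atLeastAtMost_iff subsetI)
  qed
  have hE: "h x \<in> bump_ends g" if "x \<in> E" for x
    using that h' cj(1) unfolding E_def bump_ends_def by blast
  \<comment> \<open>A nondyadic end is an inner end of a chain, and \<open>h\<close> matches chains
    with chains in both directions.\<close>
  have dE: "dyadic (h x) \<longleftrightarrow> dyadic x" if x: "x \<in> E" for x
  proof
    assume hx: "dyadic (h x)"
    show "dyadic x"
    proof (rule ccontr)
      assume "\<not> dyadic x"
      then obtain C i where C: "bump_chain f C" "Suc i < length C" "x = snd (C ! i)"
        using nondyadic_end_inner[OF F(1)] x unfolding E_def by metis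
      then show False using bump_chainD(4)[OF chain[OF C(1)], of i] hx by simp
    qed
  next
    assume dx: "dyadic x"
    show "dyadic (h x)"
    proof (rule ccontr)
      assume "\<not> dyadic (h x)"
      then obtain C' i where C': "bump_chain g C'" "Suc i < length C'" "h x = snd (C' ! i)"
        using nondyadic_end_inner[OF F(2)] hE[OF x] by metis
      obtain C where C: "bump_chain f C" "C' = map (map_prod h h) C" using chain'[OF C'(1)] by blast
      have "x = snd (C ! i)" using C' C PL_realD(10)[OF h'(1)] by simp
      then show False using bump_chainD(4)[OF C(1), of i] C' C dx by simp
    qed
  qed
  \<comment> \<open>An interval of fixed points has dyadic ends, since a nondyadic end would have
    bumps on both sides.\<close>
  have fixed: "\<exists>K. K \<in> PL_real \<and> K u = h u \<and> K v = h v \<and> (\<forall>x. u < x \<and> x < v \<longrightarrow> dyadic_germ K x)"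
    if uv: "adjacent E u v" "\<not> bump_domain f u v" for u v
  proof -
    have fx: "f x = x" if "u \<le> x" "x \<le> v" for x
      using adjacent_bump_or_fixed[OF P(1)] uv that unfolding E_def by blast
    have uvE: "u \<in> E" "v \<in> E" "u < v" using uv by (auto simp: adjacent_def)
    have no: False if "bump_domain f a b" "max a u < min b v" for a b
    proof -
      define z where "z = (max a u + min b v) / 2"
      have "max a u < z" "z < min b v" using that by (auto simp: z_def)
      then show False using bump_domainD(7)[OF P(1) that(1), of z] fx[of z] by auto
    qed
    have "dyadic u"
    proof (rule ccontr)
      assume "\<not> dyadic u"
      then obtain C i where C: "bump_chain f C" "Suc i < length C" "u = snd (C ! i)"
        using nondyadic_end_inner[OF F(1)] uvE unfolding E_def by metis
      then have "u = fst (C ! Suc i)" using bump_chainD(3)[OF C(1)] by simp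
      then show False using no[OF bump_chainD(2)[OF C(1,2)]] uvE bump_domainD(4)[OF P(1) bump_chainD(2)[OF C(1,2)]] by simp
    qed
    moreover have "dyadic v"
    proof (rule ccontr)
      assume "\<not> dyadic v"
      then obtain C i where C: "bump_chain f C" "Suc i < length C" "v = snd (C ! i)"
        using nondyadic_end_inner[OF F(1)] uvE unfolding E_def by metis
      have i: "i < length C" using C by simp
      show False using no[OF bump_chainD(2)[OF C(1) i]] uvE C bump_domainD(4)[OF P(1) bump_chainD(2)[OF C(1) i]] by simp
    qed
    moreover have "h u < h v" using PL_realD(8)[OF h'(1)] uvE by simp
    ultimately show ?thesis using dyadic_map_exists[of u v "h u" "h v"] dE uvE by metis
  qed
  define K where "K = (\<lambda>u v. if bump_domain f u v then k u v else
     SOME K. K \<in> PL_real \<and> K u = h u \<and> K v = h v \<and> (\<forall>x. u < x \<and> x < v \<longrightarrow> dyadic_germ K x))"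
  have Kfix: "K u v \<in> PL_real \<and> K u v u = h u \<and> K u v v = h v \<and> (\<forall>x. u < x \<and> x < v \<longrightarrow> dyadic_germ (K u v) x)"
    if "adjacent E u v" "\<not> bump_domain f u v" for u v
    using someI_ex[OF fixed[OF that]] that(2) by (simp add: K_def)
  have Kb: "K u v = k u v" if "bump_domain f u v" for u v using that by (simp add: K_def)
  have KE: "K u v \<in> PL_real \<and> K u v u = h u \<and> K u v v = h v" if "adjacent E u v" for u v
    using Kfix[OF that] Kb[of u v] conj_betweenD(1-3)[OF k, of u v] by (cases "bump_domain f u v") auto
  obtain H where H: "H \<in> PL_plus 0 1" "\<And>u v x. adjacent E u v \<Longrightarrow> u \<le> x \<Longrightarrow> x \<le> v \<Longrightarrow> H x = K u v x"
    using glue_pieces[OF E h'(2,3) KE] by blast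
  note HP = PL_plus_01[OF H(1)]
  have adj: "adjacent E a b" if "bump_domain f a b" for a b
    using bump_domain_adjacent[OF P(1) that] by (simp add: E_def)
  have HE: "H x = h x" if x: "x \<in> E" for x
  proof (cases "x = 0")
    case False
    then have "0 < x" using x E(4) by force
    then obtain w where w: "adjacent E w x" using adjacent_pred[OF E(1) x E(2)] by blast
    then have "H x = K w x x" using H(2)[OF w, of x] by (simp add: adjacent_def)
    then show ?thesis using KE[OF w] by simp
  qed (use HP h' in simp)
  have Hb: "conj_between H f a b g (h a) (h b)" "right_slope H a = right_slope (k a b) a"
    "left_slope H b = left_slope (k a b) b" if bd: "bump_domain f a b" for a b
  proof -
    note kD = conj_betweenD[OF k[OF bd]] and bD = bump_domainD[OF P(1) bd]
    have eq: "H x = k a b x" if "a \<le> x" "x \<le> b" for x using H(2)[OF adj[OF bd] that] Kb[OF bd] by simp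
    show "conj_between H f a b g (h a) (h b)"
      unfolding conj_between_def using HP(1) eq kD bD bump_mem[OF f(1) bD(5,6)] by simp
    show "right_slope H a = right_slope (k a b) a"
      by (rule right_slope_cong[OF bD(4) _ kD(1)]) (use eq in auto)
    show "left_slope H b = left_slope (k a b) b"
      by (rule left_slope_cong[OF bD(4) _ kD(1)]) (use eq in auto)
  qed
  have conj: "H (f y) = g (H y)" for y
  proof (cases "0 < y \<and> y < 1")
    case False
    then have "f y = y" "H y = y" "g y = y" using f(4) HP(4) g(4) by auto
    then show ?thesis by simp
  next
    case True
    show ?thesis
    proof (cases "f y = y")
      case True
      have "g (h x) = h x" if "f x = x" for x using h(2)[of x] that by simp
      \<comment> \<open>H need not equal \<open>h\<close> at y, but both have the same image on an
        interval of fixed points, so H y is the image under \<open>h\<close> of some fixed point of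
        f and is fixed by g.\<close>
      have "\<exists>x. H y = h x \<and> f x = x"
      proof (cases "y \<in> E")
        case False
        obtain s t where st: "adjacent E s t" "s < y" "y < t"
          using adjacent_cover[OF E(1-3) _ _ False] \<open>0 < y \<and> y < 1\<close> by blast
        have "\<not> bump_domain f s t" using bump_domainD(7)[OF P(1), of s t y] st True by blast
        then have fx: "f x = x" if "s \<le> x" "x \<le> t" for x
          using adjacent_bump_or_fixed[OF P(1)] st that unfolding E_def by blast
        have "H s \<le> H y" "H y \<le> H t" using PL_realD(9)[OF HP(1)] st by auto
        then have "h s \<le> H y" "H y \<le> h t" using HE st by (auto simp: adjacent_def)
        then have "s \<le> inv h (H y)" "inv h (H y) \<le> t" using PL_real_inv_less[OF h'(1)] by auto
        then show ?thesis using fx PL_realD(6)[OF h'(1)] by metis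
      qed (use HE True in auto)
      then show ?thesis using True \<open>\<And>x. f x = x \<Longrightarrow> g (h x) = h x\<close> by metis
    next
      case False
      obtain a b where ab: "bump_domain f a b" "a < y" "y < b" using bump_domain_exists[OF P(1) False] .
      then show ?thesis using conj_betweenD(4)[OF Hb(1)[OF ab(1)], of y] by simp
    qed
  qed
  \<comment> \<open>Induction along the chain: the germ at the start is dyadic,
    \<open>dyadic_germ_propagate\<close> carries this over each bump, and the matching slopes carry
    it past each inner end.\<close>
  have claim: "dyadic_germ H x" if C: "bump_chain f C" and i: "i < length C" and x: "fst (C ! 0) < x" "x < snd (C ! i)" for C i x
    using i x
  proof (induction i arbitrary: x)
    case 0
    let ?a = "fst (C ! 0)" and ?b = "snd (C ! 0)"
    have bd: "bump_domain f ?a ?b" using bump_chainD(2)[OF C 0(1)] .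
    note bD = bump_domainD[OF P(1) bd]
    obtain e where e: "affine_start H ?a e" using affine_start_exists[OF HP(1) bD(4)] by metis
    have aE: "?a \<in> E" using bd by (auto simp: E_def bump_ends_def)
    have da: "dyadic ?a" "dyadic (H ?a)" using bump_chainD(5)[OF C] HE[OF aE] dE[OF aE] by auto
    have p2: "pow2 (right_slope H ?a)" using start[OF C] Hb(2)[OF bd] by simp
    have near: "dyadic_germ H y" if y: "?a < y" "y < ?a + e" for y
    proof -
      have "left_slope H y = right_slope H ?a" "right_slope H y = right_slope H ?a"
        using no_jump_affine(2,3)[OF HP(1), of ?a "?a + e" y] e y by (auto simp: affine_start_def)
      moreover have "H y = H ?a + right_slope H ?a * (y - ?a)"
        using affine_startD[OF e, of "y - ?a"] y by simp
      moreover have "dyadic (H ?a + right_slope H ?a * (y - ?a)) \<longleftrightarrow> dyadic y"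
        using dyadic_add_cancel(2)[OF da(2)] dyadic_pow2_mult[OF p2] dyadic_add_cancel(3)[OF da(1)] by simp
      ultimately show ?thesis using p2 by (simp add: dyadic_germ_def dyadic_slopes_def)
    qed
    show ?case
      by (rule dyadic_germ_propagate[OF bD(1) Hb(1)[OF bd] g(1) germ _ near, of e])
        (use 0 e in \<open>auto simp: affine_start_def\<close>)
  next
    case (Suc i)
    let ?a = "fst (C ! 0)" and ?b = "snd (C ! i)" and ?c = "snd (C ! Suc i)"
    have i: "i < length C" using Suc by simp
    have bdi: "bump_domain f (fst (C ! i)) ?b" using bump_chainD(2)[OF C i] .
    have b: "?b = fst (C ! Suc i)" "\<not> dyadic ?b" using bump_chainD(3,4)[OF C Suc.prems(1)] by auto
    have bd: "bump_domain f ?b ?c" using bump_chainD(2)[OF C Suc.prems(1)] b(1) by simp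
    note bD = bump_domainD[OF P(1) bd]
    have ab: "?a < ?b" using bump_chain_first_le[OF P(1) C i] bump_domainD(4)[OF P(1) bdi] by simp
    have left: "dyadic_germ H y" if "?a < y" "y < ?b" for y using Suc.IH[OF i that] .
    have eq: "left_slope H ?b = right_slope H ?b"
      using Hb(3)[OF bdi] Hb(2)[OF bd] match[OF C Suc.prems(1)] b(1) by simp
    obtain e where e: "e > 0"
      "\<And>z. ?b - e < z \<Longrightarrow> z < ?b \<Longrightarrow> left_slope H z = left_slope H ?b \<and> right_slope H z = left_slope H ?b"
      "\<And>z. ?b < z \<Longrightarrow> z < ?b + e \<Longrightarrow> left_slope H z = right_slope H ?b \<and> right_slope H z = right_slope H ?b"
      using slopes_near[OF HP(1)] by blast
    have p2: "pow2 (left_slope H ?b)"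
    proof -
      define z where "z = (max ?a (?b - e) + ?b) / 2"
      have "max ?a (?b - e) < z" "z < ?b" using ab e(1) by (auto simp: z_def)
      then show ?thesis using left[of z] e(2)[of z] by (auto simp: dyadic_germ_def dyadic_slopes_def)
    qed
    have sl: "dyadic_slopes H y" if y: "?a < y" "y < ?b + e" for y
    proof (cases y ?b rule: linorder_cases)
      case less
      then show ?thesis using left[of y] y by (simp add: dyadic_germ_def)
    next
      case equal
      then show ?thesis using p2 eq by (simp add: dyadic_slopes_def)
    next
      case greater
      then show ?thesis using e(3)[of y] y p2 eq by (simp add: dyadic_slopes_def)
    qed
    \<comment> \<open>The inner end \<open>?b\<close> is not dyadic, so the base point for
      \<open>dyadic_slopes_imp_germ\<close> is taken to its left.\<close>
    obtain x0 where x0: "dyadic x0" "?a < x0" "x0 < ?b" using dyadic_dense[OF ab] by blast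
    have "dyadic (H x0)" using left[of x0] x0 by (simp add: dyadic_germ_def)
    have near: "dyadic_germ H y" if "?a < y" "y < ?b + e" for y
      by (rule dyadic_slopes_imp_germ[OF HP(1) sl]) (use that x0 e(1) \<open>dyadic (H x0)\<close> in auto)
    show ?case
    proof (cases "x < ?b + e")
      case True
      then show ?thesis using near Suc.prems by simp
    next
      case False
      show ?thesis
        by (rule dyadic_germ_propagate[OF bD(1) Hb(1)[OF bd] g(1) germ e(1)])
          (use near ab e False Suc.prems in auto)
    qed
  qed
  have generic: "dyadic_germ H x" if x: "0 < x" "x < 1" "x \<notin> E" for x
  proof -
    obtain s t where st: "adjacent E s t" "s < x" "x < t" using adjacent_cover[OF E(1-3) x] .
    show ?thesis
    proof (cases "bump_domain f s t")
      case True
      then obtain C i where C: "bump_chain f C" "i < length C" "C ! i = (s, t)"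
        using bump_chain_exists[OF F(1)] by metis
      then show ?thesis using claim[OF C(1,2), of x] bump_chain_first_le[OF P(1) C(1,2)] st by simp
    next
      case False
      have "H y = K s t y" if "s < y" "y < t" for y using H(2)[OF st(1)] that by simp
      then show ?thesis using dyadic_slopes_cong(2)[where f = H and g = "K s t", OF st(2,3)] Kfix[OF st(1) False] st by blast
    qed
  qed
  have "dyadic_germ H x" if x: "0 < x" "x < 1" for x
  proof (cases "x \<in> E")
    case True
    show ?thesis
    proof (cases "dyadic x")
      case True
      then show ?thesis
        \<comment> \<open>A node is allowed at a dyadic end; it is enough that both slopes are
          powers of 2 and that the value is dyadic.\<close>
        using pow2_slopes_closure[OF HP(1) E(1) x generic] dE[OF \<open>x \<in> E\<close>] HE[OF \<open>x \<in> E\<close>]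
        by (simp add: dyadic_germ_def dyadic_slopes_def)
    next
      case False
      then obtain C i where C: "bump_chain f C" "Suc i < length C" "x = snd (C ! i)"
        using nondyadic_end_inner[OF F(1)] True unfolding E_def by metis
      have i: "i < length C" using C by simp
      have "fst (C ! 0) < x"
        using bump_chain_first_le[OF P(1) C(1) i] bump_domainD(4)[OF P(1) bump_chainD(2)[OF C(1) i]] C(3) by simp
      moreover have "x < snd (C ! Suc i)"
        using bump_chainD(3)[OF C(1,2)] bump_domainD(4)[OF P(1) bump_chainD(2)[OF C(1,2)]] C(3) by simp
      ultimately show ?thesis by (rule claim[OF C(1,2)])
    qed
  qed (use x generic in blast)
  then have "H \<in> thompson_F" using H(1) thompson_F_iff by blast
  then show ?thesis using conj by (rule that)
qed

section \<open>From equal invariants to conjugacy in F\<close>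

text \<open>\<open>h\<close> is increasing, so it carries the concatenated list of bumps of f to
  that of g. Equal invariants give equal lengths of corresponding chains, and by
  \<open>concat_injective\<close> the division into chains is then the same.\<close>

lemma chains_list_eq_if_Delta_eq:
  assumes "f \<in> thompson_F" "g \<in> thompson_F" "h \<in> PL_plus 0 1" "\<And>y. h (f y) = g (h y)"
    and "Delta f = Delta g"
  shows "chains_list g = map (map (map_prod h h)) (chains_list f)"
    "\<And>C. bump_chain f C \<Longrightarrow> chain_class f C = chain_class g (map (map_prod h h) C)"
proof -
  have P: "f \<in> PL_plus 0 1" "g \<in> PL_plus 0 1" using assms by (auto simp: thompson_F_def)
  note h = PL_plus_01[OF assms(3)]
  let ?F = "map (map_prod h h)" and ?xs = "chains_list f" and ?ys = "chains_list g"
  have D: "map (chain_class f) ?xs = map (chain_class g) ?ys" using assms(5) by (simp add: Delta_chains_list)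
  have len: "length ?xs = length ?ys" using map_eq_imp_length_eq[OF D] .
  have cls: "chain_class f (?xs ! t) = chain_class g (?ys ! t)" if "t < length ?xs" for t
    using D len that by (metis nth_map)
  \<comment> \<open>A class contains its own vector, and all its vectors have the length of the
    chain.\<close>
  have lens: "length (?xs ! t) = length (?ys ! t)" if "t < length ?xs" for t
  proof -
    have "chain_vec g (?ys ! t) \<in> chain_class g (?ys ! t)"
      unfolding chain_class_def using chain_rel_refl[of "chain_vec g (?ys ! t)" "?ys ! t" g] by simp
    then have "chain_vec g (?ys ! t) \<in> chain_class f (?xs ! t)" using cls[OF that] by simp
    then show ?thesis by (simp add: chain_class_def chain_rel_def)
  qed
  note cf = concat_chains_list[OF assms(1)] and cg = concat_chains_list[OF assms(2)]
  note cj = conj_bump_domain(1)[OF P assms(3,4)]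
  have "map (map_prod h h) (concat ?xs) = concat ?ys"
  proof (rule map_sorted_distinct_set_unique[of fst])
    have eqm: "map fst (map (map_prod h h) (concat ?xs)) = map h (map fst (concat ?xs))" by (simp add: case_prod_beta)
    have "sorted_wrt (<) (map h (map fst (concat ?xs)))"
      using cf(2) PL_realD(8)[OF h(1)] by (simp add: sorted_wrt_map)
    then have s: "sorted_wrt (<) (map fst (map (map_prod h h) (concat ?xs)))" unfolding eqm .
    then show "sorted (map fst (map (map_prod h h) (concat ?xs)))" "distinct (map fst (map (map_prod h h) (concat ?xs)))"
      using strict_sorted_iff by blast+
    show "sorted (map fst (concat ?ys))" "distinct (map fst (concat ?ys))"
      using cg(2) strict_sorted_iff by blast+
    have "(c, d) \<in> map_prod h h ` {(a, b). bump_domain f a b} \<longleftrightarrow> bump_domain g c d" for c d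
    proof
      assume "bump_domain g c d"
      then have "bump_domain f (inv h c) (inv h d)" using cj PL_realD(6)[OF h(1)] by simp
      moreover have "(c, d) = map_prod h h (inv h c, inv h d)" using PL_realD(6)[OF h(1)] by simp
      ultimately show "(c, d) \<in> map_prod h h ` {(a, b). bump_domain f a b}" by blast
    qed (use cj in auto)
    then show sets: "set (map (map_prod h h) (concat ?xs)) = set (concat ?ys)"
      unfolding set_map cf(1) cg(1) by auto
    show "inj_on fst (set (map (map_prod h h) (concat ?xs)) \<union> set (concat ?ys))"
      unfolding sets cg(1) using bump_domain_unique_left[OF P(2)] by (auto simp: inj_on_def)
  qed
  then have "concat (map ?F ?xs) = concat ?ys" by (simp add: map_concat)
  moreover have "\<forall>(C, C')\<in>set (zip (map ?F ?xs) ?ys). length C = length C'"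
    using lens len by (auto simp: in_set_zip)
  ultimately show eq: "?ys = map ?F ?xs" using concat_injective[of "map ?F ?xs" ?ys] len by simp
  show "chain_class f C = chain_class g (?F C)" if "bump_chain f C" for C
  proof -
    have "C \<in> set ?xs" using chains_list(1)[OF P(1)] that by simp
    then obtain t where t: "t < length ?xs" "C = ?xs ! t" by (metis in_set_conv_nth)
    then show ?thesis using cls[OF t(1)] eq by simp
  qed
qed

text \<open>The exponents that witness the equivalence of the two vectors say which power of the
  root each bumpwise conjugator has to contain; with this choice the start and matching conditions
  of \<open>build_conjugator\<close> hold.\<close>

lemma conj_if_Delta_eq:
  assumes "f \<in> thompson_F" "g \<in> thompson_F" "h \<in> PL_plus 0 1" "\<And>y. h (f y) = g (h y)"
    and "Delta f = Delta g"
  obtains H where "H \<in> thompson_F" "\<And>y. H (f y) = g (H y)"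
proof -
  have P: "f \<in> PL_plus 0 1" "g \<in> PL_plus 0 1" using assms by (auto simp: thompson_F_def)
  let ?F = "map (map_prod h h)"
  note eq = chains_list_eq_if_Delta_eq[OF assms]
  note cf = chains_list(1)[OF P(1)] and cg = chains_list(1)[OF P(2)]
  have img: "{C. bump_chain g C} = ?F ` {C. bump_chain f C}" using eq(1) cf cg by (metis list.set_map)
  have chain: "bump_chain g (?F C)" if "bump_chain f C" for C using img that by blast
  \<comment> \<open>Each p pairs the exponent of 2 with the function of root exponents, so that one
    choice over all chains yields both.\<close>
  have "\<forall>C\<in>{C. bump_chain f C}. \<exists>p. 2 powi (fst p :: int) * chain_vec g (?F C) ! 0 = lam f (C ! 0) powi (snd p 0) * chain_vec f C ! 0 \<and>
     (\<forall>i. Suc i < length C \<longrightarrow> mu f (C ! i) powi (snd p i) * chain_vec g (?F C) ! Suc i = lam f (C ! Suc i) powi (snd p (Suc i)) * chain_vec f C ! Suc i)"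
  proof
    fix C assume "C \<in> {C. bump_chain f C}"
    then have C: "bump_chain f C" by simp
    have "(chain_vec g (?F C), chain_vec f C) \<in> chain_rel f C"
      using eq(2)[OF C] chain_class_eq_iff[OF P(1) C chain_rel_map[OF P assms(3,4) C]] by simp
    then show "\<exists>p. 2 powi (fst p :: int) * chain_vec g (?F C) ! 0 = lam f (C ! 0) powi (snd p 0) * chain_vec f C ! 0 \<and>
     (\<forall>i. Suc i < length C \<longrightarrow> mu f (C ! i) powi (snd p i) * chain_vec g (?F C) ! Suc i = lam f (C ! Suc i) powi (snd p (Suc i)) * chain_vec f C ! Suc i)"
      by (auto simp: chain_rel_def)
  qed
  from bchoice[OF this] obtain p where p: "\<And>C. bump_chain f C \<Longrightarrow>
      2 powi (fst (p C) :: int) * chain_vec g (?F C) ! 0 = lam f (C ! 0) powi (snd (p C) 0) * chain_vec f C ! 0"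
    "\<And>C i. bump_chain f C \<Longrightarrow> Suc i < length C \<Longrightarrow>
      mu f (C ! i) powi (snd (p C) i) * chain_vec g (?F C) ! Suc i = lam f (C ! Suc i) powi (snd (p C) (Suc i)) * chain_vec f C ! Suc i"
    by blast
  \<comment> \<open>Conjugators are chosen bump by bump, so each bump must find its exponent; by
    \<open>bump_chain_unique\<close> it lies in one chain at one index.\<close>
  define pos where "pos = (\<lambda>D. SOME (C, i). bump_chain f C \<and> i < length C \<and> C ! i = D)"
  have pos: "pos (C ! i) = (C, i)" if C: "bump_chain f C" "i < length C" for C i
  proof -
    have "case pos (C ! i) of (C', i') \<Rightarrow> bump_chain f C' \<and> i' < length C' \<and> C' ! i' = C ! i"
      unfolding pos_def by (rule someI[of _ "(C, i)"]) (use C in simp)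
    then show ?thesis using bump_chain_unique[OF P(1) _ C(1) _ C(2)] by (auto split: prod.splits)
  qed
  define n where "n = (\<lambda>D. case pos D of (C, i) \<Rightarrow> snd (p C) i)"
  have n: "n (C ! i) = snd (p C) i" if "bump_chain f C" "i < length C" for C i
    using pos[OF that] by (simp add: n_def)
  define Q where "Q = (\<lambda>D k. conj_between k f (fst D) (snd D) g (h (fst D)) (h (snd D)) \<and>
      right_slope k (fst D) = alpha f D / width D * (width (map_prod h h D) / alpha g (map_prod h h D)) * lam f D powi n D
     \<and> left_slope k (snd D) = beta f D / width D * (width (map_prod h h D) / beta g (map_prod h h D)) * mu f D powi n D)"
  define k where "k = (\<lambda>a b. SOME k. Q (a, b) k)"
  have k: "Q (a, b) (k a b)" if "bump_domain f a b" for a b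
  proof -
    have "\<exists>k. Q (a, b) k" unfolding Q_def using that by (intro conj_slopes_param_chain(2)[OF P assms(3,4)]) simp
    then show ?thesis unfolding k_def by (rule someI_ex)
  qed
  have kC: "right_slope (k (fst (C ! i)) (snd (C ! i))) (fst (C ! i)) =
      alpha f (C ! i) / width (C ! i) * (width (?F C ! i) / alpha g (?F C ! i)) * lam f (C ! i) powi snd (p C) i"
    "left_slope (k (fst (C ! i)) (snd (C ! i))) (snd (C ! i)) =
      beta f (C ! i) / width (C ! i) * (width (?F C ! i) / beta g (?F C ! i)) * mu f (C ! i) powi snd (p C) i"
    if "bump_chain f C" "i < length C" for C i
    using k[OF bump_chainD(2)[OF that]] n[OF that] that(2) by (simp_all add: Q_def)
  have *: "pow2 (right_slope (k (fst (C ! 0)) (snd (C ! 0))) (fst (C ! 0)))"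
    "Suc i < length C \<Longrightarrow> left_slope (k (fst (C ! i)) (snd (C ! i))) (snd (C ! i)) =
      right_slope (k (fst (C ! Suc i)) (snd (C ! Suc i))) (fst (C ! Suc i))"
    if C: "bump_chain f C" for C i
  proof -
    note iff = chain_slopes_iff[OF P C chain[OF C] length_map kC[OF C]]
    show "pow2 (right_slope (k (fst (C ! 0)) (snd (C ! 0))) (fst (C ! 0)))"
      using iff(1)[of "2 powi fst (p C)"] p(1)[OF C] unfolding pow2_def by metis
    show "Suc i < length C \<Longrightarrow> left_slope (k (fst (C ! i)) (snd (C ! i))) (snd (C ! i)) =
      right_slope (k (fst (C ! Suc i)) (snd (C ! Suc i))) (fst (C ! Suc i))"
      using iff(2) p(2)[OF C] by blast
  qed
  show ?thesis
  proof (rule build_conjugator[OF assms(1-4) _ chain _ *])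
    show "conj_between (k a b) f a b g (h a) (h b)" if "bump_domain f a b" for a b
      using k[OF that] by (simp add: Q_def)
    show "\<exists>C. bump_chain f C \<and> C' = ?F C" if "bump_chain g C'" for C' using img that by blast
  qed (use that in auto)
qed

lemma conjugate_in_iff:
  assumes "\<And>h. h \<in> G \<Longrightarrow> bij h"
  shows "conjugate_in G f g \<longleftrightarrow> (\<exists>h\<in>G. \<forall>y. h (f y) = g (h y))"
proof -
  have "g = h \<circ> f \<circ> inv h \<longleftrightarrow> (\<forall>y. h (f y) = g (h y))" if "h \<in> G" for h
  proof
    assume "g = h \<circ> f \<circ> inv h"
    then show "\<forall>y. h (f y) = g (h y)" using assms[OF that] by (simp add: bij_is_inj)
  next
    assume "\<forall>y. h (f y) = g (h y)"
    then show "g = h \<circ> f \<circ> inv h" using assms[OF that] by (simp add: fun_eq_iff bij_is_surj surj_f_inv_f)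
  qed
  then show ?thesis unfolding conjugate_in_def by blast
qed

theorem proposition1p2:
  fixes f g :: "real \<Rightarrow> real"
  assumes "f \<in> thompson_F" and "g \<in> thompson_F"
    and "conjugate_in (PL_plus 0 1) f g"
  shows "conjugate_in thompson_F f g \<longleftrightarrow> Delta f = Delta g"
proof -
  have bij: "\<And>h. h \<in> PL_plus 0 1 \<Longrightarrow> bij h" "\<And>h. h \<in> thompson_F \<Longrightarrow> bij h"
    using PL_realD(3) PL_plus_01(1) by (auto simp: thompson_F_def)
  have "conjugate_in (PL_plus 0 1) f g \<longleftrightarrow> (\<exists>h\<in>PL_plus 0 1. \<forall>y. h (f y) = g (h y))"
    by (rule conjugate_in_iff) (rule bij(1))
  then obtain h where h: "h \<in> PL_plus 0 1" "\<And>y. h (f y) = g (h y)" using assms(3) by blast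
  have iff: "conjugate_in thompson_F f g \<longleftrightarrow> (\<exists>h\<in>thompson_F. \<forall>y. h (f y) = g (h y))"
    by (rule conjugate_in_iff) (rule bij(2))
  show ?thesis
  proof
    assume "conjugate_in thompson_F f g"
    then show "Delta f = Delta g" unfolding iff using Delta_eq_if_conj[OF assms(1,2)] by blast
  next
    assume "Delta f = Delta g"
    then show "conjugate_in thompson_F f g" unfolding iff using conj_if_Delta_eq[OF assms(1,2) h] by blast
  qed
qed

end
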